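(* Let $\pi$ and $\pi'$ be smooth $\mathcal O[G]$-modules. Suppose that $\pi$ has finite length and that every irreducible subquotient of $\pi$ admits a central character. Let $\phi\in\mathrm{Hom}_{\mathcal O[P]}(\pi,\pi')$ and suppose $\phi$ is not $G$-equivariant. Let $\tau=\{w\in\pi:\ \phi(gw)=g\phi(w)\ \forall g\in G\}$ (the maximal $\mathcal O[G]$-submodule of $\pi$ on which $\phi$ is $G$-equivariant), and let $\sigma$ be an irreducible $G$-submodule of $\pi/\tau$. Then $\sigma\cong\mathrm{Sp}\otimes\delta\circ\det$ for some smooth character $\delta:F^\times\to\overline{\mathbf F}_p^\times$. Moreover, if $v\in\pi$ is chosen such that its image $\bar v$ in $\sigma$ spans $\sigma^{I_1}$, then $\Pi\phi(v)-\phi(\Pi v)\neq0$, $\varpi_E(\Pi\phi(v)-\phi(\Pi v))=0$, and $$g\big(\Pi\phi(v)-\phi(\Pi v)\big)=\delta(\det g)\big(\Pi\phi(v)-\phi(\Pi v)\big)\quad\text{for all }g\in G.$$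
   Context: $F$ non-Archimedean local field with ring of integers $\mathfrak o$, maximal ideal $\mathfrak p$, uniformizer $\varpi$, residual characteristic $p$. $G=\mathrm{GL}_2(F)$, $P$ the upper triangular Borel subgroup, $I_1=\begin{pmatrix}1+\mathfrak p&\mathfrak o\\ \mathfrak p&1+\mathfrak p\end{pmatrix}$, $\Pi=\begin{pmatrix}0&1\\ \varpi&0\end{pmatrix}$. $E$ is a complete discretely valued field with ring of integers $\mathcal O$, uniformizer $\varpi_E$ and residue field $\mathcal O/\varpi_E\mathcal O\cong\overline{\mathbf F}_p$. A smooth $\mathcal O[G]$-module is an $\mathcal O$-module with a linear $G$-action such that every vector has open stabilizer; irreducible ones are killed by $\varpi_E$, hence are smooth $\overline{\mathbf F}_p$-representations. $\mathrm{Sp}$ is defined by $0\to\mathbf 1\to\mathrm{Ind}_P^G\mathbf 1\to\mathrm{Sp}\to0$, where $\mathrm{Ind}_P^G\mathbf 1$ is the space of locally constant functions $f:G\to\overline{\mathbf F}_p$ left invariant under $P$, with $G$ acting by right translation. *)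

theory Defs
  imports "HOL-Computational_Algebra.Polynomial" "HOL-Computational_Algebra.Primes"
begin

text \<open>F is modelled by a type 'f of class field together with a normalised
discrete valuation val (the value at 0 is irrelevant), a uniformizer and the
residual characteristic p.\<close>

definition in_pow :: "('f::field \<Rightarrow> int) \<Rightarrow> int \<Rightarrow> 'f \<Rightarrow> bool" where
  "in_pow val N x \<longleftrightarrow> x = 0 \<or> val x \<ge> N"

abbreviation in_o where "in_o val x \<equiv> in_pow val 0 x"
abbreviation in_p where "in_p val x \<equiv> in_pow val 1 x"

definition nonarch_local_field ::
  "('f::field \<Rightarrow> int) \<Rightarrow> 'f \<Rightarrow> nat \<Rightarrow> bool" where
  "nonarch_local_field val uf p \<longleftrightarrow>
     (\<forall>x y. x \<noteq> 0 \<longrightarrow> y \<noteq> 0 \<longrightarrow> val (x * y) = val x + val y) \<and>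
     (\<forall>x y. x \<noteq> 0 \<longrightarrow> y \<noteq> 0 \<longrightarrow> x + y \<noteq> 0 \<longrightarrow> val (x + y) \<ge> min (val x) (val y)) \<and>
     uf \<noteq> 0 \<and> val uf = 1 \<and>
     \<comment> \<open>completeness\<close>
     (\<forall>s::nat \<Rightarrow> 'f. (\<forall>N. \<exists>M. \<forall>m\<ge>M. \<forall>n\<ge>M. in_pow val N (s m - s n)) \<longrightarrow>
         (\<exists>L. \<forall>N. \<exists>M. \<forall>n\<ge>M. in_pow val N (s n - L))) \<and>
     \<comment> \<open>finite residue field o/p of characteristic p\<close>
     (\<exists>R. finite R \<and> (\<forall>a. in_o val a \<longrightarrow> (\<exists>r\<in>R. in_o val r \<and> in_p val (a - r)))) \<and>
     prime p \<and> in_p val (of_nat p)"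

datatype 'a m2 = M2 'a 'a 'a 'a   \<comment> \<open>M2 a b c d = matrix (a b; c d)\<close>

fun m2mult :: "'a::comm_ring_1 m2 \<Rightarrow> 'a m2 \<Rightarrow> 'a m2" where
  "m2mult (M2 a b c d) (M2 a' b' c' d') =
     M2 (a*a' + b*c') (a*b' + b*d') (c*a' + d*c') (c*b' + d*d')"

fun m2det :: "'a::comm_ring_1 m2 \<Rightarrow> 'a" where
  "m2det (M2 a b c d) = a*d - b*c"

definition m2one :: "'a::comm_ring_1 m2" where "m2one = M2 1 0 0 1"

definition scalar_m2 :: "'a::comm_ring_1 \<Rightarrow> 'a m2" where "scalar_m2 z = M2 z 0 0 z"

definition GL2 :: "'f::field m2 set" where "GL2 = {g. m2det g \<noteq> 0}"

definition Borel :: "'f::field m2 set" where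
  "Borel = {M2 a b c d | a b c d. c = 0 \<and> a \<noteq> 0 \<and> d \<noteq> 0}"

definition Iwahori1 :: "('f::field \<Rightarrow> int) \<Rightarrow> 'f m2 set" where
  "Iwahori1 val = {M2 a b c d | a b c d.
      in_p val (a - 1) \<and> in_o val b \<and> in_p val c \<and> in_p val (d - 1)}"

text \<open>Principal congruence subgroups K(n) = 1 + M_2(p^n), n \<ge> 1; they form a basis of
open neighbourhoods of 1 in G.\<close>
definition Kcong :: "('f::field \<Rightarrow> int) \<Rightarrow> nat \<Rightarrow> 'f m2 set" where
  "Kcong val n = {M2 a b c d | a b c d.
      in_pow val (int n) (a - 1) \<and> in_pow val (int n) b \<and> in_pow val (int n) c
      \<and> in_pow val (int n) (d - 1)}"

definition PiElt :: "'f::field \<Rightarrow> 'f m2" where "PiElt uf = M2 0 1 uf 0"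

definition alg_closure_Fp :: "nat \<Rightarrow> 'k::field itself \<Rightarrow> bool" where
  "alg_closure_Fp p _ \<longleftrightarrow>
     of_nat p = (0::'k) \<and>
     (\<forall>q::'k poly. degree q > 0 \<longrightarrow> (\<exists>x. poly q x = 0)) \<and>
     (\<forall>x::'k. \<exists>q::'k poly. q \<noteq> 0 \<and> (\<forall>i. coeff q i \<in> range of_nat) \<and> poly q x = 0)"

definition complete_dvr_with_residue ::
  "'o::idom \<Rightarrow> ('o \<Rightarrow> 'k::field) \<Rightarrow> bool" where
  "complete_dvr_with_residue uE red \<longleftrightarrow>
     uE \<noteq> 0 \<and> \<not> uE dvd 1 \<and>
     (\<forall>x. x \<noteq> 0 \<longrightarrow> (\<exists>u n. u dvd 1 \<and> x = u * uE ^ n)) \<and>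
     (\<forall>s::nat \<Rightarrow> 'o. (\<forall>n. uE ^ n dvd (s (Suc n) - s n)) \<longrightarrow>
         (\<exists>L. \<forall>n. uE ^ n dvd (L - s n))) \<and>
     red 1 = 1 \<and> (\<forall>a b. red (a + b) = red a + red b) \<and> (\<forall>a b. red (a * b) = red a * red b) \<and>
     surj red \<and> (\<forall>a. red a = 0 \<longleftrightarrow> uE dvd a)"

text \<open>A module is a type 'v with the abelian group structure, an O-scalar
multiplication sm and an action ac of G = GL_2(F) (only its values on G matter).\<close>
definition smooth_OG_module ::
  "('f::field \<Rightarrow> int) \<Rightarrow> ('o::comm_ring_1 \<Rightarrow> 'v::ab_group_add \<Rightarrow> 'v) \<Rightarrow> ('f m2 \<Rightarrow> 'v \<Rightarrow> 'v) \<Rightarrow> bool" where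
  "smooth_OG_module val sm ac \<longleftrightarrow>
     (\<forall>a x y. sm a (x + y) = sm a x + sm a y) \<and>
     (\<forall>a b x. sm (a + b) x = sm a x + sm b x) \<and>
     (\<forall>a b x. sm (a * b) x = sm a (sm b x)) \<and>
     (\<forall>x. sm 1 x = x) \<and>
     (\<forall>g\<in>GL2. \<forall>x y. ac g (x + y) = ac g x + ac g y) \<and>
     (\<forall>g\<in>GL2. \<forall>a x. ac g (sm a x) = sm a (ac g x)) \<and>
     (\<forall>x. ac m2one x = x) \<and>
     (\<forall>g\<in>GL2. \<forall>h\<in>GL2. \<forall>x. ac (m2mult g h) x = ac g (ac h x)) \<and>
     (\<forall>x. \<exists>n\<ge>1. \<forall>k\<in>Kcong val n. ac k x = x)"

definition OG_submodule ::
  "('o \<Rightarrow> 'v::ab_group_add \<Rightarrow> 'v) \<Rightarrow> ('f::field m2 \<Rightarrow> 'v \<Rightarrow> 'v) \<Rightarrow> 'v set \<Rightarrow> bool" where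
  "OG_submodule sm ac M \<longleftrightarrow>
     0 \<in> M \<and> (\<forall>x\<in>M. \<forall>y\<in>M. x + y \<in> M) \<and> (\<forall>x\<in>M. - x \<in> M) \<and>
     (\<forall>a. \<forall>x\<in>M. sm a x \<in> M) \<and> (\<forall>g\<in>GL2. \<forall>x\<in>M. ac g x \<in> M)"

definition irred_subquot ::
  "('o \<Rightarrow> 'v::ab_group_add \<Rightarrow> 'v) \<Rightarrow> ('f::field m2 \<Rightarrow> 'v \<Rightarrow> 'v) \<Rightarrow> 'v set \<Rightarrow> 'v set \<Rightarrow> bool" where
  "irred_subquot sm ac A B \<longleftrightarrow>
     OG_submodule sm ac A \<and> OG_submodule sm ac B \<and> A \<subset> B \<and>
     (\<forall>N. OG_submodule sm ac N \<longrightarrow> A \<subseteq> N \<longrightarrow> N \<subseteq> B \<longrightarrow> N = A \<or> N = B)"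

definition finite_length ::
  "('o \<Rightarrow> 'v::ab_group_add \<Rightarrow> 'v) \<Rightarrow> ('f::field m2 \<Rightarrow> 'v \<Rightarrow> 'v) \<Rightarrow> bool" where
  "finite_length sm ac \<longleftrightarrow>
     (\<exists>n (M::nat \<Rightarrow> 'v set). M 0 = {0} \<and> M n = UNIV \<and>
        (\<forall>i<n. irred_subquot sm ac (M i) (M (Suc i))))"

definition has_central_char ::
  "('o \<Rightarrow> 'v::ab_group_add \<Rightarrow> 'v) \<Rightarrow> ('f::field m2 \<Rightarrow> 'v \<Rightarrow> 'v) \<Rightarrow> 'v set \<Rightarrow> 'v set \<Rightarrow> bool" where
  "has_central_char sm ac A B \<longleftrightarrow>
     (\<exists>\<chi>::'f \<Rightarrow> 'o. \<forall>z. z \<noteq> 0 \<longrightarrow> (\<forall>b\<in>B. ac (scalar_m2 z) b - sm (\<chi> z) b \<in> A))"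

definition smooth_char :: "('f::field \<Rightarrow> int) \<Rightarrow> ('f \<Rightarrow> 'k::field) \<Rightarrow> bool" where
  "smooth_char val \<delta> \<longleftrightarrow>
     (\<forall>x. x \<noteq> 0 \<longrightarrow> \<delta> x \<noteq> 0) \<and>
     (\<forall>x y. x \<noteq> 0 \<longrightarrow> y \<noteq> 0 \<longrightarrow> \<delta> (x * y) = \<delta> x * \<delta> y) \<and>
     (\<exists>n\<ge>1. \<forall>u. in_pow val (int n) (u - 1) \<longrightarrow> \<delta> u = 1)"

definition IndP1 :: "('f::field \<Rightarrow> int) \<Rightarrow> ('f m2 \<Rightarrow> 'k::field) set" where
  "IndP1 val = {f. (\<forall>x. x \<notin> GL2 \<longrightarrow> f x = 0) \<and>
      (\<forall>b\<in>Borel. \<forall>g\<in>GL2. f (m2mult b g) = f g) \<and>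
      (\<forall>g\<in>GL2. \<exists>n\<ge>1. \<forall>k\<in>Kcong val n. f (m2mult g k) = f g)}"

text \<open>Equality in Sp = Ind_P^G 1 / 1, i.e. modulo constant functions.\<close>
definition eq_mod_const :: "('f::field m2 \<Rightarrow> 'k::field) \<Rightarrow> ('f m2 \<Rightarrow> 'k) \<Rightarrow> bool" where
  "eq_mod_const f1 f2 \<longleftrightarrow> (\<exists>c. \<forall>g\<in>GL2. f1 g - f2 g = c)"

text \<open>h induces an isomorphism of O[G]-modules S/T \<cong> Sp \<otimes> \<delta>\<circ>det, where O acts on
the right-hand side through red and g acts by (g.f)(x) = \<delta>(det g) f(x g).\<close>
definition iso_quot_Sp_twist ::
  "('f::field \<Rightarrow> int) \<Rightarrow> ('o \<Rightarrow> 'k::field) \<Rightarrow> ('o \<Rightarrow> 'v::ab_group_add \<Rightarrow> 'v) \<Rightarrow> ('f m2 \<Rightarrow> 'v \<Rightarrow> 'v)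
   \<Rightarrow> 'v set \<Rightarrow> 'v set \<Rightarrow> ('f \<Rightarrow> 'k) \<Rightarrow> ('v \<Rightarrow> 'f m2 \<Rightarrow> 'k) \<Rightarrow> bool" where
  "iso_quot_Sp_twist val red sm ac T S \<delta> h \<longleftrightarrow>
     (\<forall>s\<in>S. h s \<in> IndP1 val) \<and>
     (\<forall>s\<in>S. \<forall>t\<in>S. eq_mod_const (h (s + t)) (\<lambda>x. h s x + h t x)) \<and>
     (\<forall>a. \<forall>s\<in>S. eq_mod_const (h (sm a s)) (\<lambda>x. red a * h s x)) \<and>
     (\<forall>g\<in>GL2. \<forall>s\<in>S. eq_mod_const (h (ac g s)) (\<lambda>x. \<delta> (m2det g) * h s (m2mult x g))) \<and>
     (\<forall>s\<in>S. eq_mod_const (h s) (\<lambda>x. 0) \<longleftrightarrow> s \<in> T) \<and>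
     (\<forall>f\<in>IndP1 val. \<exists>s\<in>S. eq_mod_const (h s) f)"

end

theory Submission
  imports Defs "HOL-Library.Function_Algebras"
begin

text \<open>To \<open>y\<close> in \<open>S\<close> attach the function \<open>f(g) = g \<phi>(y) - \<phi>(g y)\<close> on \<open>G\<close>. It vanishes identically
exactly when \<open>y\<close> lies in \<open>\<tau>\<close>, it vanishes on \<open>P\<close> and satisfies \<open>f(b g) = b f(g)\<close> for \<open>b\<close> in \<open>P\<close>; so it is
determined by the compactly supported function \<open>u \<mapsto> f(s n(u))\<close>, where \<open>s\<close> is the Weyl element and
\<open>n(u)\<close> is upper unipotent. Thus \<open>S / \<tau>\<close> becomes an irreducible module of functions with values in \<open>\<pi>'\<close>.

Suppose first that the uniformizer of \<open>O\<close> does not kill it; then it is divisible. The values at \<open>s\<close>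
form a divisible module, finitely generated over \<open>O[\<theta>, \<theta>\<^sup>-\<^sup>1]\<close> with \<open>\<theta> = diag(1, uf)\<close>. Nakayama's lemma,
the fact that a smooth vector fixed by the upper unipotents is fixed by \<open>SL\<^sub>2\<close>, and the central character
make this module zero.

So it is a representation over the residue field. An irreducible type of the maximal compact subgroup has
a one-dimensional space of unipotent invariants, and comparing translates of this type shows that the Hecke operator
\<open>U\<close> has an eigenvector on the Iwahori invariants. An eigenvalue 0 would produce a type whose functions have
smaller support, so after finitely many steps there is an eigenvector \<open>w\<close> with nonzero eigenvalue. The function
\<open>u \<mapsto> w(s n(u))\<close> is then the characteristic function of the integers times a vector \<open>x\<close> fixed by the unipotents,
hence by \<open>SL\<^sub>2\<close>, so \<open>G\<close> acts on \<open>x\<close> through \<open>\<delta> \<circ> det\<close>. By irreducibility all functions take values in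
the line of \<open>x\<close>, and dividing by \<open>\<delta> \<circ> det\<close> identifies the module with the locally constant functions on
the quotient of \<open>G\<close> by \<open>P\<close> modulo constants.\<close>

section \<open>Arithmetic of the local field\<close>

text \<open>To this end an expression of a vector by Borel translates of a type gets a total in the
  residue field, the sum of its coinvariants. \<open>U\<close> replaces a term by as many terms as
  o/p has elements, so it makes totals 0 in characteristic p, and two successive images under
  \<open>U\<close> leave room to cancel the totals after s as well. By irreducibility a nonzero
  vector with both totals 0 conflicts with the total 1 of s v, unless a nonzero formal combination
  has value 0. Integral translations act on such combinations through a finite abelian p-group, so
  there is an invariant one; as the unipotent invariants of the type form a line, it is a polynomial
  in \<open>U\<close> applied to v. The divisible case is removed beforehand because this is linear
  algebra over the residue field. There the difficulty is that the module of positive powers of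
  \<theta> must be shown to be separated for the uniformizer.\<close>

locale local_field =
  fixes val :: "'f::field \<Rightarrow> int" and uf :: 'f and p :: nat
  assumes nalf: "nonarch_local_field val uf p"
begin

abbreviation pw :: "int \<Rightarrow> 'f \<Rightarrow> bool" where "pw \<equiv> in_pow val"

definition ou :: "'f \<Rightarrow> bool" where "ou x \<longleftrightarrow> x \<noteq> 0 \<and> val x = 0"

lemma val_mult: "x \<noteq> 0 \<Longrightarrow> y \<noteq> 0 \<Longrightarrow> val (x * y) = val x + val y"
  using nalf unfolding nonarch_local_field_def by blast

lemma val_add: "x \<noteq> 0 \<Longrightarrow> y \<noteq> 0 \<Longrightarrow> x + y \<noteq> 0 \<Longrightarrow> min (val x) (val y) \<le> val (x + y)"
  using nalf unfolding nonarch_local_field_def by blast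

lemma uf_nz [simp]: "uf \<noteq> 0" and val_uf [simp]: "val uf = 1"
  and prime_p: "prime p" and pw_p: "pw 1 (of_nat p)"
  using nalf unfolding nonarch_local_field_def by blast+

lemma val_one [simp]: "val 1 = 0"
  using val_mult[of 1 1] by simp

lemma val_minus [simp]: "val (- x) = val x"
proof (cases "x = 0")
  case False
  have "val ((-1) * (-1)) = val (-1) + val (-1)" by (intro val_mult) auto
  hence "val (-1) = 0" by simp
  with val_mult[of "-1" x] False show ?thesis by simp
qed simp

lemma val_inverse: "x \<noteq> 0 \<Longrightarrow> val (inverse x) = - val x"
  using val_mult[of x "inverse x"] by simp

lemma val_divide: "x \<noteq> 0 \<Longrightarrow> y \<noteq> 0 \<Longrightarrow> val (x / y) = val x - val y"
  using val_mult[of x "inverse y"] val_inverse[of y] by (simp add: divide_inverse)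

lemma val_power [simp]: "x \<noteq> 0 \<Longrightarrow> val (x ^ n) = int n * val x"
  by (induction n) (auto simp: val_mult algebra_simps)

lemma val_powi [simp]: "x \<noteq> 0 \<Longrightarrow> val (x powi j) = j * val x"
proof (cases "j \<ge> 0")
  case True
  thus "x \<noteq> 0 \<Longrightarrow> ?thesis" by (simp add: power_int_def)
next
  case False
  assume x: "x \<noteq> 0"
  have "x powi j = inverse (x ^ nat (- j))" using False by (simp add: power_int_def power_inverse)
  thus ?thesis using False x by (simp add: val_inverse)
qed

lemma pw_0 [simp]: "pw N 0" by (simp add: in_pow_def)
lemma pw_1 [simp]: "pw N 1 \<longleftrightarrow> N \<le> 0" by (simp add: in_pow_def)
lemma pw_uminus [simp]: "pw N (- x) \<longleftrightarrow> pw N x" by (simp add: in_pow_def)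
lemma pw_add: "pw N x \<Longrightarrow> pw N y \<Longrightarrow> pw N (x + y)"
  using val_add[of x y] unfolding in_pow_def by (cases "x = 0"; cases "y = 0"; cases "x + y = 0") auto
lemma pw_diff: "pw N x \<Longrightarrow> pw N y \<Longrightarrow> pw N (x - y)"
  using pw_add[of N x "- y"] by simp
lemma pw_diff_commute: "pw N (x - y) \<Longrightarrow> pw N (y - x)"
  using pw_uminus[of N "x - y"] by simp
lemma pw_trans: "pw N (x - y) \<Longrightarrow> pw N (y - z) \<Longrightarrow> pw N (x - z)"
  using pw_add[of N "x - y" "y - z"] by simp
lemma pw_mult: "pw M x \<Longrightarrow> pw N y \<Longrightarrow> pw (M + N) (x * y)"
  unfolding in_pow_def by (cases "x = 0"; cases "y = 0") (auto simp: val_mult)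
lemma pw_mono: "pw M x \<Longrightarrow> N \<le> M \<Longrightarrow> pw N x" unfolding in_pow_def by auto
lemma pw_mult_o: "pw 0 x \<Longrightarrow> pw N y \<Longrightarrow> pw N (x * y)" using pw_mult[of 0 x N y] by simp
lemma pw_mult_o': "pw N x \<Longrightarrow> pw 0 y \<Longrightarrow> pw N (x * y)" using pw_mult[of N x 0 y] by simp
lemma pw_divide: "y \<noteq> 0 \<Longrightarrow> pw N x \<Longrightarrow> pw (N - val y) (x / y)"
  unfolding in_pow_def by (cases "x = 0") (auto simp: val_divide)

lemma pw_divide_iff: "y \<noteq> 0 \<Longrightarrow> pw N (x / y) \<longleftrightarrow> pw (N + val y) x"
  unfolding in_pow_def by (cases "x = 0") (auto simp: val_divide)

lemma pw_mult_iff: "y \<noteq> 0 \<Longrightarrow> pw N (y * x) \<longleftrightarrow> pw (N - val y) x"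
  unfolding in_pow_def by (cases "x = 0") (auto simp: val_mult)

lemma ou_pw: "ou x \<Longrightarrow> pw 0 x" by (simp add: ou_def in_pow_def)
lemma ou_1 [simp]: "ou 1" by (simp add: ou_def)
lemma ou_minus [simp]: "ou (- x) \<longleftrightarrow> ou x" by (simp add: ou_def)
lemma ou_mult: "ou x \<Longrightarrow> ou y \<Longrightarrow> ou (x * y)" by (simp add: ou_def val_mult)
lemma ou_divide: "ou x \<Longrightarrow> ou y \<Longrightarrow> ou (x / y)" by (simp add: ou_def val_divide)
lemma ou_iff: "ou x \<longleftrightarrow> pw 0 x \<and> \<not> pw 1 x" by (auto simp: ou_def in_pow_def)

lemma ou_cong: "ou y \<Longrightarrow> pw 1 (x - y) \<Longrightarrow> ou x"
proof -
  assume a: "ou y" "pw 1 (x - y)"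
  have "pw 0 x" using pw_add[of 0 "x - y" y] a pw_mono[of 1 "x - y" 0] by (simp add: ou_iff)
  moreover have "\<not> pw 1 x" using pw_diff[of 1 x "x - y"] a by (auto simp: ou_iff)
  ultimately show ?thesis by (simp add: ou_iff)
qed

lemma pw_Suc_uf: "pw (int j) x \<longleftrightarrow> pw 0 (x / uf ^ j)"
  by (subst pw_divide_iff) auto

lemma pw_of_nat: "pw 0 (of_nat m)" by (induction m) (auto intro: pw_add)

lemma pw_of_nat_pow: "pw (int m) (of_nat (p ^ m))"
  by (induction m) (use pw_mult[OF pw_p] in auto)

section \<open>Representatives of o modulo powers of p\<close>

definition transv :: "nat \<Rightarrow> 'f set \<Rightarrow> bool" where
  "transv j R \<longleftrightarrow> finite R \<and> (\<forall>r\<in>R. pw 0 r) \<and>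
     (\<forall>a. pw 0 a \<longrightarrow> (\<exists>r\<in>R. pw (int j) (a - r))) \<and>
     (\<forall>r\<in>R. \<forall>r'\<in>R. pw (int j) (r - r') \<longrightarrow> r = r')"

lemma ex_transv1: "\<exists>R. transv 1 R \<and> 0 \<in> R"
proof -
  obtain R0 where R0: "finite R0" "\<And>a. pw 0 a \<Longrightarrow> \<exists>r\<in>R0. pw 0 r \<and> pw 1 (a - r)"
    using nalf unfolding nonarch_local_field_def by blast
  \<comment> \<open>The representative depends on the class alone, since congruent elements give
    \<open>SOME\<close> the same predicate. The class of p is represented by 0: later sums isolate
    the term \<open>r = 0\<close> and need all other representatives to be units.\<close>
  define rp where "rp a = (if pw 1 a then 0 else SOME b. pw 0 b \<and> pw 1 (a - b))" for a
  have rp: "pw 0 (rp a) \<and> pw 1 (a - rp a)" if "pw 0 a" for a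
  proof (cases "pw 1 a")
    case False
    have "\<exists>b. pw 0 b \<and> pw 1 (a - b)" using that by (intro exI[of _ a]) auto
    from someI_ex[OF this] show ?thesis using False by (simp add: rp_def)
  qed (simp add: rp_def)
  have rpc: "rp a = rp b" if "pw 1 (a - b)" for a b
  proof -
    have "pw 1 (a - c) \<longleftrightarrow> pw 1 (b - c)" for c
      using that pw_trans[of 1 a b c] pw_trans[of 1 b a c] pw_diff_commute[of 1 a b] by blast
    moreover from this[of 0] have "pw 1 a \<longleftrightarrow> pw 1 b" by simp
    ultimately show ?thesis unfolding rp_def by presburger
  qed
  define R where "R = rp ` {a. pw 0 a}"
  have "R \<subseteq> rp ` R0" unfolding R_def using R0(2) rpc by blast
  hence "finite R" using R0(1) finite_surj by blast
  moreover have "r = r'" if "r \<in> R" "r' \<in> R" "pw 1 (r - r')" for r r'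
  proof -
    obtain a a' where a: "pw 0 a" "pw 0 a'" "r = rp a" "r' = rp a'" using \<open>r \<in> R\<close> \<open>r' \<in> R\<close> R_def by auto
    have "pw 1 (a - a')" using pw_trans[of 1 a r r'] pw_trans[of 1 a r' a'] rp[of a] rp[of a'] a that
      pw_diff_commute[of 1 a' r'] by auto
    thus ?thesis using rpc a by auto
  qed
  moreover have "0 \<in> R" unfolding R_def by (rule image_eqI[of _ _ 0]) (auto simp: rp_def)
  ultimately have "transv 1 R \<and> 0 \<in> R"
    unfolding transv_def R_def using rp by auto
  thus ?thesis by blast
qed

definition R :: "'f set" where "R = (SOME R. transv 1 R \<and> 0 \<in> R)"

lemma transv_R: "transv 1 R" and zero_R: "0 \<in> R"
  using someI_ex[OF ex_transv1] unfolding R_def by blast+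

lemma fin_R [simp]: "finite R" using transv_R by (simp add: transv_def)
lemma R_pw: "r \<in> R \<Longrightarrow> pw 0 r" using transv_R by (simp add: transv_def)

lemma R_ou: "r \<in> R \<Longrightarrow> r \<noteq> 0 \<Longrightarrow> ou r"
  using transv_R zero_R unfolding transv_def ou_iff by fastforce

text \<open>Truncated expansions r_0 + uf r_1 + ... with digits in \<open>R\<close>. This choice of
  representatives makes a power of the Hecke operator a single sum in \<open>U_pow\<close>.\<close>

primrec RR :: "nat \<Rightarrow> 'f set" where
  "RR 0 = {0}"
| "RR (Suc j) = (\<lambda>(r, u). r + uf * u) ` (R \<times> RR j)"

lemma pw_uf_cancel: "pw (N + 1) (uf * x) \<longleftrightarrow> pw N x"
  by (subst pw_mult_iff) auto

lemma RR_inj_aux: assumes "transv 1 R'" "r \<in> R'" "r' \<in> R'" "pw 0 u" "pw 0 u'" "pw (int (Suc j)) ((r + uf * u) - (r' + uf * u'))"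
  shows "r = r' \<and> pw (int j) (u - u')"
proof -
  have u: "pw 0 (u - u')" using assms pw_diff by blast
  hence u1: "pw 1 (uf * (u - u'))" using pw_uf_cancel[of 0 "u - u'"] by simp
  have eq: "r - r' = ((r + uf * u) - (r' + uf * u')) - uf * (u - u')" by (simp add: algebra_simps)
  have "pw 1 (r - r')" unfolding eq by (rule pw_diff[OF pw_mono[OF assms(6)] u1]) simp
  hence "r = r'" using assms by (auto simp: transv_def)
  thus ?thesis using assms(6) pw_uf_cancel[of "int j" "u - u'"] by (simp add: algebra_simps)
qed

lemma transv_RR: "transv j (RR j)"
proof (induction j)
  case 0
  show ?case by (auto simp: transv_def)
next
  case (Suc j)
  have fin: "finite (RR (Suc j))" using Suc by (auto simp: transv_def)
  have mem: "pw 0 x" if "x \<in> RR (Suc j)" for x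
  proof -
    obtain r u where ru: "r \<in> R" "u \<in> RR j" "x = r + uf * u" using \<open>x \<in> RR (Suc j)\<close> by auto
    moreover have "pw 0 (uf * u)" using Suc ru pw_mult_o[of uf 0 u] by (auto simp: transv_def in_pow_def)
    ultimately show ?thesis using R_pw pw_add by blast
  qed
  have cov: "\<exists>r\<in>RR (Suc j). pw (int (Suc j)) (a - r)" if "pw 0 a" for a
  proof -
    obtain r where r: "r \<in> R" "pw 1 (a - r)" using transv_R \<open>pw 0 a\<close> by (auto simp: transv_def)
    have "pw 0 ((a - r) / uf)" using r(2) pw_divide[of uf 1] by simp
    then obtain u where u: "u \<in> RR j" "pw (int j) ((a - r) / uf - u)" using Suc by (auto simp: transv_def)
    have "pw (int j + 1) (uf * ((a - r) / uf - u))" using u(2) by (simp add: pw_uf_cancel)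
    moreover have "uf * ((a - r) / uf - u) = a - (r + uf * u)" by (simp add: field_simps)
    ultimately have "pw (int (Suc j)) (a - (r + uf * u))" by (simp add: add.commute)
    thus ?thesis using r(1) u(1) by (intro bexI[of _ "r + uf * u"]) auto
  qed
  have inj: "x = y" if "x \<in> RR (Suc j)" "y \<in> RR (Suc j)" "pw (int (Suc j)) (x - y)" for x y
  proof -
    obtain r u r' u' where "r \<in> R" "u \<in> RR j" "x = r + uf * u" "r' \<in> R" "u' \<in> RR j" "y = r' + uf * u'"
      using \<open>x \<in> RR (Suc j)\<close> \<open>y \<in> RR (Suc j)\<close> by auto
    moreover from this that(3) Suc have "r = r' \<and> pw (int j) (u - u')"
      by (intro RR_inj_aux[OF transv_R]) (auto simp: transv_def)
    ultimately show ?thesis using Suc by (auto simp: transv_def)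
  qed
  show ?case using fin mem cov inj unfolding transv_def by blast
qed

lemma fin_RR [simp]: "finite (RR j)" using transv_RR by (simp add: transv_def)
lemma RR_pw: "r \<in> RR j \<Longrightarrow> pw 0 r" using transv_RR by (simp add: transv_def)

lemma sum_RR_Suc: "sum g (RR (Suc j)) = (\<Sum>r\<in>R. \<Sum>u\<in>RR j. g (r + uf * u))"
proof -
  have "inj_on (\<lambda>(r, u). r + uf * u) (R \<times> RR j)"
  proof (intro inj_onI, clarify)
    fix r u r' u' assume *: "r \<in> R" "u \<in> RR j" "r' \<in> R" "u' \<in> RR j" "r + uf * u = r' + uf * u'"
    hence "r = r' \<and> pw (int j) (u - u')"
      by (intro RR_inj_aux[OF transv_R]) (auto simp: RR_pw)
    thus "r = r' \<and> u = u'" using * by simp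
  qed
  thus ?thesis by (simp add: sum.reindex sum.cartesian_product case_prod_unfold)
qed

lemma transv_unique:
  assumes "transv j R'" "r \<in> R'" "r' \<in> R'" "pw (int j) (a - r)" "pw (int j) (a - r')"
  shows "r = r'"
proof -
  have "pw (int j) (r - r')" by (rule pw_trans[OF pw_diff_commute[OF assms(4)] assms(5)])
  thus ?thesis using assms(1-3) by (auto simp: transv_def)
qed

lemma transv_rep: assumes "transv j R'" "pw 0 a" shows "\<exists>!r. r \<in> R' \<and> pw (int j) (a - r)"
proof -
  obtain r where "r \<in> R'" "pw (int j) (a - r)" using assms by (auto simp: transv_def)
  thus ?thesis using transv_unique[OF assms(1)] by (intro ex1I[of _ r]) auto
qed

lemma transv_bij:
  assumes R1: "transv j R1" and R2: "transv j R2"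
  obtains i where "bij_betw i R1 R2" "\<And>x. x \<in> R1 \<Longrightarrow> pw (int j) (x - i x)"
proof -
  define i where "i x = (THE y. y \<in> R2 \<and> pw (int j) (x - y))" for x
  have o1: "pw 0 x" if "x \<in> R1" for x using R1 that by (simp add: transv_def)
  have i: "i x \<in> R2 \<and> pw (int j) (x - i x)" if "x \<in> R1" for x
    unfolding i_def by (rule theI'[OF transv_rep[OF R2 o1[OF that]]])
  have "bij_betw i R1 R2"
  proof (intro bij_betw_imageI inj_onI equalityI subsetI)
    fix x y assume xy: "x \<in> R1" "y \<in> R1" "i x = i y"
    have "pw (int j) (i x - x)" "pw (int j) (i x - y)"
      using i[OF xy(1)] i[OF xy(2)] xy(3) pw_diff_commute by auto
    thus "x = y" by (rule transv_unique[OF R1 xy(1,2)])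
  next
    fix y assume y: "y \<in> R2"
    then obtain x where x: "x \<in> R1" "pw (int j) (y - x)"
      using R1 R2 unfolding transv_def by blast
    have "y = i x"
      by (rule transv_unique[OF R2 y conjunct1[OF i[OF x(1)]] pw_diff_commute[OF x(2)] conjunct2[OF i[OF x(1)]]])
    thus "y \<in> i ` R1" using x by blast
  qed (use i in auto)
  thus ?thesis using i that by blast
qed

text \<open>The bijection between the two sets matches congruent elements. This is how integral
  translations and unit factors are later absorbed into sums over o/p^j.\<close>

lemma sum_transv_cong:
  assumes R1: "transv j R1" and R2: "transv j R2"
    and g: "\<And>x y. pw 0 x \<Longrightarrow> pw 0 y \<Longrightarrow> pw (int j) (x - y) \<Longrightarrow> g x = g y"
  shows "sum g R1 = sum g R2"
proof -
  obtain i where i: "bij_betw i R1 R2" "\<And>x. x \<in> R1 \<Longrightarrow> pw (int j) (x - i x)"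
    using transv_bij[OF R1 R2] by blast
  have "i x \<in> R2" if "x \<in> R1" for x using i(1) that by (auto simp: bij_betw_def)
  hence "g x = g (i x)" if "x \<in> R1" for x
    using that R1 R2 by (intro g i(2)) (auto simp: transv_def)
  thus ?thesis using sum.reindex_bij_betw[OF i(1), of g] by simp
qed

lemma transv_shift: assumes "transv j R1" "pw 0 c" shows "transv j ((\<lambda>r. r + c) ` R1)"
  unfolding transv_def
proof (intro conjI allI ballI impI)
  show "finite ((\<lambda>r. r + c) ` R1)" using assms by (auto simp: transv_def)
  show "pw 0 r" if "r \<in> (\<lambda>r. r + c) ` R1" for r using that assms by (auto simp: transv_def intro: pw_add)
  show "\<exists>r\<in>(\<lambda>r. r + c) ` R1. pw (int j) (a - r)" if "pw 0 a" for a
  proof -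
    have "pw 0 (a - c)" using that assms pw_diff by blast
    then obtain r where "r \<in> R1" "pw (int j) (a - c - r)" using assms by (auto simp: transv_def)
    thus ?thesis by (auto simp: algebra_simps intro!: bexI[of _ r])
  qed
qed (use assms in \<open>auto simp: transv_def\<close>)

lemma sum_transv_shift:
  assumes "transv j R1" "pw 0 c"
    and "\<And>x y. pw 0 x \<Longrightarrow> pw 0 y \<Longrightarrow> pw (int j) (x - y) \<Longrightarrow> g x = g y"
  shows "(\<Sum>r\<in>R1. g (r + c)) = sum g R1"
proof -
  have "(\<Sum>r\<in>R1. g (r + c)) = sum g ((\<lambda>r. r + c) ` R1)"
    by (subst sum.reindex) (auto simp: inj_on_def)
  also have "\<dots> = sum g R1" by (rule sum_transv_cong[OF transv_shift[OF assms(1,2)] assms(1)]) (fact assms(3))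
  finally show ?thesis .
qed

lemma transv_mult: assumes "transv j R1" "ou c" shows "transv j ((\<lambda>r. c * r) ` R1)"
  unfolding transv_def
proof (intro conjI allI ballI impI)
  have c: "c \<noteq> 0" "val c = 0" using assms by (auto simp: ou_def)
  show "finite ((\<lambda>r. c * r) ` R1)" using assms by (auto simp: transv_def)
  show "pw 0 r" if "r \<in> (\<lambda>r. c * r) ` R1" for r
    using that assms ou_pw by (auto simp: transv_def intro: pw_mult_o)
  show "\<exists>r\<in>(\<lambda>r. c * r) ` R1. pw (int j) (a - r)" if "pw 0 a" for a
  proof -
    have "pw 0 (a / c)" using that c by (simp add: pw_divide_iff)
    then obtain r where r: "r \<in> R1" "pw (int j) (a / c - r)" using assms by (auto simp: transv_def)
    have "pw (int j) (c * (a / c - r))" using r(2) c by (simp add: pw_mult_iff)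
    hence "pw (int j) (a - c * r)" using c by (simp add: algebra_simps)
    thus ?thesis using r by blast
  qed
  show "r = r'" if "r \<in> (*) c ` R1" "r' \<in> (*) c ` R1" "pw (int j) (r - r')" for r r'
  proof -
    obtain x y where xy: "x \<in> R1" "y \<in> R1" "r = c * x" "r' = c * y" using \<open>r \<in> _\<close> \<open>r' \<in> _\<close> by auto
    have "pw (int j) (c * (x - y))" using \<open>pw (int j) (r - r')\<close> xy by (simp add: algebra_simps)
    hence "pw (int j) (x - y)" using c by (simp add: pw_mult_iff)
    thus ?thesis using xy assms by (auto simp: transv_def)
  qed
qed

lemma sum_transv_mult:
  assumes "transv j R1" "ou c"
    and "\<And>x y. pw 0 x \<Longrightarrow> pw 0 y \<Longrightarrow> pw (int j) (x - y) \<Longrightarrow> g x = g y"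
  shows "(\<Sum>r\<in>R1. g (c * r)) = sum g R1"
proof -
  have "(\<Sum>r\<in>R1. g (c * r)) = sum g ((\<lambda>r. c * r) ` R1)"
    using assms(2) by (subst sum.reindex) (auto simp: inj_on_def ou_def)
  also have "\<dots> = sum g R1" by (rule sum_transv_cong[OF transv_mult[OF assms(1,2)] assms(1)]) (fact assms(3))
  finally show ?thesis .
qed

text \<open>The sums over \<open>R\<close> and over \<open>R\<close> shifted by 1 are congruent, so
  the number \<open>card R\<close> lies in the maximal ideal; were it prime to \<open>p\<close>, a
  Bezout relation would put 1 there as well.\<close>

lemma p_dvd_card_R: "p dvd card R"
proof (rule ccontr)
  assume nd: "\<not> p dvd card R"
  have shift: "pw 1 (sum (\<lambda>r. r) R1 - sum (\<lambda>r. r) R2)" if R1: "transv 1 R1" and R2: "transv 1 R2" for R1 R2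
  proof -
    obtain i where i: "bij_betw i R1 R2" "\<And>x. x \<in> R1 \<Longrightarrow> pw (int 1) (x - i x)"
      using transv_bij[OF R1 R2] by blast
    have "sum (\<lambda>r. r) R1 - sum (\<lambda>r. r) R2 = (\<Sum>r\<in>R1. r - i r)"
      using sum.reindex_bij_betw[OF i(1), of "\<lambda>r. r"] by (simp add: sum_subtractf)
    moreover have "pw 1 (\<Sum>r\<in>B. r - i r)" if "B \<subseteq> R1" "finite B" for B
      using that(2,1) by (induction B) (use i(2) in \<open>auto intro!: pw_add\<close>)
    ultimately show ?thesis using R1 by (auto simp: transv_def)
  qed
  have "pw 1 (sum (\<lambda>r. r) ((\<lambda>r. r + 1) ` R) - sum (\<lambda>r. r) R)"
    by (rule shift[OF transv_shift[OF transv_R] transv_R]) simp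
  moreover have "sum (\<lambda>r. r) ((\<lambda>r. r + 1) ` R) = (\<Sum>r\<in>R. r + 1)"
    by (subst sum.reindex) (auto simp: inj_on_def)
  ultimately have c: "pw 1 (of_nat (card R))" by (simp add: sum.distrib)
  have "coprime p (card R)" using nd prime_p prime_imp_coprime by blast
  hence "gcd (int p) (int (card R)) = 1" by simp
  then obtain x y where "x * int p + y * int (card R) = 1"
    using bezout_int[of "int p" "int (card R)"] by auto
  hence "of_int (x * int p + y * int (card R)) = (1::'f)" by simp
  hence xy: "of_int x * of_nat p + of_int y * of_nat (card R) = (1::'f)" by simp
  have "pw 0 (of_int z)" for z
    by (cases z rule: int_cases2) (auto simp: pw_of_nat)
  hence "pw 1 (of_int x * of_nat p + of_int y * of_nat (card R))"
    by (intro pw_add pw_mult_o pw_p c)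
  hence "pw 1 1" by (simp only: xy)
  thus False by simp
qed

end

section \<open>Representations killed by the uniformizer\<close>

locale residue =
  fixes uE :: "'o::idom" and red :: "'o \<Rightarrow> 'k::field" and p :: nat
  assumes dvr: "complete_dvr_with_residue uE red" and acl: "alg_closure_Fp p TYPE('k)"
    and prime_p': "prime p"
begin

lemma red_1 [simp]: "red 1 = 1" and red_add [simp]: "red (a + b) = red a + red b"
  and red_mult [simp]: "red (a * b) = red a * red b" and red_eq_0: "red a = 0 \<longleftrightarrow> uE dvd a"
  and uE_nz [simp]: "uE \<noteq> 0" and uE_nunit: "\<not> uE dvd 1"
  and surj_red: "surj red"
  and dvr_rep: "a \<noteq> 0 \<Longrightarrow> \<exists>u n. u dvd 1 \<and> a = u * uE ^ n"
  and dvr_complete: "(\<And>n. uE ^ n dvd (s (Suc n) - s n)) \<Longrightarrow> \<exists>L. \<forall>n. uE ^ n dvd (L - s n)"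
  using dvr unfolding complete_dvr_with_residue_def by (blast+)

lemma red_0 [simp]: "red 0 = 0" by (simp add: red_eq_0)
lemma red_uE [simp]: "red uE = 0" by (simp add: red_eq_0)
lemma red_minus [simp]: "red (- a) = - red a"
  using red_add[of a "- a"] by (simp add: eq_neg_iff_add_eq_0 add.commute del: red_add)
lemma red_diff [simp]: "red (a - b) = red a - red b"
  using red_add[of a "- b"] by simp
lemma red_sum [simp]: "red (sum f A) = (\<Sum>x\<in>A. red (f x))"
  by (induction A rule: infinite_finite_induct) auto
lemma red_power [simp]: "red (a ^ n) = red a ^ n" by (induction n) auto
lemma red_of_nat [simp]: "red (of_nat n) = of_nat n" by (induction n) auto

lemma red_eq_iff: "red a = red b \<longleftrightarrow> uE dvd (a - b)"
  using red_eq_0[of "a - b"] by simp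

lemma unit_iff: "a dvd 1 \<longleftrightarrow> red a \<noteq> 0"
proof
  assume "a dvd 1"
  then obtain b where "1 = a * b" by (auto elim: dvdE)
  hence "red a * red b = 1" by (metis red_1 red_mult)
  thus "red a \<noteq> 0" by auto
next
  assume a: "red a \<noteq> 0"
  hence "a \<noteq> 0" by auto
  then obtain u n where u: "u dvd 1" "a = u * uE ^ n" using dvr_rep by blast
  hence "n = 0" using a by (cases n) auto
  thus "a dvd 1" using u by simp
qed

definition lift :: "'k \<Rightarrow> 'o" where "lift a = (SOME x. red x = a)"

lemma red_lift [simp]: "red (lift a) = a"
  using surj_red unfolding lift_def surj_def by (metis (mono_tags, lifting) someI_ex)

lemma p_zero [simp]: "of_nat p = (0::'k)"
  using acl unfolding alg_closure_Fp_def by blast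

lemma p_dvd_zero: "p dvd n \<Longrightarrow> of_nat n = (0::'k)"
  by (auto elim!: dvdE)

lemma has_root: "degree (q::'k poly) > 0 \<Longrightarrow> \<exists>x. poly q x = 0"
  using acl unfolding alg_closure_Fp_def by blast

lemma char_k: "CHAR('k) = p"
proof -
  have "CHAR('k) dvd p" using of_nat_eq_0_iff_char_dvd[of p, where ?'a = 'k] by simp
  hence "CHAR('k) = 1 \<or> CHAR('k) = p" using prime_p' by (auto simp: prime_nat_iff)
  thus ?thesis by simp
qed

text \<open>Frobenius is injective: (a - 1)^(p^e) = a^(p^e) - 1.\<close>

lemma p_power_root_1: assumes "(a::'k) ^ (p ^ e) = 1" shows "a = 1"
proof -
  have "((a - 1) + 1) ^ (p ^ e) = (a - 1) ^ (p ^ e) + 1 ^ (p ^ e)"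
    using prime_p' char_k by (intro freshmans_dream') auto
  hence "(a - 1) ^ (p ^ e) = 0" using assms by simp
  thus ?thesis by simp
qed

text \<open>A vector killed by \<open>uE\<close> sees scalars only through \<open>red\<close>. Thus
  modules remain over O, and linear algebra over the residue field is done with arbitrary
  lifts.\<close>

lemma sc_cong: assumes "module sc" "sc uE v = 0" "red a = red b" shows "sc a v = sc b v"
proof -
  interpret module sc by fact
  obtain c where "a - b = uE * c" using assms(3) by (auto simp: red_eq_iff elim: dvdE)
  hence a: "a = b + c * uE" by (simp add: algebra_simps)
  show ?thesis unfolding a by (simp add: scale_left_distrib assms(2) flip: scale_scale)
qed

lemma sc_unit: assumes "module sc" "sc uE v = 0" "red a \<noteq> 0"
  shows "sc (lift (inverse (red a))) (sc a v) = v"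
proof -
  interpret module sc by fact
  have "sc (lift (inverse (red a)) * a) v = sc 1 v"
    using assms by (intro sc_cong[OF assms(1,2)]) simp
  thus ?thesis by simp
qed

lemma sc_nz: assumes "module sc" "sc uE v = 0" "red a \<noteq> 0" "sc a v = 0" shows "v = 0"
  using sc_unit[OF assms(1-3)] assms(4) module.scale_zero_right[OF assms(1)] by simp

lemma sc_eq_iff: assumes "module sc" "sc uE v = 0" "v \<noteq> 0"
  shows "sc a v = sc b v \<longleftrightarrow> red a = red b"
proof
  interpret module sc by fact
  assume "sc a v = sc b v"
  hence "sc (a - b) v = 0" by (simp add: scale_left_diff_distrib)
  hence "red (a - b) = 0" using sc_nz[OF assms(1,2), of "a - b"] assms(3) by blast
  thus "red a = red b" by simp
qed (rule sc_cong[OF assms(1,2)])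

section \<open>Eigenvectors over the residue field\<close>

definition lin_on :: "('o \<Rightarrow> 'b::ab_group_add \<Rightarrow> 'b) \<Rightarrow> 'b set \<Rightarrow> ('b \<Rightarrow> 'b) \<Rightarrow> bool" where
  "lin_on sc V g \<longleftrightarrow> (\<forall>x\<in>V. g x \<in> V) \<and> (\<forall>x\<in>V. \<forall>y\<in>V. g (x + y) = g x + g y) \<and>
     (\<forall>a. \<forall>x\<in>V. g (sc a x) = sc a (g x))"

definition kill :: "('o \<Rightarrow> 'b::ab_group_add \<Rightarrow> 'b) \<Rightarrow> 'b set \<Rightarrow> bool" where
  "kill sc V \<longleftrightarrow> (\<forall>v\<in>V. sc uE v = 0)"

text \<open>The value q(g) y in Horner form. The coefficients act through \<open>lift\<close>, which
  need not be additive, so the rules below are proved on a subspace killed by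
  \<open>uE\<close>.\<close>

definition evk :: "('o \<Rightarrow> 'b::ab_group_add \<Rightarrow> 'b) \<Rightarrow> ('b \<Rightarrow> 'b) \<Rightarrow> 'k poly \<Rightarrow> 'b \<Rightarrow> 'b" where
  "evk sc g q y = fold_coeffs (\<lambda>c x. sc (lift c) y + g x) q 0"

lemma lin_on_0: "module sc \<Longrightarrow> module.subspace sc V \<Longrightarrow> lin_on sc V g \<Longrightarrow> g 0 = 0"
  using module.subspace_0[of sc V] module.scale_zero_left[of sc] unfolding lin_on_def by metis

context
  fixes sc :: "'o \<Rightarrow> 'b::ab_group_add \<Rightarrow> 'b" and V g
  assumes m: "module sc" and V: "module.subspace sc V" and kV: "kill sc V" and g: "lin_on sc V g"
begin

interpretation module sc by (rule m)

lemma evk_0 [simp]: "evk sc g 0 y = 0" by (simp add: evk_def)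

lemma evk_pCons: "y \<in> V \<Longrightarrow> evk sc g (pCons c q) y = sc (lift c) y + g (evk sc g q y)"
proof (cases "c = 0 \<and> q = 0")
  case True
  assume y: "y \<in> V"
  have "sc (lift 0) y = sc 0 y" using y kV by (intro sc_cong[OF m]) (auto simp: kill_def)
  thus ?thesis using True by (simp add: lin_on_0[OF m V g])
next
  case False
  thus ?thesis by (auto simp: evk_def cCons_def fold_coeffs_def cCons_not_0_eq)
qed

lemma evk_mem: "y \<in> V \<Longrightarrow> evk sc g q y \<in> V"
  using V g by (induction q) (auto simp: evk_pCons lin_on_def intro: subspace_add subspace_scale subspace_0)

lemma evk_add: "y \<in> V \<Longrightarrow> evk sc g (q + q') y = evk sc g q y + evk sc g q' y"
proof (induction q arbitrary: q')
  case (pCons c q)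
  show ?case
  proof (cases q')
    case q': (pCons c' q'')
    have "sc (lift (c + c')) y = sc (lift c + lift c') y"
      using pCons.prems kV by (intro sc_cong[OF m]) (auto simp: kill_def)
    thus ?thesis using pCons g evk_mem[OF pCons.prems]
      by (simp add: q' evk_pCons scale_left_distrib lin_on_def)
  qed
qed simp

lemma evk_smult: "y \<in> V \<Longrightarrow> evk sc g (smult a q) y = sc (lift a) (evk sc g q y)"
proof (induction q)
  case (pCons c q)
  have "sc (lift (a * c)) y = sc (lift a * lift c) y"
    using pCons.prems kV by (intro sc_cong[OF m]) (auto simp: kill_def)
  thus ?case using pCons g evk_mem[OF pCons.prems]
    by (simp add: evk_pCons scale_right_distrib lin_on_def)
qed simp

lemma evk_monom: "y \<in> V \<Longrightarrow> evk sc g (monom 1 n) y = (g ^^ n) y"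
proof (induction n)
  case 0
  have "sc (lift 1) y = sc 1 y" using 0 kV by (intro sc_cong[OF m]) (auto simp: kill_def)
  thus ?case using 0 by (simp add: monom_0 evk_pCons lin_on_0[OF m V g])
next
  case (Suc n)
  have "sc (lift 0) y = sc 0 y" using Suc.prems kV by (intro sc_cong[OF m]) (auto simp: kill_def)
  thus ?case using Suc by (simp add: monom_Suc evk_pCons)
qed

lemma evk_diff: "y \<in> V \<Longrightarrow> evk sc g (q - q') y = evk sc g q y - evk sc g q' y"
  using evk_add[of y "q - q'" q'] by (simp add: eq_diff_eq)

lemma evk_sum_monom: "y \<in> V \<Longrightarrow> finite A \<Longrightarrow>
    evk sc g (\<Sum>i\<in>A. smult (c i) (monom 1 (e i))) y = (\<Sum>i\<in>A. sc (lift (c i)) ((g ^^ e i) y))"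
  by (induction A rule: infinite_finite_induct) (auto simp: evk_add evk_smult evk_monom simp del: smult_monom)

text \<open>For a root a write q = (X - a) q'. Either q'(g) y = 0 and the degree drops, or q'(g) y
  is an eigenvector. Since a polynomial has to kill just one vector, infinite dimension does no
  harm.\<close>

lemma eigenvector_exists:
  assumes "y \<in> V" "y \<noteq> 0" "q \<noteq> 0" "evk sc g q y = 0"
  shows "\<exists>a y'. y' \<in> V \<and> y' \<noteq> 0 \<and> g y' = sc a y'"
  using assms(3,4)
proof (induction "degree q" arbitrary: q)
  case 0
  then obtain c where q: "q = [:c:]" by (metis degree_eq_zeroE)
  have "sc (lift c) y = 0" using 0 assms(1) by (simp add: q evk_pCons lin_on_0[OF m V g])
  moreover have "red (lift c) \<noteq> 0" using 0 q by simp
  moreover have "sc uE y = 0" using assms(1) kV by (simp add: kill_def)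
  ultimately have "y = 0" using sc_nz[OF m] by blast
  thus ?case using assms(2) by blast
next
  case (Suc n)
  then obtain a where "poly q a = 0" using has_root[of q] by auto
  then obtain q' where q': "q = [:-a, 1:] * q'" by (auto simp: poly_eq_0_iff_dvd elim: dvdE)
  have q'0: "q' \<noteq> 0" using Suc q' by auto
  hence deg: "degree q' = n" using Suc(2) degree_mult_eq[of "[:-a,1:]" q'] q' by simp
  define z where "z = evk sc g q' y"
  have zV: "z \<in> V" unfolding z_def using assms by (simp add: evk_mem)
  have "q = smult (- a) q' + pCons 0 q'" unfolding q' by simp
  hence "evk sc g q y = sc (lift (- a)) z + (sc (lift 0) y + g z)"
    using assms by (simp only: evk_add evk_smult evk_pCons z_def)
  moreover have "sc (lift (- a)) z = sc (- lift a) z" using zV kV by (intro sc_cong[OF m]) (auto simp: kill_def)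
  moreover have "sc (lift 0) y = sc 0 y" using assms kV by (intro sc_cong[OF m]) (auto simp: kill_def)
  ultimately have "g z = sc (lift a) z" using Suc.prems by simp
  show ?case
  proof (cases "z = 0")
    case True
    thus ?thesis using Suc(1)[of q'] deg q'0 by (simp add: z_def)
  next
    case False
    thus ?thesis using zV \<open>g z = _\<close> by blast
  qed
qed

lemma eigenvector_periodic:
  assumes "y \<in> V" "(g ^^ i) y = (g ^^ j) y" "i < j"
  shows "\<exists>q. q \<noteq> 0 \<and> evk sc g q y = 0"
proof (intro exI conjI)
  have "coeff (monom 1 j - monom (1::'k) i) j = 1" using assms by simp
  thus "monom 1 j - monom (1::'k) i \<noteq> 0" by (metis coeff_0 zero_neq_one)
  show "evk sc g (monom 1 j - monom (1::'k) i) y = 0"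
    using assms by (simp add: evk_diff evk_monom)
qed

end

text \<open>An eigenspace of one operator is stable under the others because they commute, and it
  inherits all hypotheses.\<close>

lemma common_eigenvector:
  fixes sc :: "'o \<Rightarrow> 'b::ab_group_add \<Rightarrow> 'b"
  assumes m: "module sc" and "finite G"
    and "module.subspace sc V" "kill sc V" "V \<noteq> {0}"
    and "\<And>g. g \<in> G \<Longrightarrow> lin_on sc V g"
    and "\<And>g h x. g \<in> G \<Longrightarrow> h \<in> G \<Longrightarrow> x \<in> V \<Longrightarrow> g (h x) = h (g x)"
    and "\<And>g x. g \<in> G \<Longrightarrow> x \<in> V \<Longrightarrow> \<exists>q. q \<noteq> 0 \<and> evk sc g q x = 0"
  shows "\<exists>y\<in>V. y \<noteq> 0 \<and> (\<forall>g\<in>G. \<exists>a. g y = sc a y)"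
proof -
  interpret module sc by (rule m)
  show ?thesis using assms(2-)
  proof (induction G arbitrary: V rule: finite_induct)
    case empty
    thus ?case using subspace_0[of V] by auto
  next
    case (insert g G)
    obtain y where y: "y \<in> V" "y \<noteq> 0" using insert.prems(1,3) subspace_0[of V] by auto
    obtain q where q: "q \<noteq> 0" "evk sc g q y = 0" using insert.prems(6)[of g y] y by auto
    obtain a y' where y': "y' \<in> V" "y' \<noteq> 0" "g y' = sc a y'"
      using eigenvector_exists[OF m insert.prems(1,2) insert.prems(4) y q] by auto
    define V' where "V' = {x \<in> V. g x = sc a x}"
    have lg: "lin_on sc V g" using insert.prems(4) by simp
    have sub: "subspace V'"
      unfolding V'_def using insert.prems(1) lg lin_on_0[OF m insert.prems(1) lg]
      by (intro subspaceI) (auto simp: lin_on_def subspace_0 subspace_add subspace_scale scale_right_distrib mult.commute)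
    have lh: "lin_on sc V' h" if h: "h \<in> G" for h
    proof -
      have 1: "lin_on sc V h" using insert.prems(4) h by simp
      have "g (h x) = h (g x)" if "x \<in> V" for x using insert.prems(5) h that by simp
      thus ?thesis using 1 by (auto simp: lin_on_def V'_def)
    qed
    have "\<exists>y\<in>V'. y \<noteq> 0 \<and> (\<forall>g\<in>G. \<exists>a. g y = sc a y)"
    proof (rule insert.IH[OF sub])
      show "kill sc V'" using insert.prems(2) by (auto simp: kill_def V'_def)
      show "V' \<noteq> {0}" using y' by (auto simp: V'_def)
    qed (use lh insert.prems(5,6) in \<open>auto simp: V'_def\<close>)
    thus ?case by (auto simp: V'_def)
  qed
qed

text \<open>Stands for the fact that a finite abelian p-group acting in characteristic p fixes a
  nonzero vector, in any dimension: the eigenvalues on a common eigenvector have p^e-th power 1,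
  hence equal 1.\<close>

lemma p_power_fixed_vector:
  fixes sc :: "'o \<Rightarrow> 'b::ab_group_add \<Rightarrow> 'b"
  assumes m: "module sc" and "finite G"
    and V: "module.subspace sc V" "kill sc V" "V \<noteq> {0}"
    and lin: "\<And>g. g \<in> G \<Longrightarrow> lin_on sc V g"
    and comm: "\<And>g h x. g \<in> G \<Longrightarrow> h \<in> G \<Longrightarrow> x \<in> V \<Longrightarrow> g (h x) = h (g x)"
    and per: "\<And>g x. g \<in> G \<Longrightarrow> x \<in> V \<Longrightarrow> (g ^^ (p ^ e)) x = x"
  shows "\<exists>y\<in>V. y \<noteq> 0 \<and> (\<forall>g\<in>G. g y = y)"
proof -
  interpret module sc by (rule m)
  have p0: "0 < p ^ e" using prime_p' by (simp add: prime_gt_0_nat)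
  have "\<exists>y\<in>V. y \<noteq> 0 \<and> (\<forall>g\<in>G. \<exists>a. g y = sc a y)"
  proof (rule common_eigenvector[OF m assms(2) V lin])
    show "g (h x) = h (g x)" if "g \<in> G" "h \<in> G" "x \<in> V" for g h x using comm that .
  next
    fix g x assume "g \<in> G" "x \<in> V"
    thus "\<exists>q. q \<noteq> 0 \<and> evk sc g q x = 0"
      using per p0 by (intro eigenvector_periodic[OF m V(1,2) lin, of _ _ 0 "p ^ e"]) auto
  qed
  then obtain y where y: "y \<in> V" "y \<noteq> 0" "\<And>g. g \<in> G \<Longrightarrow> \<exists>a. g y = sc a y" by blast
  have "g y = y" if gG: "g \<in> G" for g
  proof -
    obtain a where a: "g y = sc a y" using y(3) gG by blast
    have "(g ^^ n) y = sc (a ^ n) y" for n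
    proof (induction n)
      case (Suc n)
      thus ?case using lin[OF gG] y(1) a by (auto simp: lin_on_def mult.commute)
    qed simp
    hence "sc (a ^ (p ^ e)) y = sc 1 y" using per[OF gG y(1)] by simp
    moreover have "sc uE y = 0" using y(1) V(2) by (simp add: kill_def)
    ultimately have "red (a ^ (p ^ e)) = red 1" using sc_eq_iff[OF m _ y(2)] by blast
    hence "red a ^ (p ^ e) = 1" by simp
    hence "red a = red 1" using p_power_root_1 by simp
    hence "sc a y = sc 1 y" using y(1) V(2) by (intro sc_cong[OF m]) (auto simp: kill_def)
    thus ?thesis using a by simp
  qed
  thus ?thesis using y by blast
qed

text \<open>Dimension counting over the residue field, expressed by generators. The strict drop for
  a proper subspace is what the choice of a minimal K-stable subspace relies on.\<close>

lemma submodule_generators: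
  fixes sc :: "'o \<Rightarrow> 'b::ab_group_add \<Rightarrow> 'b"
  assumes m: "module sc" and "finite E" "kill sc E"
    and "module.subspace sc W" "W \<subseteq> module.span sc E"
  shows "\<exists>E'. finite E' \<and> module.span sc E' = W \<and> card E' \<le> card E \<and>
     (W \<noteq> module.span sc E \<longrightarrow> card E' < card E)"
proof -
  interpret module sc by (rule m)
  show ?thesis using assms(2-)
  proof (induction E arbitrary: W rule: finite_induct)
    case empty
    thus ?case using subspace_0[of W] by (intro exI[of _ "{}"]) auto
  next
    case (insert e E)
    show ?case
    proof (cases "W \<subseteq> span E")
      case True
      then obtain E' where "finite E'" "span E' = W" "card E' \<le> card E"
        using insert.IH[of W] insert.prems by (auto simp: kill_def)
      thus ?thesis using insert.hyps by (intro exI[of _ E']) auto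
    next
      case False
      have sW: "subspace W" using insert.prems(2) .
      \<comment> \<open>An element of \<open>W\<close> outside the span of \<open>E\<close> involves
        \<open>e\<close> with a unit coefficient, so it can take the place of \<open>e\<close>; what
        is left of \<open>W\<close> lies in the span of \<open>E\<close>.\<close>
      obtain w where w: "w \<in> W" "w \<notin> span E" using False by blast
      then obtain c where c: "w - sc c e \<in> span E" using insert.prems(3) by (auto simp: span_insert)
      have ek: "sc uE e = 0" using insert.prems(1) by (simp add: kill_def)
      have c0: "red c \<noteq> 0"
      proof
        assume "red c = 0"
        hence "sc c e = sc 0 e" by (intro sc_cong[OF m ek]) simp
        thus False using c w by simp
      qed
      let ?W = "W \<inter> span E"
      have sW': "subspace ?W" using sW by (simp add: subspace_inter)
      obtain E' where E': "finite E'" "span E' = ?W" "card E' \<le> card E" "?W \<noteq> span E \<Longrightarrow> card E' < card E"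
        using insert.IH[OF _ sW'] insert.prems(1) by (auto simp: kill_def)
      have "W \<subseteq> span (insert w E')"
      proof
        fix x assume x: "x \<in> W"
        then obtain d where d: "x - sc d e \<in> span E" using insert.prems(3) by (auto simp: span_insert)
        define b where "b = d * lift (inverse (red c))"
        have "sc (b * c) e = sc d e" unfolding b_def
          using c0 by (intro sc_cong[OF m ek]) simp
        hence "x - sc b w = (x - sc d e) - sc b (w - sc c e)" by (simp add: scale_right_diff_distrib)
        also have "\<dots> \<in> span E" by (rule span_diff[OF d span_scale[OF c]])
        finally have "x - sc b w \<in> ?W" using x w sW by (auto intro: subspace_diff subspace_scale)
        thus "x \<in> span (insert w E')" unfolding span_insert E'(2)[symmetric] by blast
      qed
      moreover have "span (insert w E') \<subseteq> W"
      proof (rule span_minimal[OF _ sW])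
        show "insert w E' \<subseteq> W" using w E'(2) span_superset[of E'] by auto
      qed
      ultimately have eq: "span (insert w E') = W" by blast
      have "card (insert w E') < card (insert e E)" if ne: "W \<noteq> span (insert e E)"
      proof -
        have "?W \<noteq> span E"
        proof
          assume "?W = span E"
          hence "span E \<subseteq> W" by blast
          moreover have "e \<in> W"
          proof -
            have "sc c e = w - (w - sc c e)" by simp
            also have "\<dots> \<in> W" by (rule subspace_diff[OF sW w(1)]) (use c \<open>span E \<subseteq> W\<close> in auto)
            finally have "sc (lift (inverse (red c))) (sc c e) \<in> W" using sW subspace_scale by blast
            thus ?thesis using sc_unit[OF m ek c0] by simp
          qed
          moreover have "E \<subseteq> span E" by (rule span_superset)
          ultimately have "span (insert e E) \<subseteq> W" using sW by (intro span_minimal) auto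
          thus False using ne insert.prems(3) by blast
        qed
        hence "card E' < card E" using E' by blast
        thus ?thesis using insert.hyps E'(1) by (simp add: card_insert_if)
      qed
      moreover have "card (insert w E') \<le> card (insert e E)"
        using E'(1,3) insert.hyps by (simp add: card_insert_if)
      ultimately show ?thesis using E'(1) eq by (intro exI[of _ "insert w E'"]) auto
    qed
  qed
qed

lemma nakayama:
  fixes sc :: "'o \<Rightarrow> 'b::ab_group_add \<Rightarrow> 'b"
  assumes m: "module sc" and "finite E"
    and "\<And>v. v \<in> module.span sc E \<Longrightarrow> \<exists>v'\<in>module.span sc E. v = sc uE v'"
  shows "module.span sc E = {0}"
proof -
  interpret module sc by (rule m)
  show ?thesis using assms(2-)
  proof (induction E rule: finite_induct)
    case (insert e E)
    obtain v' where v': "v' \<in> span (insert e E)" "e = sc uE v'"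
      using insert.prems[of e] span_base[of e "insert e E"] by auto
    obtain c where c: "v' - sc c e \<in> span E" using v' by (auto simp: span_insert)
    \<comment> \<open>Divisibility expresses \<open>e\<close> through itself with a factor
      \<open>uE\<close>; since \<open>1 - uE * c\<close> is a unit, \<open>e\<close> is redundant as
      a generator.\<close>
    have "sc (1 - uE * c) e = e - sc (uE * c) e" by (simp add: scale_left_diff_distrib)
    also have "\<dots> = sc uE (v' - sc c e)" by (subst v'(2)) (simp add: scale_right_diff_distrib mult.assoc flip: v'(2))
    finally have "sc (1 - uE * c) e = sc uE (v' - sc c e)" .
    hence e1: "sc (1 - uE * c) e \<in> span E" using c by (simp add: span_scale)
    have "(1 - uE * c) dvd 1" by (simp add: unit_iff)
    then obtain d where "1 = (1 - uE * c) * d" by (elim dvdE)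
    hence "sc d (sc (1 - uE * c) e) = e" by (simp add: mult.commute)
    hence "e \<in> span E" using span_scale[OF e1, of d] by simp
    hence "span (insert e E) = span E"
      using span_superset[of E] by (simp add: span_eq span_base subset_insertI2 span_mono) (meson span_mono span_superset subset_insertI subset_trans)
    thus ?case using insert by simp
  qed simp
qed

text \<open>Successive approximation: iterating \<open>gen\<close> gives coefficients that are
  series in powers of \<open>uE\<close> and converge in O; the error lies in \<open>uE ^ n\<close>
  times \<open>Q\<close> for every n, so \<open>sep\<close> makes it 0.\<close>

lemma complete_generation:
  fixes sc :: "'o \<Rightarrow> 'b::ab_group_add \<Rightarrow> 'b"
  assumes m: "module sc" and fin: "finite E" and Q: "module.subspace sc Q" and EQ: "E \<subseteq> Q"
    and gen: "\<And>q. q \<in> Q \<Longrightarrow> \<exists>x\<in>module.span sc E. \<exists>q'\<in>Q. q = x + sc uE q'"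
    and sep: "\<And>y. (\<And>n. \<exists>q\<in>Q. y = sc (uE ^ n) q) \<Longrightarrow> y = 0"
  shows "Q \<subseteq> module.span sc E"
proof
  interpret module sc by (rule m)
  fix q assume qQ: "q \<in> Q"
  have "\<forall>q\<in>Q. \<exists>c q'. q' \<in> Q \<and> q = (\<Sum>e\<in>E. sc (c e) e) + sc uE q'"
    using gen span_finite[OF fin] by fastforce
  then obtain c t where ct: "\<And>q. q \<in> Q \<Longrightarrow> t q \<in> Q \<and> q = (\<Sum>e\<in>E. sc (c q e) e) + sc uE (t q)"
    by metis
  define qs where "qs n = (t ^^ n) q" for n
  have qs: "qs n \<in> Q" for n by (induction n) (use qQ ct in \<open>auto simp: qs_def\<close>)
  define s where "s n e = (\<Sum>i<n. uE ^ i * c (qs i) e)" for n e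
  have dec: "q = (\<Sum>e\<in>E. sc (s n e) e) + sc (uE ^ n) (qs n)" for n
  proof (induction n)
    case 0
    show ?case by (simp add: s_def qs_def)
  next
    case (Suc n)
    have 1: "qs n = (\<Sum>e\<in>E. sc (c (qs n) e) e) + sc uE (qs (Suc n))"
      using ct[OF qs[of n]] by (simp add: qs_def)
    have "sc (uE ^ n) (qs n) = (\<Sum>e\<in>E. sc (uE ^ n * c (qs n) e) e) + sc (uE ^ Suc n) (qs (Suc n))"
      by (subst 1) (simp add: scale_right_distrib scale_sum_right mult.commute)
    thus ?case using Suc by (simp add: s_def scale_left_distrib sum.distrib)
  qed
  have "\<forall>e. \<exists>L. \<forall>n. uE ^ n dvd (L - s n e)"
    by (intro allI dvr_complete) (simp add: s_def)
  then obtain L where L: "\<And>e n. uE ^ n dvd (L e - s n e)" by metis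
  define x where "x = (\<Sum>e\<in>E. sc (L e) e)"
  have "q - x = 0"
  proof (rule sep)
    fix n
    have "\<forall>e. \<exists>d. L e - s n e = uE ^ n * d" using L unfolding dvd_def by blast
    then obtain d where d: "\<And>e. L e - s n e = uE ^ n * d e" by metis
    have "x - (\<Sum>e\<in>E. sc (s n e) e) = (\<Sum>e\<in>E. sc (L e - s n e) e)"
      by (simp add: x_def scale_left_diff_distrib sum_subtractf)
    also have "\<dots> = sc (uE ^ n) (\<Sum>e\<in>E. sc (d e) e)" by (simp add: d scale_sum_right)
    finally have "q - x = sc (uE ^ n) (qs n - (\<Sum>e\<in>E. sc (d e) e))"
      using dec[of n] by (simp add: scale_right_diff_distrib algebra_simps)
    moreover have "qs n - (\<Sum>e\<in>E. sc (d e) e) \<in> Q"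
      using Q qs EQ by (intro subspace_diff subspace_sum subspace_scale) auto
    ultimately show "\<exists>q'\<in>Q. q - x = sc (uE ^ n) q'" by blast
  qed
  thus "q \<in> span E" by (auto simp: x_def intro: span_sum span_scale span_base)
qed

end

section \<open>Smooth modules and cocycle functions\<close>

lemma M2_GL2 [simp]: "M2 a b c d \<in> GL2 \<longleftrightarrow> a * d - b * c \<noteq> (0::'f::field)"
  by (simp add: GL2_def)

lemma M2_Borel [simp]: "M2 a b c d \<in> Borel \<longleftrightarrow> c = 0 \<and> a \<noteq> 0 \<and> d \<noteq> (0::'f::field)"
  by (auto simp: Borel_def)

lemma Borel_GL2: "b \<in> Borel \<Longrightarrow> b \<in> GL2" by (cases b) auto

lemma m2mult_assoc: "m2mult (m2mult a b) c = m2mult a (m2mult b (c::'f::field m2))"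
  by (cases a; cases b; cases c) (simp add: algebra_simps)

lemma m2det_mult: "m2det (m2mult a b) = m2det a * m2det (b::'f::field m2)"
  by (cases a; cases b) (simp add: algebra_simps)

lemma GL2_mult [simp]: "a \<in> GL2 \<Longrightarrow> b \<in> GL2 \<Longrightarrow> m2mult a b \<in> (GL2 :: 'f::field m2 set)"
  by (simp add: GL2_def m2det_mult)

lemma m2one_GL2 [simp]: "m2one \<in> (GL2 :: 'f::field m2 set)" by (simp add: m2one_def)
lemma m2one_left [simp]: "m2mult m2one a = (a :: 'f::field m2)" by (cases a) (simp add: m2one_def)
lemma m2one_right [simp]: "m2mult a m2one = (a :: 'f::field m2)" by (cases a) (simp add: m2one_def)

fun m2inv :: "'f::field m2 \<Rightarrow> 'f m2" where
  "m2inv (M2 a b c d) = M2 (d / (a*d - b*c)) (- b / (a*d - b*c)) (- c / (a*d - b*c)) (a / (a*d - b*c))"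

lemma m2inv_mult: "a \<in> GL2 \<Longrightarrow> m2mult (m2inv a) a = m2one"
  by (cases a) (simp add: m2one_def mult.commute flip: add_divide_distrib diff_divide_distrib)
lemma m2mult_inv: "a \<in> GL2 \<Longrightarrow> m2mult a (m2inv a) = m2one"
  by (cases a) (simp add: m2one_def mult.commute flip: add_divide_distrib diff_divide_distrib)
lemma m2inv_GL2 [simp]: "a \<in> GL2 \<Longrightarrow> m2inv a \<in> GL2"
proof -
  assume "a \<in> GL2"
  hence "m2det (m2inv a) * m2det a = 1" using m2inv_mult[of a] m2det_mult[of "m2inv a" a]
    by (simp add: m2one_def)
  thus ?thesis by (auto simp: GL2_def)
qed

lemma scalar_GL2 [simp]: "z \<noteq> 0 \<Longrightarrow> scalar_m2 z \<in> (GL2 :: 'f::field m2 set)"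
  by (simp add: scalar_m2_def)

definition nn :: "'f::field \<Rightarrow> 'f m2" where "nn u = M2 1 u 0 1"
definition nb :: "'f::field \<Rightarrow> 'f m2" where "nb c = M2 1 0 c 1"
definition dg :: "'f::field \<Rightarrow> 'f \<Rightarrow> 'f m2" where "dg a d = M2 a 0 0 d"
definition ss :: "'f::field m2" where "ss = M2 0 1 1 0"

lemmas mdefs = nn_def nb_def dg_def ss_def scalar_m2_def m2one_def

lemma gens_GL2 [simp]: "nn u \<in> GL2" "nb u \<in> GL2" "ss \<in> GL2" "dg a d \<in> GL2 \<longleftrightarrow> a \<noteq> 0 \<and> d \<noteq> (0::'f::field)"
  by (auto simp: mdefs)
lemma gens_Borel [simp]: "nn u \<in> Borel" "dg a d \<in> Borel \<longleftrightarrow> a \<noteq> 0 \<and> d \<noteq> (0::'f::field)"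
  "z \<noteq> 0 \<Longrightarrow> scalar_m2 z \<in> (Borel :: 'f::field m2 set)"
  by (auto simp: mdefs)

locale smooth_mod = local_field val uf p + residue uE red p
  for val :: "'f::field \<Rightarrow> int" and uf :: 'f and p :: nat
    and uE :: "'o::idom" and red :: "'o \<Rightarrow> 'k::field" +
  fixes sm :: "'o \<Rightarrow> 'w::ab_group_add \<Rightarrow> 'w" and ac :: "'f m2 \<Rightarrow> 'w \<Rightarrow> 'w"
  assumes W: "smooth_OG_module val sm ac"
begin

lemma module_sm: "module sm"
  by unfold_locales (use W in \<open>auto simp: smooth_OG_module_def\<close>)

sublocale W: module sm by (rule module_sm)

lemma ac_add: "g \<in> GL2 \<Longrightarrow> ac g (x + y) = ac g x + ac g y"
  and ac_sm: "g \<in> GL2 \<Longrightarrow> ac g (sm a x) = sm a (ac g x)"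
  and ac_one [simp]: "ac m2one x = x"
  and ac_mult: "g \<in> GL2 \<Longrightarrow> h \<in> GL2 \<Longrightarrow> ac (m2mult g h) x = ac g (ac h x)"
  and ac_smooth: "\<exists>n\<ge>1. \<forall>k\<in>Kcong val n. ac k x = x"
  using W unfolding smooth_OG_module_def by blast+

lemma ac_0 [simp]: "g \<in> GL2 \<Longrightarrow> ac g 0 = 0"
  using ac_add[of g 0 0] by simp
lemma ac_minus: "g \<in> GL2 \<Longrightarrow> ac g (- x) = - ac g x"
  using ac_add[of g x "- x"] by (simp add: eq_neg_iff_add_eq_0 add.commute)
lemma ac_diff: "g \<in> GL2 \<Longrightarrow> ac g (x - y) = ac g x - ac g y"
  using ac_add[of g x "- y"] by (simp add: ac_minus)

lemma ac_inv: "g \<in> GL2 \<Longrightarrow> ac (m2inv g) (ac g x) = x" "g \<in> GL2 \<Longrightarrow> ac g (ac (m2inv g) x) = x"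
  by (simp_all add: m2inv_mult m2mult_inv flip: ac_mult)

lemma ac_eq_iff: "g \<in> GL2 \<Longrightarrow> ac g x = ac g y \<longleftrightarrow> x = y"
  by (metis ac_inv(1))

lemma ac_eq_0: "g \<in> GL2 \<Longrightarrow> ac g x = 0 \<longleftrightarrow> x = 0"
  using ac_eq_iff[of g x 0] by simp

definition smf :: "'o \<Rightarrow> ('f m2 \<Rightarrow> 'w) \<Rightarrow> 'f m2 \<Rightarrow> 'w" where "smf a f = (\<lambda>g. sm a (f g))"

text \<open>For the cocycle \<open>f(g) = g \<phi>(y) - \<phi>(g y)\<close> attached to a vector \<open>y\<close>, the function \<open>act h f\<close> is
the cocycle attached to \<open>h y\<close>; \<open>C\<close> records the properties of these functions that do not mention \<open>\<phi>\<close>.\<close>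

definition act :: "'f m2 \<Rightarrow> ('f m2 \<Rightarrow> 'w) \<Rightarrow> 'f m2 \<Rightarrow> 'w" where
  "act h f = (\<lambda>g. if g \<in> GL2 then f (m2mult g h) - ac g (f h) else 0)"

lemma module_smf: "module smf"
  by unfold_locales (auto simp: smf_def fun_eq_iff W.scale_right_distrib W.scale_left_distrib)

sublocale S: module smf by (rule module_smf)

lemma act_mult: "g \<in> GL2 \<Longrightarrow> h \<in> GL2 \<Longrightarrow> act (m2mult g h) f = act g (act h f)"
  by (auto simp: act_def fun_eq_iff m2mult_assoc ac_diff ac_mult)

lemma act_add: "act h (f + f') = act h f + act h f'"
  by (auto simp: act_def fun_eq_iff ac_add)

lemma act_smf: "act h (smf a f) = smf a (act h f)"
  by (auto simp: act_def smf_def fun_eq_iff ac_sm W.scale_right_diff_distrib)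

lemma act_0 [simp]: "act h 0 = 0"
  by (auto simp: act_def fun_eq_iff)

lemma act_sum: "act h (sum f A) = (\<Sum>x\<in>A. act h (f x))"
  by (rule additive.sum[of "act h"]) (simp add: additive_def act_add)

lemma act_minus: "act h (- f) = - act h f"
  by (auto simp: act_def fun_eq_iff ac_minus)

lemma act_diff: "act h (f - f') = act h f - act h f'"
  using act_add[of h f "- f'"] by (simp add: act_minus)

definition C :: "('f m2 \<Rightarrow> 'w) set" where
  "C = {f. (\<forall>g. g \<notin> GL2 \<longrightarrow> f g = 0) \<and> f m2one = 0 \<and>
     (\<forall>b\<in>Borel. \<forall>g\<in>GL2. f (m2mult b g) = ac b (f g)) \<and>
     (\<exists>n\<ge>1. \<forall>k\<in>Kcong val n. \<forall>g\<in>GL2. f (m2mult g k) = f g)}"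

lemma C_off: "f \<in> C \<Longrightarrow> g \<notin> GL2 \<Longrightarrow> f g = 0"
  and C_one: "f \<in> C \<Longrightarrow> f m2one = 0"
  and C_Borel: "f \<in> C \<Longrightarrow> b \<in> Borel \<Longrightarrow> g \<in> GL2 \<Longrightarrow> f (m2mult b g) = ac b (f g)"
  and C_smooth: "f \<in> C \<Longrightarrow> \<exists>n\<ge>1. \<forall>k\<in>Kcong val n. \<forall>g\<in>GL2. f (m2mult g k) = f g"
  unfolding C_def by blast+

lemma C_on_Borel: "f \<in> C \<Longrightarrow> b \<in> Borel \<Longrightarrow> f b = 0"
  using C_Borel[of f b m2one] by (simp add: C_one Borel_GL2)

lemma act_one: "f \<in> C \<Longrightarrow> act m2one f = f"
  by (auto simp: act_def fun_eq_iff C_one C_off)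

lemma act_Borel: "f \<in> C \<Longrightarrow> b \<in> Borel \<Longrightarrow> g \<in> GL2 \<Longrightarrow> act b f g = f (m2mult g b)"
  by (simp add: act_def C_on_Borel)

text \<open>The big cell \<open>P s N\<close> and \<open>P\<close> cover \<open>G\<close>, so \<open>f\<close> in \<open>C\<close> is determined by its values on \<open>s N\<close>.\<close>

definition FF :: "('f m2 \<Rightarrow> 'w) \<Rightarrow> 'f \<Rightarrow> 'w" where "FF f u = f (M2 0 1 1 u)"

lemma C_formula:
  assumes "f \<in> C" "c \<noteq> 0" "a * d - b * c \<noteq> 0"
  shows "f (M2 a b c d) = ac (M2 (b - a * d / c) a 0 c) (FF f (d / c))"
proof -
  have "m2mult (M2 (b - a * d / c) a 0 c) (M2 0 1 1 (d / c)) = M2 a b c d"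
    using assms by (simp add: field_simps)
  moreover have "b - a * d / c \<noteq> 0" using assms by (auto simp: field_simps)
  ultimately show ?thesis using C_Borel[OF assms(1), of "M2 (b - a * d / c) a 0 c" "M2 0 1 1 (d / c)"] assms
    by (simp add: FF_def)
qed

lemma C_ext: assumes "f \<in> C" "f' \<in> C" "\<And>u. FF f u = FF f' u" shows "f = f'"
proof
  fix g :: "'f m2"
  obtain a b c d where g: "g = M2 a b c d" by (cases g)
  show "f g = f' g"
  proof (cases "g \<in> GL2")
    case False
    thus ?thesis using C_off[OF assms(1) False] C_off[OF assms(2) False] by simp
  next
    case True
    show ?thesis
    proof (cases "c = 0")
      case True
      hence "g \<in> Borel" using \<open>g \<in> GL2\<close> g by simp
      thus ?thesis using C_on_Borel[OF assms(1)] C_on_Borel[OF assms(2)] by simp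
    next
      case False
      thus ?thesis using assms True by (simp add: g C_formula)
    qed
  qed
qed

lemma FF_0 [simp]: "FF 0 u = 0" by (simp add: FF_def)
lemma FF_add: "FF (f + f') u = FF f u + FF f' u" by (simp add: FF_def)
lemma FF_smf: "FF (smf a f) u = sm a (FF f u)" by (simp add: FF_def smf_def)
lemma FF_sum: "FF (sum f A) u = (\<Sum>x\<in>A. FF (f x) u)"
  by (rule additive.sum[of "\<lambda>f. FF f u"]) (simp add: additive_def FF_add)

lemma zero_C [simp]: "0 \<in> C"
  by (auto simp: C_def Borel_GL2 intro!: exI[of _ 1])

lemma C_eq_0: "f \<in> C \<Longrightarrow> (\<And>u. FF f u = 0) \<Longrightarrow> f = 0"
  by (rule C_ext) auto

lemma FF_nn: "f \<in> C \<Longrightarrow> FF (act (nn a) f) u = FF f (u + a)"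
  by (simp add: FF_def act_Borel) (simp add: mdefs add.commute)

lemma FF_dg: assumes "f \<in> C" "a \<noteq> 0" "d \<noteq> 0"
  shows "FF (act (dg a d) f) u = ac (dg d a) (FF f (u * d / a))"
proof -
  have "FF (act (dg a d) f) u = f (M2 0 d a (u * d))"
    using assms by (simp add: FF_def act_Borel) (simp add: mdefs)
  also have "\<dots> = ac (dg d a) (FF f (u * d / a))" using assms by (simp add: C_formula dg_def)
  finally show ?thesis .
qed

lemma FF_scalar: assumes "f \<in> C" "z \<noteq> 0"
  shows "FF (act (scalar_m2 z) f) u = ac (scalar_m2 z) (FF f u)"
  using FF_dg[of f z z u] assms by (simp add: mdefs)

lemma C_nb: assumes "f \<in> C" "c \<noteq> 0" shows "f (nb c) = ac (M2 (- 1 / c) 1 0 c) (FF f (1 / c))"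
  using assms by (simp add: nb_def C_formula)

lemma act_smooth: "f \<in> C \<Longrightarrow> \<exists>n\<ge>1. \<forall>k\<in>Kcong val n. act k f = f"
proof -
  assume f: "f \<in> C"
  then obtain n where n: "n \<ge> 1" "\<And>k g. k \<in> Kcong val n \<Longrightarrow> g \<in> GL2 \<Longrightarrow> f (m2mult g k) = f g"
    using C_smooth by metis
  have "act k f = f" if k: "k \<in> Kcong val n" for k
  proof
    fix g
    have "f k = 0" using n(2)[OF k, of m2one] f by (simp add: C_one)
    thus "act k f g = f g" using n(2)[OF k] C_off[OF f] by (simp add: act_def)
  qed
  thus ?thesis using n by blast
qed

lemma nn_Kcong: "pw (int n) u \<Longrightarrow> nn u \<in> Kcong val n" by (simp add: Kcong_def nn_def)
lemma nb_Kcong: "pw (int n) u \<Longrightarrow> nb u \<in> Kcong val n" by (simp add: Kcong_def nb_def)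

lemma FF_loc_const: "f \<in> C \<Longrightarrow> \<exists>n\<ge>1. \<forall>u u'. pw (int n) (u - u') \<longrightarrow> FF f u = FF f u'"
proof -
  assume f: "f \<in> C"
  then obtain n where n: "n \<ge> 1" "\<And>k. k \<in> Kcong val n \<Longrightarrow> act k f = f"
    using act_smooth by blast
  have "FF f u = FF f u'" if "pw (int n) (u - u')" for u u'
  proof -
    have "FF (act (nn (u - u')) f) u' = FF f u" using f by (simp add: FF_nn)
    thus ?thesis using n(2)[OF nn_Kcong[OF that]] by simp
  qed
  thus ?thesis using n(1) by blast
qed

text \<open>For large u the matrix s n(u) lies in P times \<open>nb (1 / u)\<close>, and
  \<open>nb (1 / u)\<close> is so close to the identity that the function vanishes there.\<close>

lemma FF_support: "f \<in> C \<Longrightarrow> \<exists>m::nat. \<forall>u. FF f u \<noteq> 0 \<longrightarrow> pw (- int m) u"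
proof -
  assume f: "f \<in> C"
  then obtain n where n: "n \<ge> 1" "\<And>k g. k \<in> Kcong val n \<Longrightarrow> g \<in> GL2 \<Longrightarrow> f (m2mult g k) = f g"
    using C_smooth by metis
  have "pw (- int n) u" if "FF f u \<noteq> 0" for u
  proof (rule ccontr)
    assume np: "\<not> pw (- int n) u"
    hence u0: "u \<noteq> 0" and "val u < - int n" by (auto simp: in_pow_def)
    hence "pw (int n) (1 / u)" by (simp add: in_pow_def val_divide)
    hence "f (nb (1 / u)) = 0" using n(2)[OF nb_Kcong, of "1 / u" m2one] f by (simp add: C_one)
    hence "FF f u = 0" using C_nb[OF f, of "1 / u"] u0 by (simp add: ac_eq_0)
    thus False using that by simp
  qed
  thus ?thesis by blast
qed

end

lemma finite_image_factor:
  assumes "finite (h ` A)" "\<And>x y. x \<in> A \<Longrightarrow> y \<in> A \<Longrightarrow> h x = h y \<Longrightarrow> f x = f y"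
  shows "finite (f ` A)"
proof (rule finite_subset)
  show "f ` A \<subseteq> (\<lambda>t. f (SOME x. x \<in> A \<and> h x = t)) ` (h ` A)"
  proof
    fix y assume "y \<in> f ` A"
    then obtain x where x: "x \<in> A" "y = f x" by auto
    have "(SOME x'. x' \<in> A \<and> h x' = h x) \<in> A \<and> h (SOME x'. x' \<in> A \<and> h x' = h x) = h x"
      by (rule someI[of _ x]) (use x in auto)
    hence "f (SOME x'. x' \<in> A \<and> h x' = h x) = y" using assms(2) x by blast
    thus "y \<in> (\<lambda>t. f (SOME x. x \<in> A \<and> h x = t)) ` (h ` A)" using x by blast
  qed
qed (use assms(1) in blast)

context smooth_mod
begin

section \<open>The maximal compact subgroup and decompositions of G\<close>

definition KK :: "'f m2 set" where
  "KK = {M2 a b c d | a b c d. pw 0 a \<and> pw 0 b \<and> pw 0 c \<and> pw 0 d \<and> ou (a * d - b * c)}"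

lemma M2_KK [simp]: "M2 a b c d \<in> KK \<longleftrightarrow> pw 0 a \<and> pw 0 b \<and> pw 0 c \<and> pw 0 d \<and> ou (a * d - b * c)"
  by (auto simp: KK_def)

lemma KK_GL2: "k \<in> KK \<Longrightarrow> k \<in> GL2" by (auto simp: KK_def ou_def)

lemma KK_mult: "k \<in> KK \<Longrightarrow> k' \<in> KK \<Longrightarrow> m2mult k k' \<in> KK"
proof -
  assume a: "k \<in> KK" "k' \<in> KK"
  obtain a b c d where k: "k = M2 a b c d" by (cases k)
  obtain a' b' c' d' where k': "k' = M2 a' b' c' d'" by (cases k')
  have "ou ((a * d - b * c) * (a' * d' - b' * c'))" using a k k' by (intro ou_mult) auto
  moreover have "(a * d - b * c) * (a' * d' - b' * c') =
    (a * a' + b * c') * (c * b' + d * d') - (a * b' + b * d') * (c * a' + d * c')" by (simp add: algebra_simps)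
  ultimately show ?thesis using a by (auto simp: k k' intro!: pw_add pw_mult_o)
qed

lemma KK_gens: "pw 0 u \<Longrightarrow> nn u \<in> KK" "pw 0 u \<Longrightarrow> nb u \<in> KK" "ss \<in> KK" "ou a \<Longrightarrow> ou d \<Longrightarrow> dg a d \<in> KK" "m2one \<in> KK"
  by (auto simp: mdefs ou_pw ou_mult)

lemma KK_pow: "k \<in> KK \<Longrightarrow> (act k ^^ i) f = act (((m2mult k) ^^ i) m2one) f \<and> ((m2mult k) ^^ i) m2one \<in> KK" if "f \<in> C"
proof (induction i)
  case 0
  thus ?case using that by (simp add: act_one KK_gens)
next
  case (Suc i)
  thus ?case by (auto simp: act_mult KK_GL2 KK_mult)
qed

definition mcong :: "nat \<Rightarrow> 'f m2 \<Rightarrow> 'f m2 \<Rightarrow> bool" where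
  "mcong n k k' \<longleftrightarrow> (case k of M2 a b c d \<Rightarrow> case k' of M2 a' b' c' d' \<Rightarrow>
     pw (int n) (a' - a) \<and> pw (int n) (b' - b) \<and> pw (int n) (c' - c) \<and> pw (int n) (d' - d))"

definition kfix :: "nat \<Rightarrow> ('f m2 \<Rightarrow> 'w) \<Rightarrow> bool" where
  "kfix n f \<longleftrightarrow> (\<forall>k\<in>Kcong val n. act k f = f)"

text \<open>Matrices of K congruent modulo p^n differ by a right factor in K(n). Finiteness,
  commutation and exponent statements about K acting on level-n vectors are all reduced to such
  congruences.\<close>

lemma act_mcong:
  assumes f: "kfix n f" and k: "k \<in> KK" "k' \<in> KK" "mcong n k k'"
  shows "act k f = act k' f"
proof -
  obtain a b c d where k1: "k = M2 a b c d" by (cases k)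
  obtain a' b' c' d' where k2: "k' = M2 a' b' c' d'" by (cases k')
  have cg: "pw (int n) (a' - a)" "pw (int n) (b' - b)" "pw (int n) (c' - c)" "pw (int n) (d' - d)"
    using k(3) by (auto simp: k1 k2 mcong_def)
  define e where "e = a * d - b * c"
  have e: "e \<noteq> 0" "val e = 0" using k by (auto simp: e_def k1 ou_def)
  have sm: "pw (int n) ((x * s - y * t) / e)" if "pw 0 x" "pw 0 y" "pw (int n) s" "pw (int n) t" for x y s t
    using pw_divide[of e "int n" "x * s - y * t"] e that by (auto intro: pw_diff pw_mult_o)
  have "m2mult (m2inv k) k' \<in> Kcong val n"
  proof -
    have eqs: "d / e * a' + - b / e * c' - 1 = (d * (a' - a) - b * (c' - c)) / e"
      "d / e * b' + - b / e * d' = (d * (b' - b) - b * (d' - d)) / e"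
      "- c / e * a' + a / e * c' = (a * (c' - c) - c * (a' - a)) / e"
      "- c / e * b' + a / e * d' - 1 = (a * (d' - d) - c * (b' - b)) / e"
      using e(1) by (simp_all add: field_simps) (simp_all add: e_def algebra_simps)
    show ?thesis unfolding Kcong_def k1 k2 m2inv.simps m2mult.simps e_def[symmetric]
      by (rule CollectI, rule exI, rule exI, rule exI, rule exI, rule conjI[OF refl])
        (unfold eqs, use k k1 cg in \<open>auto intro!: sm\<close>)
  qed
  hence "act (m2mult (m2inv k) k') f = f" using f by (simp add: kfix_def)
  hence "act k (act (m2mult (m2inv k) k') f) = act k f" by simp
  moreover have "m2mult k (m2mult (m2inv k) k') = k'"
    using KK_GL2[OF k(1)] by (simp add: m2mult_inv flip: m2mult_assoc)
  ultimately show "act k f = act k' f"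
    using KK_GL2[OF k(1)] KK_GL2[OF k(2)] by (simp flip: act_mult)
qed

lemma finite_KK_orbit: assumes f: "f \<in> C" shows "finite ((\<lambda>k. act k f) ` KK)"
proof -
  obtain n where n: "n \<ge> 1" "kfix n f"
    using act_smooth[OF f] unfolding kfix_def by blast
  define r where "r a = (THE x. x \<in> RR n \<and> pw (int n) (a - x))" for a
  have r: "r a \<in> RR n \<and> pw (int n) (a - r a)" if "pw 0 a" for a
    unfolding r_def by (rule theI'[OF transv_rep[OF transv_RR that]])
  define h where "h k = (case k of M2 a b c d \<Rightarrow> (r a, r b, r c, r d))" for k
  show ?thesis
  proof (rule finite_image_factor[of h])
    have "h ` KK \<subseteq> RR n \<times> RR n \<times> RR n \<times> RR n" using r by (auto simp: h_def KK_def)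
    thus "finite (h ` KK)" by (rule finite_subset) simp
  next
    fix k k' assume k: "k \<in> KK" "k' \<in> KK" "h k = h k'"
    have cong: "pw (int n) (x' - x)" if "r x = r x'" "pw 0 x" "pw 0 x'" for x x'
      using r[OF that(2)] r[OF that(3)] that(1) pw_trans[of "int n" x' "r x'" x] pw_diff_commute[of "int n" x "r x"] by simp
    have "mcong n k k'" using k cong by (cases k; cases k') (auto simp: h_def mcong_def)
    thus "act k f = act k' f" by (rule act_mcong[OF n(2) k(1,2)])
  qed
qed

lemma finite_range_FF: assumes f: "f \<in> C" shows "finite (range (FF f))"
proof -
  obtain n where n: "\<And>u u'. pw (int n) (u - u') \<Longrightarrow> FF f u = FF f u'" using FF_loc_const[OF f] by blast
  obtain m :: nat where m: "\<And>u. FF f u \<noteq> 0 \<Longrightarrow> pw (- int m) u" using FF_support[OF f] by blast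
  define A where "A = {u. pw (- int m) u}"
  define r where "r a = (THE x. x \<in> RR (m + n) \<and> pw (int (m + n)) (a - x))" for a
  have r: "r a \<in> RR (m + n) \<and> pw (int (m + n)) (a - r a)" if "pw 0 a" for a
    unfolding r_def by (rule theI'[OF transv_rep[OF transv_RR that]])
  have o: "pw 0 (uf ^ m * u)" if "u \<in> A" for u using that by (subst pw_mult_iff) (auto simp: A_def)
  have "finite (FF f ` A)"
  proof (rule finite_image_factor[of "\<lambda>u. r (uf ^ m * u)"])
    have "(\<lambda>u. r (uf ^ m * u)) ` A \<subseteq> RR (m + n)" using r o by blast
    thus "finite ((\<lambda>u. r (uf ^ m * u)) ` A)" by (rule finite_subset) simp
  next
    fix x y assume xy: "x \<in> A" "y \<in> A" "r (uf ^ m * x) = r (uf ^ m * y)"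
    have "pw (int (m + n)) (uf ^ m * x - uf ^ m * y)"
      using r[OF o[OF xy(1)]] r[OF o[OF xy(2)]] xy(3)
        pw_trans[of "int (m + n)" "uf ^ m * x" "r (uf ^ m * x)" "uf ^ m * y"]
        pw_diff_commute[of "int (m + n)" "uf ^ m * y"] by simp
    hence "pw (int (m + n)) (uf ^ m * (x - y))" by (simp add: algebra_simps)
    hence "pw (int n) (x - y)" by (subst (asm) pw_mult_iff) auto
    thus "FF f x = FF f y" by (rule n)
  qed
  moreover have "range (FF f) \<subseteq> insert 0 (FF f ` A)" using m by (auto simp: A_def)
  ultimately show ?thesis by (meson finite.insertI finite_subset)
qed

text \<open>The bottom row (c : d) is normalised by its entry of smallest valuation. The
  representatives are kept explicit, because an Iwahori-fixed vector is then controlled by itself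
  and its image under s.\<close>

lemma Iwasawa:
  assumes "g \<in> GL2"
  obtains (big) b u where "b \<in> Borel" "pw 0 u" "g = m2mult b (M2 0 1 1 u)"
  | (small) b c where "b \<in> Borel" "pw 1 c" "g = m2mult b (nb c)"
proof -
  obtain a b c d where g: "g = M2 a b c d" by (cases g)
  show ?thesis
  proof (cases "c \<noteq> 0 \<and> pw 0 (d / c)")
    case True
    have "m2mult (M2 (b - a * d / c) a 0 c) (M2 0 1 1 (d / c)) = g" using True by (simp add: g field_simps)
    moreover have "b - a * d / c \<noteq> 0" using True assms by (auto simp: field_simps g)
    ultimately show ?thesis using True by (intro big[of "M2 (b - a * d / c) a 0 c" "d / c"]) auto
  next
    case False
    have d: "d \<noteq> 0" "pw 1 (c / d)"
      using False assms by (auto simp: g in_pow_def val_divide)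
    have "m2mult (M2 (a - b * c / d) b 0 d) (nb (c / d)) = g" using d by (simp add: g nb_def field_simps)
    moreover have "a - b * c / d \<noteq> 0" using d assms by (auto simp: field_simps g)
    ultimately show ?thesis using d by (intro small[of "M2 (a - b * c / d) b 0 d" "c / d"]) auto
  qed
qed

text \<open>A smooth vector fixed by the upper unipotents is fixed by a small lower unipotent as well,
hence by all of \<open>SL\<^sub>2\<close>.\<close>

lemma unipotent_fixed_nb:
  assumes x: "\<And>u. ac (nn u) x = x"
  shows "ac (nb v) x = x"
proof -
  obtain n where n: "\<And>k. k \<in> Kcong val n \<Longrightarrow> ac k x = x" using ac_smooth by blast
  define c where "c = uf ^ n"
  have c0: "c \<noteq> 0" by (simp add: c_def)
  have c: "ac (nb c) x = x" by (rule n[OF nb_Kcong]) (simp add: c_def in_pow_def)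
  \<comment> \<open>A Weyl element assembled from the one small lower unipotent known to fix
    \<open>x\<close>; conjugation by it turns lower unipotents into upper ones.\<close>
  define w where "w = M2 0 (- 1 / c) c 0"
  have "w = m2mult (nn (- 1 / c)) (m2mult (nb c) (nn (- 1 / c)))" using c0 by (simp add: w_def mdefs)
  hence w: "ac w x = x" using c x by (simp add: ac_mult)
  have "m2mult (nb v) w = m2mult w (nn (- v / c ^ 2))"
    using c0 by (simp add: mdefs w_def field_simps power2_eq_square)
  moreover have "w \<in> GL2" using c0 by (simp add: w_def)
  ultimately have "ac (nb v) (ac w x) = ac w (ac (nn (- v / c ^ 2)) x)" by (simp flip: ac_mult)
  thus ?thesis using w x by simp
qed

lemma unipotent_fixed_det:
  assumes x: "\<And>u. ac (nn u) x = x" and g: "g \<in> GL2"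
  shows "ac g x = ac (dg 1 (m2det g)) x"
proof -
  have nb: "ac (nb v) x = x" for v by (rule unipotent_fixed_nb[OF x])
  \<comment> \<open>For c nonzero, g is diag(1, det g) times unipotents fixing \<open>x\<close>. The
    case c = 0 is brought to this one by left multiplication with \<open>nb 1\<close>, which makes
    the lower left entry equal to a.\<close>
  have *: "ac (M2 a b c d) x = ac (dg 1 (a * d - b * c)) x" if c: "c \<noteq> 0" and e0: "a * d - b * c \<noteq> 0" for a b c d
  proof -
    define e where "e = a * d - b * c"
    define \<alpha> where "\<alpha> = (a - 1) / c"
    define b' where "b' = b - \<alpha> * d"
    have e: "e \<noteq> 0" using e0 by (simp add: e_def)
    have h1: "\<alpha> * c = a - 1" using c by (simp add: \<alpha>_def)
    have "c * b' = c * b - (\<alpha> * c) * d" by (simp add: b'_def algebra_simps)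
    hence h2: "c * b' + e = d" by (simp add: h1 e_def algebra_simps)
    have h3: "b' + \<alpha> * d = b" by (simp add: b'_def)
    have "m2mult (dg 1 e) (m2mult (nn (\<alpha> * e)) (m2mult (nb (c / e)) (nn b'))) =
       M2 (1 + \<alpha> * c) (b' + \<alpha> * (c * b' + e)) c (c * b' + e)"
      using e by (simp add: mdefs algebra_simps)
    also have "\<dots> = M2 a b c d" by (simp only: h1 h2 h3) simp
    finally have "M2 a b c d = m2mult (dg 1 e) (m2mult (nn (\<alpha> * e)) (m2mult (nb (c / e)) (nn b')))" ..
    thus ?thesis using e by (simp add: ac_mult x nb flip: e_def)
  qed
  obtain a b c d where g': "g = M2 a b c d" by (cases g)
  show ?thesis
  proof (cases "c = 0")
    case False
    thus ?thesis using * g by (simp add: g')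
  next
    case True
    have e: "a * d \<noteq> 0" using g True by (simp add: g')
    have "m2mult (nb 1) g = M2 a b a (b + d)" using True by (simp add: g' nb_def)
    hence "ac (nb 1) (ac g x) = ac (M2 a b a (b + d)) x" using g by (simp flip: ac_mult)
    also have "\<dots> = ac (dg 1 (a * d)) x"
      using *[of a a "b + d" b] e by (simp add: algebra_simps)
    also have "\<dots> = ac (m2mult (dg 1 (a * d)) (nb (1 / (a * d)))) x" using e by (simp add: ac_mult nb)
    also have "m2mult (dg 1 (a * d)) (nb (1 / (a * d))) = m2mult (nb 1) (dg 1 (a * d))"
      using e by (simp add: mdefs)
    also have "ac \<dots> x = ac (nb 1) (ac (dg 1 (a * d)) x)" using e by (intro ac_mult) auto
    finally show ?thesis using True by (simp add: ac_eq_iff g')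
  qed
qed

end

text \<open>\<open>Sg\<close> stands for S / \<tau> realised inside \<open>C\<close>, with
  \<open>\<phi>\<close> forgotten; irreducibility and the central character are carried over to
  functions.\<close>

locale sigma = smooth_mod val uf p uE red sm ac
  for val :: "'f::field \<Rightarrow> int" and uf :: 'f and p :: nat
    and uE :: "'o::idom" and red :: "'o \<Rightarrow> 'k::field"
    and sm :: "'o \<Rightarrow> 'w::ab_group_add \<Rightarrow> 'w" and ac :: "'f m2 \<Rightarrow> 'w \<Rightarrow> 'w" +
  fixes Sg :: "('f m2 \<Rightarrow> 'w) set" and \<chi> :: "'f \<Rightarrow> 'o"
  assumes Sg_C: "Sg \<subseteq> C" and Sg_sub: "S.subspace Sg"
    and Sg_act: "\<And>g f. g \<in> GL2 \<Longrightarrow> f \<in> Sg \<Longrightarrow> act g f \<in> Sg"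
    and irr: "\<And>N. N \<subseteq> Sg \<Longrightarrow> S.subspace N \<Longrightarrow> (\<And>g f. g \<in> GL2 \<Longrightarrow> f \<in> N \<Longrightarrow> act g f \<in> N) \<Longrightarrow> N = {0} \<or> N = Sg"
    and Sg_nz: "Sg \<noteq> {0}"
    and central: "\<And>z f. z \<noteq> 0 \<Longrightarrow> f \<in> Sg \<Longrightarrow> act (scalar_m2 z) f = smf (\<chi> z) f"
begin

lemma SgC: "f \<in> Sg \<Longrightarrow> f \<in> C" using Sg_C by blast
lemma Sg0: "0 \<in> Sg" using Sg_sub S.subspace_0 by blast

lemma span_act_closed:
  assumes "\<And>g f. g \<in> G \<Longrightarrow> f \<in> E \<Longrightarrow> act g f \<in> S.span E" "g \<in> G" "f \<in> S.span E"
  shows "act g f \<in> S.span E"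
proof -
  have "S.span E \<subseteq> {f. act g f \<in> S.span E}"
    using assms(1)[OF assms(2)]
    by (intro S.span_minimal S.subspaceI)
      (auto simp: act_add act_smf intro: S.span_add S.span_scale S.span_zero)
  thus ?thesis using assms(3) by blast
qed

lemma Sg_generated: assumes "f \<in> Sg" "f \<noteq> 0" shows "Sg = S.span ((\<lambda>g. act g f) ` GL2)"
proof -
  let ?E = "(\<lambda>g. act g f) ` GL2"
  have "?E \<subseteq> Sg" using assms Sg_act by blast
  hence 1: "S.span ?E \<subseteq> Sg" using Sg_sub by (rule S.span_minimal)
  have "S.span ?E = {0} \<or> S.span ?E = Sg"
  proof (rule irr[OF 1 S.subspace_span])
    fix g :: "'f m2" and f' assume g: "g \<in> GL2" "f' \<in> S.span ?E"
    have "act h f'' \<in> S.span ?E" if h: "h \<in> GL2" and f'': "f'' \<in> ?E" for h f''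
    proof -
      obtain k where k: "k \<in> GL2" "f'' = act k f" using f'' by blast
      have "act h f'' = act (m2mult h k) f" using h k by (simp add: act_mult)
      thus ?thesis using h k by (intro S.span_base) auto
    qed
    thus "act g f' \<in> S.span ?E" using g by (rule span_act_closed)
  qed
  moreover have "f \<in> S.span ?E"
    using act_one[OF SgC[OF assms(1)]] by (intro S.span_base image_eqI[of _ _ m2one]) auto
  ultimately show ?thesis using assms(2) by auto
qed

end

section \<open>Excluding divisible modules\<close>

context smooth_mod
begin

definition th :: "int \<Rightarrow> 'w \<Rightarrow> 'w" where "th j x = ac (dg 1 (uf powi j)) x"

lemma th_0 [simp]: "th 0 x = x"
  using ac_one[of x] by (simp add: th_def mdefs)

lemma th_th: "th i (th j x) = th (i + j) x"
proof -
  have "m2mult (dg 1 (uf powi i)) (dg 1 (uf powi j)) = dg 1 (uf powi (i + j))"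
    by (simp add: mdefs power_int_add)
  thus ?thesis by (simp add: th_def flip: ac_mult)
qed

lemma th_add: "th j (x + y) = th j x + th j y" by (simp add: th_def ac_add)
lemma th_sm: "th j (sm a x) = sm a (th j x)" by (simp add: th_def ac_sm)
lemma th_zero [simp]: "th j 0 = 0" by (simp add: th_def)
lemma th_eq_0: "th j x = 0 \<longleftrightarrow> x = 0" by (simp add: th_def ac_eq_0)

lemma nn_th: "ac (nn u) (th j x) = th j (ac (nn (u * uf powi j)) x)"
proof -
  have "m2mult (nn u) (dg 1 (uf powi j)) = m2mult (dg 1 (uf powi j)) (nn (u * uf powi j))"
    by (simp add: mdefs)
  thus ?thesis by (simp add: th_def flip: ac_mult)
qed

definition ev :: "'o poly \<Rightarrow> 'w \<Rightarrow> 'w" where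
  "ev P x = fold_coeffs (\<lambda>c y. sm c x + th 1 y) P 0"

lemma ev_0 [simp]: "ev 0 x = 0" by (simp add: ev_def)

lemma ev_pCons: "ev (pCons c P) x = sm c x + th 1 (ev P x)"
proof (cases "c = 0 \<and> P = 0")
  case False
  thus ?thesis by (auto simp: ev_def cCons_def fold_coeffs_def cCons_not_0_eq)
qed simp

lemma ev_add: "ev (P + Q) x = ev P x + ev Q x"
proof (induction P arbitrary: Q)
  case (pCons c P)
  show ?case by (cases Q) (simp add: ev_pCons pCons W.scale_left_distrib th_add)
qed simp

lemma ev_smult: "ev (smult a P) x = sm a (ev P x)"
  by (induction P) (simp_all add: ev_pCons W.scale_right_distrib th_sm)

lemma ev_x_0 [simp]: "ev P 0 = 0"
  by (induction P) (simp_all add: ev_pCons)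
lemma ev_x_add: "ev P (x + y) = ev P x + ev P y"
  by (induction P) (simp_all add: ev_pCons W.scale_right_distrib th_add)
lemma ev_x_sm: "ev P (sm a x) = sm a (ev P x)"
  by (induction P) (simp_all add: ev_pCons W.scale_right_distrib th_sm mult.commute)
lemma ev_x_th: "ev P (th j x) = th j (ev P x)"
  by (induction P) (simp_all add: ev_pCons th_add th_sm th_th add.commute)

lemma ev_mult: "ev (P * Q) x = ev P (ev Q x)"
  by (induction P) (simp_all add: ev_pCons ev_add ev_smult)

lemma ev_monom: "ev (monom 1 n) x = th (int n) x"
  by (induction n) (simp_all add: monom_0 monom_Suc ev_pCons th_th add.commute)

lemma ev_closed:
  assumes "W.subspace V" "\<And>x. x \<in> V \<Longrightarrow> th 1 x \<in> V" "x \<in> V"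
  shows "ev P x \<in> V"
  using assms by (induction P) (auto simp: ev_pCons intro: W.subspace_0 W.subspace_add W.subspace_scale)

text \<open>The module over O[\<theta>, \<theta>^-1] generated by \<open>E\<close>, where \<theta>
  is \<open>th 1\<close>.\<close>

definition spi :: "'w set \<Rightarrow> 'w set" where
  "spi E = W.span {th j e | j e. e \<in> E}"

lemma spi_subspace [simp]: "W.subspace (spi E)" by (simp add: spi_def)

lemma spi_th: assumes "x \<in> spi E" shows "th j x \<in> spi E"
proof -
  have "th i e \<in> W.span {th j e | j e. e \<in> E}" if "e \<in> E" for i e
    by (rule W.span_base) (use that in blast)
  hence "spi E \<subseteq> {x. th j x \<in> spi E}"
    unfolding spi_def
    by (intro W.span_minimal W.subspaceI)
      (auto simp: th_add th_sm th_th intro: W.span_add W.span_scale W.span_zero)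
  thus ?thesis using assms by blast
qed

lemma spi_ev: "x \<in> spi E \<Longrightarrow> ev P x \<in> spi E"
  by (rule ev_closed) (auto intro: spi_th)

lemma spi_base: "e \<in> E \<Longrightarrow> e \<in> spi E"
  unfolding spi_def by (rule W.span_base) (auto intro: exI[of _ 0] exI[of _ e])

text \<open>A high power of \<theta> clears the negative exponents on \<open>e\<close>, so
  polynomials can be used in place of Laurent polynomials.\<close>

lemma spi_insert:
  assumes "x \<in> spi (insert e E)"
  shows "\<exists>N P. \<exists>r\<in>spi E. th (int N) x = ev P e + r"
proof -
  let ?V = "{x. \<exists>N P. \<exists>r\<in>spi E. th (int N) x = ev P e + r}"
  have "spi (insert e E) \<subseteq> ?V"
    unfolding spi_def[of "insert e E"]
  proof (intro W.span_minimal W.subspaceI subsetI)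
    fix y assume "y \<in> {th j e' | j e'. e' \<in> insert e E}"
    then obtain j e' where y: "y = th j e'" "e' \<in> insert e E" by blast
    have 1: "th (int (nat \<bar>j\<bar>)) y = th (int (nat (\<bar>j\<bar> + j))) e'"
      using abs_ge_minus_self[of j] by (simp add: y th_th del: abs_ge_minus_self)
    show "y \<in> ?V"
    proof (cases "e' = e")
      case True
      hence "th (int (nat \<bar>j\<bar>)) y = ev (monom 1 (nat (\<bar>j\<bar> + j))) e + 0" using 1 by (simp add: ev_monom)
      moreover have "0 \<in> spi E" by (simp add: W.subspace_0)
      ultimately show ?thesis by blast
    next
      case False
      hence "th (int 0) y = ev 0 e + y" "y \<in> spi E" using y by (auto intro: spi_th spi_base)
      thus ?thesis by blast
    qed
  next
    show "0 \<in> ?V" using W.subspace_0[OF spi_subspace[of E]] by (auto intro!: exI[of _ 0] bexI[of _ 0])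
  next
    fix x y assume "x \<in> ?V" "y \<in> ?V"
    then obtain N P r N' P' r' where 1: "r \<in> spi E" "th (int N) x = ev P e + r"
      "r' \<in> spi E" "th (int N') y = ev P' e + r'" by auto
    have "th (int (N + N')) (x + y) = th (int N') (th (int N) x) + th (int N) (th (int N') y)"
      by (simp add: th_th th_add add.commute)
    also have "\<dots> = ev (monom 1 N' * P + monom 1 N * P') e + (th (int N') r + th (int N) r')"
      by (simp add: 1 th_add ev_add ev_mult ev_monom)
    finally have "th (int (N + N')) (x + y) =
      ev (monom 1 N' * P + monom 1 N * P') e + (th (int N') r + th (int N) r')" .
    moreover have "th (int N') r + th (int N) r' \<in> spi E" using 1 by (intro W.subspace_add[OF spi_subspace] spi_th)
    ultimately show "x + y \<in> ?V" by blast
  next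
    fix c x assume "x \<in> ?V"
    then obtain N P r where 1: "r \<in> spi E" "th (int N) x = ev P e + r" by auto
    have "th (int N) (sm c x) = ev (smult c P) e + sm c r"
      by (simp add: th_sm 1 W.scale_right_distrib ev_smult)
    moreover have "sm c r \<in> spi E" using 1 by (intro W.subspace_scale[OF spi_subspace])
    ultimately show "sm c x \<in> ?V" by blast
  qed
  thus ?thesis using assms by blast
qed

definition monomial_mod_uE :: "'o poly \<Rightarrow> bool" where
  "monomial_mod_uE D \<longleftrightarrow> (\<exists>a D'. D = monom 1 a + smult uE D')"

lemma monomial_mod_uE_mult: "monomial_mod_uE D \<Longrightarrow> monomial_mod_uE D' \<Longrightarrow> monomial_mod_uE (D * D')"
proof -
  assume "monomial_mod_uE D" "monomial_mod_uE D'"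
  then obtain a E b E' where "D = monom 1 a + smult uE E" "D' = monom 1 b + smult uE E'" by (auto simp: monomial_mod_uE_def)
  hence "D * D' = monom 1 (a + b) + smult uE (E * monom 1 b + monom 1 a * E' + smult uE (E * E'))"
    by (simp add: algebra_simps mult_monom smult_add_right)
  thus ?thesis unfolding monomial_mod_uE_def by blast
qed

text \<open>The determinant trick for a finitely generated \<open>O[\<theta>, \<theta>\<^sup>-\<^sup>1]\<close>-module that is divisible by
the uniformizer, done by eliminating one generator at a time.\<close>

lemma divisible_annihilator:
  assumes "finite E" and div: "\<And>x. x \<in> spi E \<Longrightarrow> \<exists>x'\<in>spi E. x = sm uE x'"
  shows "\<exists>D. monomial_mod_uE D \<and> (\<forall>x\<in>spi E. ev D x = 0)"
proof -
  have "\<exists>D. monomial_mod_uE D \<and> (\<forall>x\<in>spi E. ev D x \<in> spi E')" if "finite E'" "finite B" "E' \<union> B = E" for E' B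
    using that(2,1,3)
  proof (induction B arbitrary: E' rule: finite_induct)
    case empty
    have "monomial_mod_uE 1" unfolding monomial_mod_uE_def by (rule exI[of _ 0], rule exI[of _ 0]) (simp add: monom_0 one_pCons)
    moreover have "ev 1 x = x" for x by (simp add: one_pCons ev_pCons)
    ultimately show ?case using empty by (intro exI[of _ 1]) auto
  next
    case (insert e B)
    have "\<exists>D. monomial_mod_uE D \<and> (\<forall>x\<in>spi E. ev D x \<in> spi (insert e E'))"
      by (rule insert.IH) (use insert.prems in auto)
    then obtain D where D: "monomial_mod_uE D" "\<And>x. x \<in> spi E \<Longrightarrow> ev D x \<in> spi (insert e E')"
      by blast
    \<comment> \<open>The relation for a quotient x of e by \<open>uE\<close>, multiplied by
      \<open>uE\<close>, shows that X^N D - uE P sends e into the module of the remaining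
      generators. Subtracting a multiple of \<open>uE\<close> keeps the polynomial monomial modulo
      \<open>uE\<close>.\<close>
    have "e \<in> spi E" using insert.prems by (intro spi_base) auto
    then obtain x where x: "x \<in> spi E" "e = sm uE x" using div by blast
    obtain N P r where r: "r \<in> spi E'" "th (int N) (ev D x) = ev P e + r"
      using spi_insert[OF D(2)[OF x(1)]] by blast
    have "th (int N) (ev D e) = th (int N) (sm uE (ev D x))" by (subst x(2)) (simp add: ev_x_sm)
    also have "\<dots> = sm uE (ev P e) + sm uE r" by (simp add: th_sm r W.scale_right_distrib)
    finally have e: "ev (monom 1 N * D - smult uE P) e = sm uE r"
      using ev_add[of "monom 1 N * D - smult uE P" "smult uE P" e]
      by (simp add: ev_mult ev_monom ev_smult)
    define D' where "D' = monom 1 N * D - smult uE P"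
    have "monomial_mod_uE D'"
    proof -
      obtain a D0 where "D = monom 1 a + smult uE D0" using D(1) by (auto simp: monomial_mod_uE_def)
      hence "D' = monom 1 (N + a) + smult uE (monom 1 N * D0 - P)"
        by (simp add: D'_def algebra_simps mult_monom smult_diff_right)
      thus ?thesis unfolding monomial_mod_uE_def by blast
    qed
    have D'e: "ev D' e \<in> spi E'" using e r(1) by (simp add: D'_def W.subspace_scale)
    have "spi (insert e E') \<subseteq> {x. ev D' x \<in> spi E'}"
      unfolding spi_def[of "insert e E'"]
    proof (intro W.span_minimal W.subspaceI subsetI)
      fix y assume "y \<in> {th j e' | j e'. e' \<in> insert e E'}"
      thus "y \<in> {x. ev D' x \<in> spi E'}" using D'e by (auto simp: ev_x_th intro: spi_th spi_ev spi_base)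
    qed (auto simp: ev_x_add ev_x_sm intro: W.subspace_0 W.subspace_add W.subspace_scale)
    hence "ev (D' * D) x \<in> spi E'" if "x \<in> spi E" for x using D(2)[OF that] by (auto simp: ev_mult)
    thus ?case using monomial_mod_uE_mult[OF \<open>monomial_mod_uE D'\<close> D(1)] by blast
  qed
  from this[of "{}" E] assms(1) obtain D where D: "monomial_mod_uE D" "\<And>x. x \<in> spi E \<Longrightarrow> ev D x \<in> spi {}" by auto
  have "spi {} = {0}" by (simp add: spi_def)
  thus ?thesis using D by auto
qed

end

locale sigma_div = sigma val uf p uE red sm ac Sg \<chi>
  for val :: "'f::field \<Rightarrow> int" and uf :: 'f and p :: nat
    and uE :: "'o::idom" and red :: "'o \<Rightarrow> 'k::field"
    and sm :: "'o \<Rightarrow> 'w::ab_group_add \<Rightarrow> 'w" and ac :: "'f m2 \<Rightarrow> 'w \<Rightarrow> 'w"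
    and Sg :: "('f m2 \<Rightarrow> 'w) set" and \<chi> :: "'f \<Rightarrow> 'o" +
  assumes Sg_div: "\<And>f. f \<in> Sg \<Longrightarrow> \<exists>f'\<in>Sg. f = smf uE f'"
begin

definition X :: "'w set" where "X = (\<lambda>f. FF f 0) ` Sg"

lemma X_sub: "W.subspace X"
proof (intro W.subspaceI)
  show "0 \<in> X" using Sg0 by (force simp: X_def)
  show "x + y \<in> X" if "x \<in> X" "y \<in> X" for x y
    using that S.subspace_add[OF Sg_sub] by (auto simp: X_def simp flip: FF_add)
  show "sm c x \<in> X" if "x \<in> X" for c x
    using that S.subspace_scale[OF Sg_sub] by (auto simp: X_def simp flip: FF_smf)
qed

lemma X_FF: "f \<in> Sg \<Longrightarrow> FF f u \<in> X"
  using FF_nn[OF SgC, of f u 0] Sg_act[of "nn u" f] by (force simp: X_def)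

lemma X_dg: "x \<in> X \<Longrightarrow> e \<noteq> 0 \<Longrightarrow> ac (dg 1 e) x \<in> X"
proof -
  assume "x \<in> X" "e \<noteq> 0"
  then obtain f where f: "f \<in> Sg" "x = FF f 0" by (auto simp: X_def)
  thus ?thesis using FF_dg[OF SgC, of f e 1 0] X_FF[OF Sg_act, of "dg e 1" f 0] \<open>e \<noteq> 0\<close> by simp
qed

lemma X_th: "x \<in> X \<Longrightarrow> th j x \<in> X" by (simp add: th_def X_dg)

text \<open>Here the cocycle rule enters: f(s s) = 0, so the translate of f by s takes the value - s
  f(s) at s.\<close>

lemma X_ss: "x \<in> X \<Longrightarrow> ac ss x \<in> X"
proof -
  assume "x \<in> X"
  then obtain f where f: "f \<in> Sg" "x = FF f 0" by (auto simp: X_def)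
  have "FF (act ss f) 0 = - ac ss x"
    using C_one[OF SgC[OF f(1)]] f(2) by (simp add: FF_def act_def mdefs)
  hence "- ac ss x \<in> X" using X_FF[OF Sg_act, of ss f 0] f by simp
  thus ?thesis using W.subspace_neg[OF X_sub, of "- ac ss x"] by simp
qed

lemma X_scalar: "x \<in> X \<Longrightarrow> z \<noteq> 0 \<Longrightarrow> ac (scalar_m2 z) x = sm (\<chi> z) x"
  unfolding X_def using FF_scalar[OF SgC] central by (auto simp: FF_smf simp flip: FF_scalar[OF SgC])

lemma X_div: "x \<in> X \<Longrightarrow> \<exists>x'\<in>X. x = sm uE x'"
  unfolding X_def using Sg_div by (force simp: FF_smf)

text \<open>A Borel translate changes the value at s by a diagonal matrix and a shift of the
  argument. The diagonal matrix is a scalar, acting through O, times a power of \<theta>, times a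
  unit that K absorbs; so the finitely many values of one finite K-orbit suffice.\<close>

lemma X_generated: "\<exists>E. finite E \<and> E \<subseteq> X \<and> X = spi E"
proof -
  obtain f0 where f0: "f0 \<in> Sg" "f0 \<noteq> 0" using Sg_nz Sg0 by auto
  define E where "E = (\<Union>f\<in>(\<lambda>k. act k f0) ` KK. range (FF f))"
  have mem: "act k f0 \<in> Sg" if "k \<in> KK" for k using that KK_GL2 Sg_act f0 by blast
  have "finite E" unfolding E_def
    using finite_KK_orbit[OF SgC[OF f0(1)]] finite_range_FF[OF SgC[OF mem]] by blast
  moreover have EX: "E \<subseteq> X" using mem X_FF by (auto simp: E_def)
  moreover have "spi E \<subseteq> X" unfolding spi_def using EX X_th by (intro W.span_minimal X_sub) auto
  moreover have "X \<subseteq> spi E"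
  proof -
    have bk: "FF (act (m2mult b k) f0) 0 \<in> spi E" if b: "b \<in> Borel" and k: "k \<in> KK" for b k
    proof -
      obtain \<alpha> \<beta> \<gamma> where b': "b = M2 \<alpha> \<beta> 0 \<gamma>" "\<alpha> \<noteq> 0" "\<gamma> \<noteq> 0" using b by (cases b) auto
      define fk where "fk = act k f0"
      have fk: "fk \<in> Sg" unfolding fk_def by (rule mem[OF k])
      define j where "j = val (\<alpha> / \<gamma>)"
      define \<epsilon> where "\<epsilon> = \<alpha> / \<gamma> / uf powi j"
      have \<epsilon>: "ou \<epsilon>" using b' by (auto simp: \<epsilon>_def j_def ou_def val_divide val_mult)
      have \<alpha>: "\<alpha> = \<gamma> * (uf powi j * \<epsilon>)" using b' by (simp add: \<epsilon>_def)
      have "FF (act (m2mult b k) f0) 0 = FF (act b fk) 0"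
        by (simp add: act_mult[OF Borel_GL2[OF b] KK_GL2[OF k]] fk_def)
      also have "\<dots> = fk (M2 0 \<gamma> \<alpha> \<beta>)" using b SgC[OF fk] by (simp add: FF_def act_Borel b')
      also have "\<dots> = ac (dg \<gamma> \<alpha>) (FF fk (\<beta> / \<alpha>))" using b' by (simp add: C_formula[OF SgC[OF fk]] dg_def)
      also have "dg \<gamma> \<alpha> = m2mult (scalar_m2 \<gamma>) (m2mult (dg 1 (uf powi j)) (dg 1 \<epsilon>))"
        by (subst \<alpha>) (simp add: mdefs mult_ac)
      also have "ac \<dots> (FF fk (\<beta> / \<alpha>)) = ac (scalar_m2 \<gamma>) (th j (ac (dg 1 \<epsilon>) (FF fk (\<beta> / \<alpha>))))"
        using b' \<epsilon> by (simp add: ac_mult th_def ou_def)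
      also have "ac (dg 1 \<epsilon>) (FF fk (\<beta> / \<alpha>)) = FF (act (dg \<epsilon> 1) fk) (\<beta> / \<alpha> * \<epsilon>)"
        using \<epsilon> FF_dg[OF SgC[OF fk], of \<epsilon> 1 "\<beta> / \<alpha> * \<epsilon>"] by (simp add: ou_def)
      also have "act (dg \<epsilon> 1) fk = act (m2mult (dg \<epsilon> 1) k) f0"
        using \<epsilon> k KK_GL2 by (simp add: act_mult fk_def ou_def)
      finally have eq: "FF (act (m2mult b k) f0) 0 =
        ac (scalar_m2 \<gamma>) (th j (FF (act (m2mult (dg \<epsilon> 1) k) f0) (\<beta> / \<alpha> * \<epsilon>)))" .
      have kk: "m2mult (dg \<epsilon> 1) k \<in> KK" using k \<epsilon> by (intro KK_mult KK_gens) auto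
      hence e: "FF (act (m2mult (dg \<epsilon> 1) k) f0) (\<beta> / \<alpha> * \<epsilon>) \<in> E" by (auto simp: E_def)
      have "FF (act (m2mult b k) f0) 0 = sm (\<chi> \<gamma>) (th j (FF (act (m2mult (dg \<epsilon> 1) k) f0) (\<beta> / \<alpha> * \<epsilon>)))"
        unfolding eq using e EX b' by (intro X_scalar X_th) auto
      thus ?thesis using spi_th[OF spi_base[OF e]] by (simp add: W.subspace_scale)
    qed
    have "FF (act g f0) 0 \<in> spi E" if "g \<in> GL2" for g
      using that
    proof (cases rule: Iwasawa)
      case (big b u)
      thus ?thesis by (auto intro!: bk)
    next
      case (small b c)
      thus ?thesis using pw_mono[of 1 c 0] by (auto intro!: bk KK_gens)
    qed
    hence "S.span ((\<lambda>g. act g f0) ` GL2) \<subseteq> {f. FF f 0 \<in> spi E}"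
      by (intro S.span_minimal S.subspaceI)
        (auto simp: FF_add FF_smf intro: W.subspace_0 W.subspace_add W.subspace_scale)
    hence "FF f 0 \<in> spi E" if "f \<in> Sg" for f using that Sg_generated[OF f0] by blast
    thus ?thesis unfolding X_def by blast
  qed
  ultimately show ?thesis by blast
qed

text \<open>The eigenvalues of \<open>\<theta>\<close> on a divisible finitely generated module of positive powers would be
units, because a vector on which \<open>\<theta>\<close> is invertible is fixed by \<open>SL\<^sub>2\<close>, where \<open>\<theta>\<^sup>2\<close> is central.\<close>

lemma positive_powers_fg:
  assumes "finite E" "E \<subseteq> X"
  shows "\<exists>E'. finite E' \<and> E' \<subseteq> X \<and> (\<forall>i. \<forall>e\<in>E. th (int i) e \<in> W.span E')"
proof -
  obtain G where G: "finite G" "X = spi G" using X_generated by blast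
  obtain D where D: "monomial_mod_uE D" "\<And>x. x \<in> X \<Longrightarrow> ev D x = 0"
    using divisible_annihilator[OF G(1)] X_div G(2) by auto
  obtain a D' where D': "D = monom 1 a + smult uE D'" using D(1) by (auto simp: monomial_mod_uE_def)
  \<comment> \<open>The annihilator turns \<theta>^a into \<open>uE\<close> times a polynomial in
    \<theta>; as \<theta>^a is injective, so is \<open>uE\<close> on \<open>X\<close>.\<close>
  have tha: "th (int a) x = sm uE (ev (- D') x)" if "x \<in> X" for x
    using D(2)[OF that] ev_add[of D' "- D'" x] W.scale_right_distrib[of uE "ev D' x" "ev (- D') x"]
    by (simp add: D' ev_add ev_monom ev_smult add_eq_0_iff)
  have inj: "x = 0" if "x \<in> X" "sm uE x = 0" for x
    using tha[OF that(1)] that(2) by (simp add: th_eq_0 flip: ev_x_sm)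
  have injn: "x = y" if "x \<in> X" "y \<in> X" "sm uE x = sm uE y" for x y
    using inj[of "x - y"] that W.subspace_diff[OF X_sub] by (simp add: W.scale_right_diff_distrib)
  have "D \<noteq> 0"
  proof
    assume "D = 0"
    hence "coeff D a = 0" by simp
    hence "1 = uE * (- coeff D' a)" by (simp add: D' eq_neg_iff_add_eq_0)
    thus False using uE_nunit by (metis dvd_triv_left)
  qed
  \<comment> \<open>Cancelling powers of X from an annihilator leaves a nonzero constant term, so
    the scalar c factors through \<theta>. As c is a unit times a power of \<open>uE\<close>,
    \<theta> is onto on stable submodules where \<open>uE\<close> is onto.\<close>
  obtain c P where cP: "c \<noteq> 0" "\<And>x. x \<in> X \<Longrightarrow> sm c x = th 1 (ev P x)"
  proof -
    have "\<exists>D0. coeff D0 0 \<noteq> 0 \<and> (\<forall>x\<in>X. ev D0 x = 0)" using \<open>D \<noteq> 0\<close> D(2)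
    proof (induction D)
      case (pCons d D)
      show ?case
      proof (cases "d = 0")
        case False
        thus ?thesis using pCons.prems by (intro exI[of _ "pCons d D"]) auto
      next
        case True
        have "ev D x = 0" if "x \<in> X" for x using pCons.prems(2)[OF that] True by (simp add: ev_pCons th_eq_0)
        moreover have "D \<noteq> 0" using True pCons.prems by auto
        ultimately show ?thesis using pCons.IH by blast
      qed
    qed simp
    then obtain D0 where D0: "coeff D0 0 \<noteq> 0" "\<And>x. x \<in> X \<Longrightarrow> ev D0 x = 0" by blast
    obtain c P where "D0 = pCons c P" by (cases D0)
    hence c: "c \<noteq> 0" "\<And>x. x \<in> X \<Longrightarrow> sm c x + th 1 (ev P x) = 0" using D0 by (auto simp: ev_pCons)
    show ?thesis
    proof (rule that[of "- c" P])
      show "sm (- c) x = th 1 (ev P x)" if "x \<in> X" for x using c(2)[OF that] by (simp add: neg_eq_iff_add_eq_0)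
    qed (use c in simp)
  qed
  define Q where "Q = W.span {th (int i) e | i e. e \<in> E}"
  have Qsub: "W.subspace Q" by (simp add: Q_def)
  have QX: "Q \<subseteq> X" unfolding Q_def using assms(2) X_th by (intro W.span_minimal X_sub) auto
  have Qth: "th 1 x \<in> Q" if "x \<in> Q" for x
  proof -
    have "th 1 (th (int i) e) \<in> Q" if "e \<in> E" for i e
      unfolding Q_def th_th by (rule W.span_base) (use that in \<open>auto intro!: exI[of _ "Suc i"]\<close>)
    hence "Q \<subseteq> {x. th 1 x \<in> Q}" unfolding Q_def
      by (intro W.span_minimal W.subspaceI)
        (auto simp: th_add th_sm intro: W.span_zero W.span_add W.span_scale)
    thus ?thesis using that by blast
  qed
  have Qev: "ev P x \<in> Q" if "x \<in> Q" for P x by (rule ev_closed[OF Qsub]) (use Qth that in auto)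
  \<comment> \<open>One level serves all of \<open>Q\<close>, since positive powers of \<theta> only
    shrink the unipotent: n(u) \<theta>^i = \<theta>^i n(u uf^i).\<close>
  obtain m :: nat where m: "\<And>u x. x \<in> Q \<Longrightarrow> pw (int m) u \<Longrightarrow> ac (nn u) x = x"
  proof -
    have "\<exists>n. \<forall>u. pw (int n) u \<longrightarrow> ac (nn u) e = e" for e
      using ac_smooth[of e] nn_Kcong by blast
    then obtain n where n: "\<And>e u. pw (int (n e)) u \<Longrightarrow> ac (nn u) e = e" by metis
    define m where "m = Max (insert 0 (n ` E))"
    have nm: "n e \<le> m" if "e \<in> E" for e using that assms(1) by (auto simp: m_def intro: Max_ge)
    have "ac (nn u) x = x" if x: "x \<in> Q" and u: "pw (int m) u" for u x
    proof -
      have "ac (nn u) (th (int i) e) = th (int i) e" if "e \<in> E" for i e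
      proof -
        have "pw (int (n e)) (u * uf powi int i)"
          using pw_mult[OF u, of "int i" "uf powi int i"] nm[OF that]
          by (auto simp: in_pow_def[of val "int i"] intro: pw_mono)
        thus ?thesis by (simp add: nn_th n)
      qed
      hence "Q \<subseteq> {x. ac (nn u) x = x}" unfolding Q_def
        by (intro W.span_minimal W.subspaceI) (auto simp: ac_add ac_sm)
      thus ?thesis using x by blast
    qed
    thus ?thesis using that by blast
  qed
  \<comment> \<open>The part of \<open>Q\<close> obstructing separatedness. It has to vanish before
    \<open>complete_generation\<close> can be applied.\<close>
  define Qi where "Qi = {y. \<forall>n. \<exists>q\<in>Q. y = sm (uE ^ n) q}"
  have QiQ: "Qi \<subseteq> Q"
  proof
    fix y assume "y \<in> Qi"
    then obtain q where "q \<in> Q" "y = sm (uE ^ 0) q" unfolding Qi_def by blast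
    thus "y \<in> Q" by simp
  qed
  have Qi_sub: "W.subspace Qi"
  proof (intro W.subspaceI)
    show "0 \<in> Qi" using W.subspace_0[OF Qsub] by (auto simp: Qi_def intro!: bexI[of _ 0])
    fix x y assume xy: "x \<in> Qi" "y \<in> Qi"
    show "x + y \<in> Qi" unfolding Qi_def
    proof (clarify)
      fix n
      obtain q q' where "q \<in> Q" "x = sm (uE ^ n) q" "q' \<in> Q" "y = sm (uE ^ n) q'"
        using xy unfolding Qi_def by blast
      thus "\<exists>q\<in>Q. x + y = sm (uE ^ n) q"
        by (intro bexI[of _ "q + q'"]) (auto simp: W.scale_right_distrib intro: W.subspace_add[OF Qsub])
    qed
  next
    fix d x assume x: "x \<in> Qi"
    show "sm d x \<in> Qi" unfolding Qi_def
    proof (clarify)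
      fix n
      obtain q where "q \<in> Q" "x = sm (uE ^ n) q" using x unfolding Qi_def by blast
      thus "\<exists>q\<in>Q. sm d x = sm (uE ^ n) q"
        by (intro bexI[of _ "sm d q"]) (auto simp: mult.commute intro: W.subspace_scale[OF Qsub])
    qed
  qed
  have Qi_th: "th 1 y \<in> Qi" if y: "y \<in> Qi" for y unfolding Qi_def
  proof (clarify)
    fix n
    obtain q where "q \<in> Q" "y = sm (uE ^ n) q" using y unfolding Qi_def by blast
    thus "\<exists>q\<in>Q. th 1 y = sm (uE ^ n) q" using Qth by (auto simp: th_sm)
  qed
  have Qi_ev: "ev P y \<in> Qi" if "y \<in> Qi" for P y by (rule ev_closed[OF Qi_sub]) (use Qi_th that in auto)
  \<comment> \<open>Injectivity of \<open>uE\<close> makes the quotient \<open>q 1\<close> unique,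
    so all higher quotients witness that it is again in \<open>Qi\<close>.\<close>
  have Qi_div: "\<exists>y'\<in>Qi. y = sm uE y'" if y: "y \<in> Qi" for y
  proof -
    have "\<forall>n. \<exists>q. q \<in> Q \<and> y = sm (uE ^ n) q" using y unfolding Qi_def by blast
    then obtain q where q: "\<And>n. q n \<in> Q \<and> y = sm (uE ^ n) (q n)" by metis
    have "q 1 = sm (uE ^ n) (q (Suc n))" for n
    proof (rule injn)
      show "sm uE (q 1) = sm uE (sm (uE ^ n) (q (Suc n)))" using q[of 1] q[of "Suc n"] by simp
      show "q 1 \<in> X" "sm (uE ^ n) (q (Suc n)) \<in> X"
        using q QX by (auto intro: W.subspace_scale[OF X_sub])
    qed
    hence "q 1 \<in> Qi" unfolding Qi_def using q by blast
    thus ?thesis using q[of 1] by auto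
  qed
  have Qi_divn: "\<exists>y'\<in>Qi. y = sm (uE ^ n) y'" if "y \<in> Qi" for y n
    using that
  proof (induction n)
    case (Suc n)
    then obtain y' where "y' \<in> Qi" "y = sm (uE ^ n) y'" by blast
    moreover from this obtain y'' where "y'' \<in> Qi" "y' = sm uE y''" using Qi_div by blast
    ultimately show ?case by (intro bexI[of _ y'']) (auto simp: mult.commute)
  qed auto
  have Qi_surj: "\<exists>y'\<in>Qi. y = th 1 y'" if y: "y \<in> Qi" for y
  proof -
    obtain u e where ue: "u dvd 1" "c = u * uE ^ e" using dvr_rep[OF cP(1)] by blast
    obtain v where v: "1 = u * v" using ue(1) by (elim dvdE)
    obtain y' where y': "y' \<in> Qi" "y = sm (uE ^ e) y'" using Qi_divn[OF y] by blast
    define z where "z = sm v y'"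
    have z: "z \<in> Qi" unfolding z_def using y' Qi_sub by (auto intro: W.subspace_scale)
    have "sm c z = sm (u * v) y" by (simp add: z_def ue y' mult_ac)
    hence "y = sm c z" using v by simp
    also have "\<dots> = th 1 (ev P z)" using cP(2) z QiQ QX by blast
    finally show ?thesis using Qi_ev[OF z] by blast
  qed
  have Qi_surjn: "\<exists>y'\<in>Qi. y = th (int j) y'" if "y \<in> Qi" for y j
    using that
  proof (induction j)
    case (Suc j)
    then obtain y' where "y' \<in> Qi" "y = th (int j) y'" by blast
    moreover from this obtain y'' where "y'' \<in> Qi" "y' = th 1 y''" using Qi_surj by blast
    ultimately show ?case by (intro bexI[of _ y'']) (auto simp: th_th add.commute)
  qed auto
  have Qi0: "y = 0" if y: "y \<in> Qi" for y
  proof -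
    have yX: "y \<in> X" using y QiQ QX by blast
    \<comment> \<open>Since \<theta> is onto on \<open>Qi\<close>, one can write y = \<theta>^j y'
      with y' in \<open>Qi\<close>, which replaces u by u uf^j in p^m.\<close>
    have fixN: "ac (nn u) y = y" for u
    proof -
      define j where "j = nat (int m - val u)"
      obtain y' where y': "y' \<in> Qi" "y = th (int j) y'" using Qi_surjn[OF y] by blast
      have "pw (int m) (u * uf powi int j)"
        by (cases "u = 0") (auto simp: in_pow_def val_mult j_def)
      hence "ac (nn (u * uf powi int j)) y' = y'" using m y'(1) QiQ by blast
      thus ?thesis by (simp add: y'(2) nn_th)
    qed
    \<comment> \<open>A vector fixed by the unipotents sees a matrix only through its determinant,
      so \<theta>^(2i) acts like the scalar matrix uf^i. Hence the span of y and \<theta> y is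
      stable under \<theta> and its inverse, and it is divisible because \<theta>^a is a multiple of
      \<open>uE\<close>.\<close>
    have sq: "th (2 * i) y = sm (\<chi> (uf powi i)) y" for i
    proof -
      have "uf powi i \<noteq> 0" by simp
      hence "ac (scalar_m2 (uf powi i)) y = ac (dg 1 (m2det (scalar_m2 (uf powi i)))) y"
        by (intro unipotent_fixed_det[OF fixN] scalar_GL2)
      moreover have "m2det (scalar_m2 z) = z * z" for z :: 'f by (simp add: scalar_m2_def)
      moreover have "uf powi (i + i) = uf powi i * uf powi i" by (rule power_int_add) simp
      ultimately have "th (i + i) y = ac (scalar_m2 (uf powi i)) y" by (simp only: th_def)
      also have "\<dots> = sm (\<chi> (uf powi i)) y" by (rule X_scalar[OF yX]) simp
      finally show ?thesis by (simp only: mult_2)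
    qed
    define B where "B = W.span {y, th 1 y}"
    have Bsub: "W.subspace B" by (simp add: B_def)
    have yB: "y \<in> B" "th 1 y \<in> B" by (auto simp: B_def intro: W.span_base)
    have Bth: "th 1 x \<in> B" "th (-1) x \<in> B" if "x \<in> B" for x
    proof -
      have "th 1 (th 1 y) \<in> B" using sq[of 1] yB Bsub by (simp add: th_th W.subspace_scale)
      hence "B \<subseteq> {x. th 1 x \<in> B}" unfolding B_def using yB
        by (intro W.span_minimal W.subspaceI) (auto simp: B_def th_add th_sm intro: W.span_add W.span_scale W.span_zero)
      thus "th 1 x \<in> B" using that by blast
      have "th (-1) y = th 1 (th (2 * (-1)) y)" by (simp add: th_th)
      hence "th (-1) y \<in> B" unfolding sq using yB Bsub by (simp add: th_sm W.subspace_scale)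
      moreover have "th (-1) (th 1 y) = y" by (simp add: th_th)
      ultimately have "B \<subseteq> {x. th (-1) x \<in> B}" unfolding B_def using yB
        by (intro W.span_minimal W.subspaceI) (auto simp: B_def th_add th_sm intro: W.span_add W.span_scale W.span_zero)
      thus "th (-1) x \<in> B" using that by blast
    qed
    have BX: "B \<subseteq> X" unfolding B_def using yX X_th by (intro W.span_minimal X_sub) auto
    have Bthn: "th (- int i) x \<in> B" if "x \<in> B" for x i
      using that
    proof (induction i)
      case (Suc i)
      thus ?case using Bth(2)[of "th (- int i) x"] by (simp add: th_th)
    qed simp
    have Bev: "ev P x \<in> B" if "x \<in> B" for P x by (rule ev_closed[OF Bsub]) (use Bth that in auto)
    have "\<exists>x'\<in>B. x = sm uE x'" if x: "x \<in> B" for x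
    proof -
      have "x = th (int a) (th (- int a) x)" by (simp add: th_th)
      also have "\<dots> = sm uE (ev (- D') (th (- int a) x))"
        using Bthn[OF x] BX by (intro tha) auto
      finally show ?thesis using Bev[OF Bthn[OF x]] by blast
    qed
    hence "B = {0}" unfolding B_def by (intro nakayama[OF module_sm]) auto
    thus ?thesis using yB by simp
  qed
  \<comment> \<open>Exponents below a suffice: every higher power of \<theta> lands in
    \<open>uE\<close> times \<open>Q\<close>.\<close>
  define E' where "E' = (\<lambda>(i, e). th (int i) e) ` ({..<a} \<times> E)"
  have finE': "finite E'" unfolding E'_def using assms(1) by simp
  have E'Q: "E' \<subseteq> Q" by (auto simp: E'_def Q_def intro!: W.span_base)
  have "Q \<subseteq> W.span E'"
  proof (rule complete_generation[OF module_sm finE' Qsub E'Q])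
    fix q assume q: "q \<in> Q"
    define V where "V = {q. \<exists>x\<in>W.span E'. \<exists>q'\<in>Q. q = x + sm uE q'}"
    have "W.subspace V"
    proof (rule W.subspaceI)
      show "0 \<in> V" unfolding V_def using W.span_zero[of E'] W.subspace_0[OF Qsub] by force
    next
      fix x y assume "x \<in> V" "y \<in> V"
      then obtain x1 q1 x2 q2 where 1: "x1 \<in> W.span E'" "q1 \<in> Q" "x = x1 + sm uE q1"
        "x2 \<in> W.span E'" "q2 \<in> Q" "y = x2 + sm uE q2" unfolding V_def by blast
      have "x + y = (x1 + x2) + sm uE (q1 + q2)" using 1 by (simp add: W.scale_right_distrib)
      thus "x + y \<in> V"
        unfolding V_def using W.span_add[OF 1(1,4)] W.subspace_add[OF Qsub 1(2,5)] by blast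
    next
      fix d x assume "x \<in> V"
      then obtain x1 q1 where 1: "x1 \<in> W.span E'" "q1 \<in> Q" "x = x1 + sm uE q1"
        unfolding V_def by blast
      have "sm d x = sm d x1 + sm uE (sm d q1)" using 1 by (simp add: W.scale_right_distrib mult.commute)
      thus "sm d x \<in> V"
        unfolding V_def using W.span_scale[OF 1(1)] W.subspace_scale[OF Qsub 1(2)] by blast
    qed
    moreover have "{th (int i) e | i e. e \<in> E} \<subseteq> V"
    proof
      fix z assume "z \<in> {th (int i) e | i e. e \<in> E}"
      then obtain i e where z: "z = th (int i) e" "e \<in> E" by blast
      show "z \<in> V"
      proof (cases "i < a")
        case True
        hence "z \<in> W.span E'" using z by (auto simp: E'_def intro!: W.span_base)
        moreover have "z = z + sm uE 0" by simp
        ultimately show ?thesis unfolding V_def using W.subspace_0[OF Qsub] by blast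
      next
        case False
        have eX: "th (int (i - a)) e \<in> Q" using z by (auto simp: Q_def intro!: W.span_base)
        have "z = th (int a) (th (int (i - a)) e)" using False by (simp add: z th_th)
        also have "\<dots> = sm uE (ev (- D') (th (int (i - a)) e))" using eX QX by (intro tha) auto
        finally have "z = 0 + sm uE (ev (- D') (th (int (i - a)) e))" by simp
        thus ?thesis unfolding V_def using Qev[OF eX] W.span_zero by blast
      qed
    qed
    ultimately have "Q \<subseteq> V" unfolding Q_def by (intro W.span_minimal)
    thus "\<exists>x\<in>W.span E'. \<exists>q'\<in>Q. q = x + sm uE q'" using q V_def by blast
  next
    fix y assume "\<And>n. \<exists>q\<in>Q. y = sm (uE ^ n) q"
    thus "y = 0" by (intro Qi0) (simp add: Qi_def)
  qed
  moreover have "th (int i) e \<in> Q" if "e \<in> E" for i e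
    unfolding Q_def by (rule W.span_base) (use that in blast)
  moreover have "E' \<subseteq> X" using E'Q QX by blast
  ultimately show ?thesis using finE' by (intro exI[of _ E']) blast
qed

lemma sigma_div_False: False
proof -
  obtain E where E: "finite E" "E \<subseteq> X" "X = spi E" using X_generated by blast
  obtain E1 where E1: "finite E1" "E1 \<subseteq> X" "\<And>i e. e \<in> E \<Longrightarrow> th (int i) e \<in> W.span E1"
    using positive_powers_fg[OF E(1,2)] by metis
  have "ac ss ` E \<subseteq> X" using E X_ss by blast
  then obtain E2 where "finite E2" "E2 \<subseteq> X" "\<forall>i. \<forall>e\<in>ac ss ` E. th (int i) e \<in> W.span E2"
    using positive_powers_fg[OF finite_imageI[OF E(1)]] by meson
  hence E2: "finite E2" "E2 \<subseteq> X" "\<And>i e. e \<in> E \<Longrightarrow> th (int i) (ac ss e) \<in> W.span E2"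
    by simp_all
  define E' where "E' = E1 \<union> ac ss ` E2"
  have E'X: "E' \<subseteq> X" using E1 E2 X_ss by (auto simp: E'_def)
  \<comment> \<open>\<open>E2\<close> serves the negative exponents: \<theta>^-i is s \<theta>^i s
    up to the scalar matrix uf^-i, which acts through O on \<open>X\<close>.\<close>
  have "th j e \<in> W.span E'" if e: "e \<in> E" for j e
  proof (cases "j \<ge> 0")
    case True
    hence "th j e \<in> W.span E1" using E1(3)[OF e, of "nat j"] by simp
    thus ?thesis using W.span_mono[of E1 E'] by (auto simp: E'_def)
  next
    case False
    define i where "i = nat (- j)"
    have j: "j = - int i" using False by (simp add: i_def)
    have "dg 1 (uf powi j) = m2mult (scalar_m2 (uf powi j)) (m2mult ss (m2mult (dg 1 (uf powi int i)) ss))"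
      by (simp add: mdefs j power_int_minus)
    hence "th j e = ac (scalar_m2 (uf powi j)) (ac ss (th (int i) (ac ss e)))"
      by (simp add: th_def ac_mult)
    also have "\<dots> = sm (\<chi> (uf powi j)) (ac ss (th (int i) (ac ss e)))"
      by (intro X_scalar X_ss X_th) (use e E(2) in auto)
    finally have "th j e = sm (\<chi> (uf powi j)) (ac ss (th (int i) (ac ss e)))" .
    moreover have "ac ss x \<in> W.span E'" if "x \<in> E2" for x
      by (rule W.span_base) (use that in \<open>simp add: E'_def\<close>)
    hence "W.span E2 \<subseteq> {x. ac ss x \<in> W.span E'}"
      by (intro W.span_minimal W.subspaceI)
        (auto simp: ac_add ac_sm intro: W.span_zero W.span_add W.span_scale)
    hence "ac ss (th (int i) (ac ss e)) \<in> W.span E'" using E2(3)[OF e, of i] by blast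
    ultimately show ?thesis using W.span_scale by metis
  qed
  hence "X \<subseteq> W.span E'" unfolding E(3) spi_def by (intro W.span_minimal) auto
  moreover have "W.span E' \<subseteq> X" using E'X X_sub by (rule W.span_minimal)
  ultimately have X: "X = W.span E'" by blast
  have "W.span E' = {0}"
  proof (rule nakayama[OF module_sm])
    show "finite E'" using E1(1) E2(1) by (simp add: E'_def)
    show "\<exists>v'\<in>W.span E'. v = sm uE v'" if "v \<in> W.span E'" for v
      using that X_div unfolding X by blast
  qed
  hence "FF f u = 0" if "f \<in> Sg" for f u using X_FF[OF that, of u] X by blast
  hence "f = 0" if "f \<in> Sg" for f using C_eq_0[OF SgC[OF that]] that by blast
  thus False using Sg_nz Sg0 by blast
qed

end

section \<open>Invariants under the maximal compact subgroup\<close>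

context smooth_mod
begin

definition Kst :: "('f m2 \<Rightarrow> 'w) set \<Rightarrow> bool" where
  "Kst V \<longleftrightarrow> (\<forall>k\<in>KK. \<forall>v\<in>V. act k v \<in> V)"

definition nfix :: "('f m2 \<Rightarrow> 'w) \<Rightarrow> bool" where
  "nfix f \<longleftrightarrow> (\<forall>u. pw 0 u \<longrightarrow> act (nn u) f = f)"

text \<open>These elements generate K; the cases c a unit and c in p are the two cells of the Bruhat
  decomposition modulo p.\<close>

lemma KstI:
  assumes nn: "\<And>u v. pw 0 u \<Longrightarrow> v \<in> V \<Longrightarrow> act (nn u) v \<in> V"
    and dg: "\<And>a d v. ou a \<Longrightarrow> ou d \<Longrightarrow> v \<in> V \<Longrightarrow> act (dg a d) v \<in> V"
    and ss: "\<And>v. v \<in> V \<Longrightarrow> act ss v \<in> V"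
  shows "Kst V"
proof -
  have B: "act (M2 \<alpha> \<beta> 0 \<gamma>) v \<in> V" if "ou \<alpha>" "ou \<gamma>" "pw 0 \<beta>" "v \<in> V" for \<alpha> \<beta> \<gamma> v
  proof -
    have "M2 \<alpha> \<beta> 0 \<gamma> = m2mult (nn (\<beta> / \<gamma>)) (dg \<alpha> \<gamma>)" using that by (simp add: mdefs ou_def)
    moreover have "pw 0 (\<beta> / \<gamma>)" using that pw_divide[of \<gamma> 0 \<beta>] by (simp add: ou_def)
    ultimately show ?thesis using nn[OF _ dg] that by (simp add: act_mult ou_def)
  qed
  have "act k v \<in> V" if k: "k \<in> KK" and v: "v \<in> V" for k v
  proof -
    obtain a b c d where k': "k = M2 a b c d" by (cases k)
    have kk: "pw 0 a" "pw 0 b" "pw 0 c" "pw 0 d" "ou (a * d - b * c)" using k by (auto simp: k')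
    show ?thesis
    proof (cases "ou c")
      case True
      hence c: "c \<noteq> 0" "val c = 0" by (auto simp: ou_def)
      have e: "k = m2mult (M2 (- ((a * d - b * c) / c)) a 0 c) (m2mult ss (nn (d / c)))"
        using c by (simp add: k' mdefs field_simps)
      define \<alpha> where "\<alpha> = - ((a * d - b * c) / c)"
      have \<alpha>: "ou \<alpha>" unfolding \<alpha>_def using kk True by (simp only: ou_minus ou_divide)
      have "pw 0 (d / c)" using kk pw_divide[of c 0 d] c by simp
      hence "act (M2 \<alpha> a 0 c) (act ss (act (nn (d / c)) v)) \<in> V"
        using B[OF \<alpha> True kk(1) ss[OF nn[OF _ v]]] by blast
      thus ?thesis using \<alpha> c unfolding e \<alpha>_def[symmetric] by (simp add: act_mult ou_def)
    next
      case False
      hence c: "pw 1 c" using kk by (simp add: ou_iff)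
      have "pw 1 (a * d - b * c - a * d)" using pw_mult_o[OF kk(2) c] by simp
      hence "ou (a * d)" using kk(5) ou_cong[OF kk(5), of "a * d"] pw_diff_commute by blast
      hence d: "ou d" using kk by (auto simp: ou_iff intro: pw_mult_o)
      hence d0: "d \<noteq> 0" by (simp add: ou_def)
      have e: "k = m2mult (M2 ((a * d - b * c) / d) b 0 d) (m2mult ss (m2mult (nn (c / d)) ss))"
        using d0 by (simp add: k' mdefs field_simps)
      define \<alpha> where "\<alpha> = (a * d - b * c) / d"
      have \<alpha>: "ou \<alpha>" unfolding \<alpha>_def using kk d by (simp only: ou_divide)
      have "pw 0 (c / d)" using kk pw_divide[of d 0 c] d by (simp add: ou_def)
      hence "act (M2 \<alpha> b 0 d) (act ss (act (nn (c / d)) (act ss v))) \<in> V"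
        using B[OF \<alpha> d kk(2) ss[OF nn[OF _ ss[OF v]]]] by blast
      thus ?thesis using \<alpha> d0 unfolding e \<alpha>_def[symmetric] by (simp add: act_mult ou_def)
    qed
  qed
  thus ?thesis by (simp add: Kst_def)
qed

lemma Kcong_KK: "n \<ge> 1 \<Longrightarrow> k \<in> Kcong val n \<Longrightarrow> k \<in> KK"
proof -
  assume n: "n \<ge> 1" and k: "k \<in> Kcong val n"
  obtain a b c d where k': "k = M2 a b c d" by (cases k)
  have 1: "pw 1 (a - 1)" "pw 1 b" "pw 1 c" "pw 1 (d - 1)"
    using k n by (auto simp: k' Kcong_def intro: pw_mono)
  have o: "ou a" "ou d" using 1 ou_cong[OF ou_1] by auto
  have "a * d - b * c - a * d = - (b * c)" by simp
  hence "pw 1 (a * d - b * c - a * d)" using pw_mult_o'[of 1 b c] 1 pw_mono[of 1 c 0] by simp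
  hence "ou (a * d - b * c)" using ou_cong[OF ou_mult[OF o]] by blast
  thus ?thesis using o 1 ou_pw pw_mono[of 1 _ 0] by (auto simp: k')
qed

lemma kfix_act: assumes n: "n \<ge> 1" and f: "kfix n f" and k: "k \<in> KK" shows "kfix n (act k f)"
  unfolding kfix_def
proof
  fix x assume x: "x \<in> Kcong val n"
  obtain a b c d where k': "k = M2 a b c d" by (cases k)
  obtain a' b' c' d' where x': "x = M2 a' b' c' d'" by (cases x)
  have 1: "pw (int n) (a' - 1)" "pw (int n) b'" "pw (int n) c'" "pw (int n) (d' - 1)" using x by (auto simp: x' Kcong_def)
  have kk: "pw 0 a" "pw 0 b" "pw 0 c" "pw 0 d" using k by (auto simp: k')
  have "mcong n k (m2mult x k)"
  proof -
    have "pw (int n) ((a' - 1) * a + b' * c)" "pw (int n) ((a' - 1) * b + b' * d)"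
      "pw (int n) (c' * a + (d' - 1) * c)" "pw (int n) (c' * b + (d' - 1) * d)"
      using 1 kk by (auto intro!: pw_add pw_mult_o')
    thus ?thesis by (simp add: k' x' mcong_def algebra_simps)
  qed
  hence "act k f = act (m2mult x k) f"
    using Kcong_KK[OF n x] k by (intro act_mcong[OF f] KK_mult) auto
  thus "act x (act k f) = act k f"
    using Kcong_KK[OF n x] k KK_GL2 by (simp add: act_mult)
qed

lemma nn_mcong: assumes "kfix n f" "pw 0 u" "pw (int n) (u - u')" shows "act (nn u) f = act (nn u') f"
proof (rule act_mcong[OF assms(1)])
  have "pw 0 (u - u')" using assms(3) pw_mono[of "int n"] by simp
  from pw_diff[OF assms(2) this] show "nn u' \<in> KK" by (intro KK_gens) simp
  show "nn u \<in> KK" using assms by (intro KK_gens)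
  show "mcong n (nn u) (nn u')" using assms pw_diff_commute by (simp add: mcong_def nn_def)
qed

lemma nn_nn: "act (nn u) (act (nn u') f) = act (nn (u + u')) f"
proof -
  have "m2mult (nn u) (nn u') = nn (u + u')" by (simp add: mdefs add.commute)
  thus ?thesis by (simp flip: act_mult)
qed

lemma nn_pow: "f \<in> C \<Longrightarrow> (act (nn u) ^^ i) f = act (nn (of_nat i * u)) f"
proof (induction i)
  case 0
  have "nn 0 = (m2one :: 'f m2)" by (simp add: mdefs)
  thus ?case using 0 by (simp add: act_one)
qed (simp add: nn_nn algebra_simps)

text \<open>(1 + A)^i = 1 + i A modulo p^(n+1), because A^2 is divisible by p^(2n). For i = p this
  shows that K(n)/K(n+1) has exponent p.\<close>

lemma Kcong_pow:
  assumes n: "n \<ge> 1" and a: "pw (int n) (a - 1)" "pw (int n) b" "pw (int n) c" "pw (int n) (d - 1)"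
  shows "mcong (Suc n) (M2 (1 + of_nat i * (a - 1)) (of_nat i * b) (of_nat i * c) (1 + of_nat i * (d - 1)))
     ((m2mult (M2 a b c d) ^^ i) m2one)"
proof (induction i)
  case 0
  show ?case by (simp add: m2one_def mcong_def)
next
  case (Suc i)
  let ?N = "int (Suc n)"
  obtain A B C D where P: "(m2mult (M2 a b c d) ^^ i) m2one = M2 A B C D" by (cases "(m2mult (M2 a b c d) ^^ i) m2one")
  have IH: "pw ?N (A - (1 + of_nat i * (a - 1)))" "pw ?N (B - of_nat i * b)" "pw ?N (C - of_nat i * c)"
     "pw ?N (D - (1 + of_nat i * (d - 1)))"
    using Suc by (auto simp: P mcong_def)
  have o: "pw 0 (of_nat i)" by (rule pw_of_nat)
  have sq: "pw ?N (x * y)" if "pw (int n) x" "pw (int n) y" for x y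
    using pw_mult[OF that] n by (auto intro: pw_mono)
  have a0: "pw 0 x" if "pw (int n) (x - 1)" for x
    using pw_add[of 0 "x - 1" 1] pw_mono[OF that, of 0] by simp
  have e1: "a * A + b * C - (1 + of_nat (Suc i) * (a - 1)) =
     a * (A - (1 + of_nat i * (a - 1))) + b * (C - of_nat i * c) +
     of_nat i * ((a - 1) * (a - 1) + b * c)" by (simp add: algebra_simps)
  have e2: "a * B + b * D - of_nat (Suc i) * b =
     a * (B - of_nat i * b) + b * (D - (1 + of_nat i * (d - 1))) +
     of_nat i * ((a - 1) * b + b * (d - 1))" by (simp add: algebra_simps)
  have e3: "c * A + d * C - of_nat (Suc i) * c =
     c * (A - (1 + of_nat i * (a - 1))) + d * (C - of_nat i * c) +
     of_nat i * (c * (a - 1) + (d - 1) * c)" by (simp add: algebra_simps)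
  have e4: "c * B + d * D - (1 + of_nat (Suc i) * (d - 1)) =
     c * (B - of_nat i * b) + d * (D - (1 + of_nat i * (d - 1))) +
     of_nat i * (c * b + (d - 1) * (d - 1))" by (simp add: algebra_simps)
  have z: "pw 0 a" "pw 0 d" "pw 0 b" "pw 0 c" using a a0 pw_mono[of "int n" _ 0] by auto
  have "pw ?N (a * A + b * C - (1 + of_nat (Suc i) * (a - 1)))"
    unfolding e1 by (intro pw_add pw_mult_o z IH o sq a)
  moreover have "pw ?N (a * B + b * D - of_nat (Suc i) * b)"
    unfolding e2 by (intro pw_add pw_mult_o[OF z(1)] pw_mult_o[OF z(3)] pw_mult_o[OF o] IH sq a)
  moreover have "pw ?N (c * A + d * C - of_nat (Suc i) * c)"
    unfolding e3 by (intro pw_add pw_mult_o[OF z(4)] pw_mult_o[OF z(2)] pw_mult_o[OF o] IH sq a)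
  moreover have "pw ?N (c * B + d * D - (1 + of_nat (Suc i) * (d - 1)))"
    unfolding e4 by (intro pw_add pw_mult_o[OF z(4)] pw_mult_o[OF z(2)] pw_mult_o[OF o] IH sq a)
  ultimately show ?case by (simp add: P mcong_def)
qed

end

locale sigma_kill = sigma val uf p uE red sm ac Sg \<chi>
  for val :: "'f::field \<Rightarrow> int" and uf :: 'f and p :: nat
    and uE :: "'o::idom" and red :: "'o \<Rightarrow> 'k::field"
    and sm :: "'o \<Rightarrow> 'w::ab_group_add \<Rightarrow> 'w" and ac :: "'f m2 \<Rightarrow> 'w \<Rightarrow> 'w"
    and Sg :: "('f m2 \<Rightarrow> 'w) set" and \<chi> :: "'f \<Rightarrow> 'o" +
  assumes Sg_kill: "\<And>f. f \<in> Sg \<Longrightarrow> smf uE f = 0"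
begin

lemma kill_Sg: "V \<subseteq> Sg \<Longrightarrow> kill smf V" using Sg_kill by (auto simp: kill_def)

lemma lin_on_act: "(\<And>v. v \<in> V \<Longrightarrow> act k v \<in> V) \<Longrightarrow> lin_on smf V (act k)"
  by (auto simp: lin_on_def act_add act_smf)

text \<open>K(n)/K(n+1) is a finite abelian group of exponent p acting on the vectors of level n +
  1, so it fixes a nonzero one. \<open>T\<close> is a set of representatives of this
  quotient.\<close>

lemma lower_level:
  assumes n: "n \<ge> 1" and f: "f \<in> Sg" "f \<noteq> 0" "kfix (Suc n) f"
  shows "\<exists>f'\<in>Sg. f' \<noteq> 0 \<and> kfix n f'"
proof -
  define V where "V = {f \<in> Sg. kfix (Suc n) f}"
  define T where "T = (\<lambda>(r1, r2, r3, r4). M2 (1 + uf ^ n * r1) (uf ^ n * r2) (uf ^ n * r3) (1 + uf ^ n * r4)) ` (R \<times> R \<times> R \<times> R)"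
  have pwu: "pw (int n) (uf ^ n * x)" if "pw 0 x" for x using that by (simp add: pw_mult_iff)
  have TK: "T \<subseteq> Kcong val n" by (auto simp: T_def Kcong_def R_pw pwu)
  have KKT: "k \<in> KK" if "k \<in> T" for k using that TK Kcong_KK[OF n] by blast
  have Vsub: "S.subspace V"
    using Sg_sub by (intro S.subspaceI)
      (auto simp: V_def kfix_def act_add act_smf S.subspace_0 S.subspace_add S.subspace_scale)
  have Vact: "act k v \<in> V" if "k \<in> KK" "v \<in> V" for k v
    using that kfix_act[of "Suc n" v k] Sg_act KK_GL2 by (auto simp: V_def)
  have "\<exists>y\<in>V. y \<noteq> 0 \<and> (\<forall>g\<in>act ` T. g y = y)"
  proof (rule p_power_fixed_vector[OF module_smf, where e = 1])
    show "finite (act ` T)" by (simp add: T_def)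
    show "S.subspace V" by (rule Vsub)
    show "kill smf V" by (rule kill_Sg) (auto simp: V_def)
    show "V \<noteq> {0}" using f by (auto simp: V_def)
    show "lin_on smf V g" if "g \<in> act ` T" for g
      using that KKT Vact by (auto intro!: lin_on_act)
    fix g x assume gx: "g \<in> act ` T" "x \<in> V"
    then obtain k where k: "k \<in> T" "g = act k" by blast
    have xf: "kfix (Suc n) x" "x \<in> C" using gx SgC by (auto simp: V_def)
    obtain a b c d where k': "k = M2 a b c d" by (cases k)
    have kc: "pw (int n) (a - 1)" "pw (int n) b" "pw (int n) c" "pw (int n) (d - 1)"
      using k TK by (auto simp: k' Kcong_def)
    show "g (h x) = h (g x)" if h: "h \<in> act ` T" for h
    proof -
      obtain l where l: "l \<in> T" "h = act l" using h by blast
      obtain a' b' c' d' where l': "l = M2 a' b' c' d'" by (cases l)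
      have lc: "pw (int n) (a' - 1)" "pw (int n) b'" "pw (int n) c'" "pw (int n) (d' - 1)"
        using l TK by (auto simp: l' Kcong_def)
      have ad: "pw (int n) (a - d)" "pw (int n) (a' - d')"
        using pw_diff[OF kc(1,4)] pw_diff[OF lc(1,4)] by simp_all
      have sq: "pw (int (Suc n)) (x * y)" if "pw (int n) x" "pw (int n) y" for x y
        using pw_mult[OF that] n by (auto intro: pw_mono)
      have "mcong (Suc n) (m2mult l k) (m2mult k l)"
      proof -
        have "pw (int (Suc n)) (b * c' - b' * c)" "pw (int (Suc n)) ((a - d) * b' - b * (a' - d'))"
          "pw (int (Suc n)) (c * (a' - d') - c' * (a - d))" "pw (int (Suc n)) (c * b' - c' * b)"
          by (intro pw_diff sq kc lc ad)+
        thus ?thesis by (simp add: k' l' mcong_def algebra_simps)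
      qed
      hence "act (m2mult l k) x = act (m2mult k l) x"
        using k l KKT by (intro act_mcong[OF xf(1)] KK_mult) auto
      thus ?thesis using k l KKT KK_GL2 by (simp add: act_mult)
    qed
    have kp: "mcong (Suc n) (M2 (1 + of_nat p * (a - 1)) (of_nat p * b) (of_nat p * c) (1 + of_nat p * (d - 1)))
       ((m2mult k ^^ p) m2one)"
      unfolding k' by (rule Kcong_pow[OF n kc])
    have "pw (int (Suc n)) (of_nat p * x)" if "pw (int n) x" for x
      using pw_mult[OF pw_p that] by simp
    note pp = this[OF kc(1)] this[OF kc(2)] this[OF kc(3)] this[OF kc(4)]
    have "mcong (Suc n) m2one ((m2mult k ^^ p) m2one)"
    proof -
      obtain A B C D where P: "(m2mult k ^^ p) m2one = M2 A B C D" by (cases "(m2mult k ^^ p) m2one")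
      have kp': "pw (int (Suc n)) (A - (1 + of_nat p * (a - 1)))" "pw (int (Suc n)) (B - of_nat p * b)"
        "pw (int (Suc n)) (C - of_nat p * c)" "pw (int (Suc n)) (D - (1 + of_nat p * (d - 1)))"
        using kp unfolding P mcong_def m2.case by blast+
      have "pw (int (Suc n)) (A - 1)" "pw (int (Suc n)) B" "pw (int (Suc n)) C" "pw (int (Suc n)) (D - 1)"
        using pw_add[OF kp'(1) pp(1)] pw_add[OF kp'(2) pp(2)] pw_add[OF kp'(3) pp(3)] pw_add[OF kp'(4) pp(4)]
        by simp_all
      thus ?thesis unfolding P by (simp add: mcong_def m2one_def)
    qed
    moreover have "(act k ^^ p) x = act ((m2mult k ^^ p) m2one) x \<and> (m2mult k ^^ p) m2one \<in> KK"
      using KK_pow[OF xf(2) KKT[OF k(1)]] .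
    ultimately show "(g ^^ (p ^ 1)) x = x"
      using act_mcong[OF xf(1), of m2one "(m2mult k ^^ p) m2one"] KK_gens(5) act_one[OF xf(2)] by (simp add: k(2))
  qed
  then obtain y where y: "y \<in> V" "y \<noteq> 0" "\<And>k. k \<in> T \<Longrightarrow> act k y = y" by auto
  have "act k y = y" if k: "k \<in> Kcong val n" for k
  proof -
    obtain a b c d where k': "k = M2 a b c d" by (cases k)
    have kc: "pw (int n) (a - 1)" "pw (int n) b" "pw (int n) c" "pw (int n) (d - 1)"
      using k by (auto simp: k' Kcong_def)
    have "\<exists>r\<in>R. pw (int (Suc n)) (uf ^ n * r - x)" if x: "pw (int n) x" for x
    proof -
      have "pw 0 (x / uf ^ n)" using x pw_Suc_uf by blast
      then obtain r where r: "r \<in> R" "pw 1 (x / uf ^ n - r)" using transv_R by (auto simp: transv_def)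
      have "pw (int n + 1) (uf ^ n * (r - x / uf ^ n))"
        using pw_diff_commute[OF r(2)] by (simp add: pw_mult_iff)
      thus ?thesis using r(1) by (intro bexI[of _ r]) (auto simp: algebra_simps)
    qed
    note ex = this
    obtain r1 where r1: "r1 \<in> R" "pw (int (Suc n)) (uf ^ n * r1 - (a - 1))" using ex[OF kc(1)] by blast
    obtain r2 where r2: "r2 \<in> R" "pw (int (Suc n)) (uf ^ n * r2 - b)" using ex[OF kc(2)] by blast
    obtain r3 where r3: "r3 \<in> R" "pw (int (Suc n)) (uf ^ n * r3 - c)" using ex[OF kc(3)] by blast
    obtain r4 where r4: "r4 \<in> R" "pw (int (Suc n)) (uf ^ n * r4 - (d - 1))" using ex[OF kc(4)] by blast
    let ?t = "M2 (1 + uf ^ n * r1) (uf ^ n * r2) (uf ^ n * r3) (1 + uf ^ n * r4)"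
    have tT: "?t \<in> T" unfolding T_def using r1(1) r2(1) r3(1) r4(1) by force
    have "mcong (Suc n) k ?t" using r1(2) r2(2) r3(2) r4(2) by (simp add: k' mcong_def algebra_simps)
    moreover have "kfix (Suc n) y" using y(1) by (simp add: V_def)
    ultimately have "act k y = act ?t y" using Kcong_KK[OF n k] KKT[OF tT] by (intro act_mcong)
    thus ?thesis using y(3)[OF tT] by (simp only:)
  qed
  thus ?thesis using y by (auto simp: V_def kfix_def)
qed

lemma ex_kfix1: "\<exists>f\<in>Sg. f \<noteq> 0 \<and> kfix 1 f"
proof -
  obtain f where f: "f \<in> Sg" "f \<noteq> 0" using Sg_nz Sg0 by auto
  obtain n where n: "n \<ge> 1" "kfix n f" using act_smooth[OF SgC[OF f(1)]] unfolding kfix_def by blast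
  define Q where "Q m \<longleftrightarrow> (\<exists>f\<in>Sg. f \<noteq> 0 \<and> kfix m f)" for m
  have step: "Q m" if m: "m \<ge> 1" and Q: "Q (Suc m)" for m
  proof -
    obtain f where "f \<in> Sg" "f \<noteq> 0" "kfix (Suc m) f" using Q unfolding Q_def by blast
    from lower_level[OF m this] show ?thesis unfolding Q_def .
  qed
  have "Q (Suc m) \<Longrightarrow> Q 1" for m
  proof (induction m)
    case (Suc m)
    from Suc.IH[OF step[OF _ Suc.prems]] show ?case by simp
  qed simp
  moreover have "Q n" using f n(2) unfolding Q_def by blast
  ultimately show ?thesis using n(1) unfolding Q_def[symmetric] by (cases n) auto
qed

text \<open>On level-one vectors the integral unipotents act through the additive group o/p, which
  has exponent p.\<close>

lemma ex_nfix:
  assumes V: "S.subspace V" "V \<subseteq> Sg" "\<And>v. v \<in> V \<Longrightarrow> kfix 1 v" "V \<noteq> {0}"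
    and nn: "\<And>u v. pw 0 u \<Longrightarrow> v \<in> V \<Longrightarrow> act (nn u) v \<in> V"
  shows "\<exists>v\<in>V. v \<noteq> 0 \<and> nfix v"
proof -
  have VC: "v \<in> C" if "v \<in> V" for v using that V(2) SgC by blast
  have "\<exists>y\<in>V. y \<noteq> 0 \<and> (\<forall>g\<in>(\<lambda>r. act (nn r)) ` R. g y = y)"
  proof (rule p_power_fixed_vector[OF module_smf, where e = 1])
    show "kill smf V" using V(2) by (rule kill_Sg)
    show "lin_on smf V g" if "g \<in> (\<lambda>r. act (nn r)) ` R" for g
      using that nn R_pw by (auto intro!: lin_on_act)
    show "g (h x) = h (g x)" if "g \<in> (\<lambda>r. act (nn r)) ` R" "h \<in> (\<lambda>r. act (nn r)) ` R" for g h x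
      using that by (auto simp: nn_nn add.commute)
    fix g x assume "g \<in> (\<lambda>r. act (nn r)) ` R" and x: "x \<in> V"
    then obtain r where r: "r \<in> R" "g = act (nn r)" by blast
    have pr: "pw 1 (of_nat p * r)" using pw_p R_pw[OF r(1)] by (rule pw_mult_o')
    have "act (nn (of_nat p * r)) x = x"
      using V(3)[OF x] pr by (auto simp: kfix_def intro!: nn_Kcong)
    thus "(g ^^ (p ^ 1)) x = x" using nn_pow[OF VC[OF x]] by (simp add: r(2))
  qed (use V in auto)
  then obtain y where y: "y \<in> V" "y \<noteq> 0" "\<And>r. r \<in> R \<Longrightarrow> act (nn r) y = y" by auto
  have nf: "nfix y" unfolding nfix_def
  proof (intro allI impI)
    fix u assume u: "pw 0 u"
    then obtain r where r: "r \<in> R" "pw (int 1) (u - r)" using transv_R by (auto simp: transv_def)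
    show "act (nn u) y = y" using nn_mcong[OF V(3)[OF y(1)] u r(2)] y(3)[OF r(1)] by simp
  qed
  thus ?thesis using y by blast
qed

text \<open>Unit diagonal matrices preserve the unipotent invariants and act there through finitely
  many commuting operators. K-orbits are finite, so a difference of two powers of each operator
  kills any given vector.\<close>

lemma ex_weight_vector:
  assumes V: "S.subspace V" "V \<subseteq> Sg" "Kst V" "\<And>v. v \<in> V \<Longrightarrow> kfix 1 v" "V \<noteq> {0}"
  shows "\<exists>v\<in>V. v \<noteq> 0 \<and> nfix v \<and> (\<exists>\<psi>. \<forall>a d. ou a \<longrightarrow> ou d \<longrightarrow> act (dg a d) v = smf (\<psi> a d) v)"
proof -
  have VC: "v \<in> C" if "v \<in> V" for v using that V(2) SgC by blast
  obtain y where y: "y \<in> V" "y \<noteq> 0" and nf: "nfix y"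
    using ex_nfix[OF V(1,2,4,5)] V(3) KK_gens(1) unfolding Kst_def by metis
  define V' where "V' = {v \<in> V. nfix v}"
  have V'act: "act (dg a d) v \<in> V'" if ad: "ou a" "ou d" and v: "v \<in> V'" for a d v
  proof -
    have "act (nn u) (act (dg a d) v) = act (dg a d) v" if "pw 0 u" for u
    proof -
      have "m2mult (nn u) (dg a d) = m2mult (dg a d) (nn (u * d / a))" using ad by (simp add: mdefs ou_def)
      hence "act (nn u) (act (dg a d) v) = act (dg a d) (act (nn (u * d / a)) v)"
        using ad by (simp add: ou_def flip: act_mult)
      moreover have "pw 0 (u * d / a)"
        using pw_divide[OF _ pw_mult_o'[OF that ou_pw[OF ad(2)]], of a] ad(1) by (simp add: ou_def)
      ultimately show ?thesis using v by (simp add: V'_def nfix_def)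
    qed
    moreover have "act (dg a d) v \<in> V" using V(3) v KK_gens(4)[OF ad] by (auto simp: Kst_def V'_def)
    ultimately show ?thesis by (auto simp: V'_def nfix_def)
  qed
  have V'sub: "S.subspace V'" using V(1) by (intro S.subspaceI)
    (auto simp: V'_def nfix_def act_add act_smf S.subspace_0 S.subspace_add S.subspace_scale)
  let ?G = "(\<lambda>(a, d). act (dg a d)) ` ((R - {0}) \<times> (R - {0}))"
  have kV': "kill smf V'" using V(2) by (intro kill_Sg) (auto simp: V'_def)
  have lG: "lin_on smf V' g" if "g \<in> ?G" for g
    using that V'act R_ou by (auto intro!: lin_on_act)
  have "\<exists>y\<in>V'. y \<noteq> 0 \<and> (\<forall>g\<in>?G. \<exists>a. g y = smf a y)"
  proof (rule common_eigenvector[OF module_smf _ V'sub kV'])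
    show "finite ?G" by simp
    show "V' \<noteq> {0}" using y nf by (auto simp: V'_def)
    show "g (h x) = h (g x)" if "g \<in> ?G" "h \<in> ?G" for g h x
    proof -
      obtain a d a' d' where 1: "g = act (dg a d)" "h = act (dg a' d')" "a \<noteq> 0" "d \<noteq> 0" "a' \<noteq> 0" "d' \<noteq> 0"
        using \<open>g \<in> ?G\<close> \<open>h \<in> ?G\<close> by auto
      have "m2mult (dg a d) (dg a' d') = m2mult (dg a' d') (dg a d)" by (simp add: mdefs)
      thus ?thesis using 1 by (simp flip: act_mult)
    qed
    fix g x assume g: "g \<in> ?G" and x: "x \<in> V'"
    then obtain a d where ad: "g = act (dg a d)" "ou a" "ou d" using R_ou by auto
    have xC: "x \<in> C" using x VC by (auto simp: V'_def)
    have "range (\<lambda>i::nat. (g ^^ i) x) \<subseteq> (\<lambda>k. act k x) ` KK"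
      using KK_pow[OF xC KK_gens(4)[OF ad(2,3)]] by (auto simp: ad(1))
    hence "finite (range (\<lambda>i::nat. (g ^^ i) x))" using finite_KK_orbit[OF xC] finite_subset by blast
    hence "\<not> inj (\<lambda>i::nat. (g ^^ i) x)" using finite_imageD infinite_UNIV_nat by blast
    then obtain i j :: nat where "(g ^^ i) x = (g ^^ j) x" "i \<noteq> j" by (auto simp: inj_on_def)
    then obtain i j :: nat where "(g ^^ i) x = (g ^^ j) x" "i < j" by (metis nat_neq_iff)
    thus "\<exists>q. q \<noteq> 0 \<and> evk smf g q x = 0"
      by (rule eigenvector_periodic[OF module_smf V'sub kV' lG[OF g] x])
  qed (use lG in auto)
  then obtain v where v: "v \<in> V'" "v \<noteq> 0"
    and ev: "\<And>a d. a \<in> R - {0} \<Longrightarrow> d \<in> R - {0} \<Longrightarrow> \<exists>c. act (dg a d) v = smf c v" by auto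
  have "\<exists>c. act (dg a d) v = smf c v" if ad: "ou a" "ou d" for a d
  proof -
    have ex: "\<exists>r\<in>R - {0}. pw 1 (r - x)" if x: "ou x" for x
    proof -
      obtain r where r: "r \<in> R" "pw 1 (x - r)" using transv_R ou_pw[OF x] by (auto simp: transv_def)
      moreover have "r \<noteq> 0" using r x by (auto simp: ou_iff)
      ultimately show ?thesis using pw_diff_commute by blast
    qed
    obtain r r' where r: "r \<in> R - {0}" "pw 1 (r - a)" "r' \<in> R - {0}" "pw 1 (r' - d)" using ex ad by meson
    have "act (dg a d) v = act (dg r r') v"
      using v r ad V(4) R_ou by (intro act_mcong[of 1] KK_gens) (auto simp: mcong_def dg_def V'_def)
    thus ?thesis using ev r by auto
  qed
  hence "\<exists>\<psi>. \<forall>a d. ou a \<longrightarrow> ou d \<longrightarrow> act (dg a d) v = smf (\<psi> a d) v" by metis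
  thus ?thesis using v by (auto simp: V'_def)
qed

text \<open>A K-stable subspace with the least number of generators is taken: a proper nonzero one
  inside it would need fewer.\<close>

lemma ex_irreducible:
  assumes E: "finite E" "Kst (S.span E)" "S.span E \<subseteq> Sg" "S.span E \<noteq> {0}"
  shows "\<exists>\<rho>\<subseteq>S.span E. S.subspace \<rho> \<and> Kst \<rho> \<and> \<rho> \<noteq> {0} \<and>
     (\<forall>V\<subseteq>\<rho>. S.subspace V \<longrightarrow> Kst V \<longrightarrow> V = {0} \<or> V = \<rho>)"
proof -
  let ?P = "\<lambda>n. \<exists>E'. finite E' \<and> card E' = n \<and> Kst (S.span E') \<and> S.span E' \<subseteq> S.span E \<and> S.span E' \<noteq> {0}"
  define n where "n = (LEAST n. ?P n)"
  have "?P n" unfolding n_def by (rule LeastI[of ?P "card E"]) (use E in auto)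
  then obtain E' where E': "finite E'" "card E' = n" "Kst (S.span E')" "S.span E' \<subseteq> S.span E" "S.span E' \<noteq> {0}"
    by blast
  have "V = {0} \<or> V = S.span E'" if V: "V \<subseteq> S.span E'" "S.subspace V" "Kst V" for V
  proof (rule ccontr)
    assume no: "\<not> (V = {0} \<or> V = S.span E')"
    have "E' \<subseteq> Sg" using E'(4) E(3) S.span_superset[of E'] by blast
    hence "kill smf E'" by (rule kill_Sg)
    then obtain E'' where "finite E''" "S.span E'' = V" "card E'' < card E'"
      using submodule_generators[OF module_smf E'(1) _ V(2,1)] no by auto
    hence "?P (card E'')" using V E'(4) no by blast
    hence "n \<le> card E''" unfolding n_def by (rule Least_le)
    thus False using \<open>card E'' < card E'\<close> E'(2) by simp
  qed
  thus ?thesis using E' by (intro exI[of _ "S.span E'"]) auto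
qed

lemma KK_orbit_span:
  assumes f: "f \<in> Sg"
  shows "finite ((\<lambda>k. act k f) ` KK)" "Kst (S.span ((\<lambda>k. act k f) ` KK))"
    "S.span ((\<lambda>k. act k f) ` KK) \<subseteq> Sg" "f \<in> S.span ((\<lambda>k. act k f) ` KK)"
proof -
  let ?E = "(\<lambda>k. act k f) ` KK"
  show "finite ?E" using finite_KK_orbit[OF SgC[OF f]] .
  show "S.span ?E \<subseteq> Sg" using f Sg_act KK_GL2 Sg_sub by (intro S.span_minimal) auto
  show "f \<in> S.span ?E" using act_one[OF SgC[OF f]] KK_gens(5)
    by (intro S.span_base image_eqI[of _ _ m2one]) auto
  have "act h f' \<in> S.span ?E" if h: "h \<in> KK" and f': "f' \<in> ?E" for h f'
  proof -
    obtain k where k: "k \<in> KK" "f' = act k f" using f' by blast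
    have "act h f' = act (m2mult h k) f" using h k KK_GL2 by (simp add: act_mult)
    thus ?thesis using h k KK_mult by (intro S.span_base) auto
  qed
  thus "Kst (S.span ?E)" unfolding Kst_def using span_act_closed[of KK ?E] by blast
qed

lemma kfix_span: assumes "n \<ge> 1" "kfix n f" "f' \<in> S.span ((\<lambda>k. act k f) ` KK)" shows "kfix n f'"
proof -
  have "S.span ((\<lambda>k. act k f) ` KK) \<subseteq> {f. kfix n f}"
    using kfix_act[OF assms(1,2)]
    by (intro S.span_minimal S.subspaceI) (auto simp: kfix_def act_add act_smf)
  thus ?thesis using assms(3) by blast
qed

end

section \<open>The unipotent invariants of an irreducible type\<close>

context smooth_mod
begin

lemma nn_zero [simp]: "f \<in> C \<Longrightarrow> act (nn 0) f = f"
  using act_one[of f] by (simp add: mdefs)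

lemma ss_ss [simp]: "f \<in> C \<Longrightarrow> act ss (act ss f) = f"
proof -
  have "m2mult ss ss = (m2one :: 'f m2)" by (simp add: mdefs)
  thus "f \<in> C \<Longrightarrow> act ss (act ss f) = f" using act_one[of f] by (simp flip: act_mult)
qed

lemma dg_ss: "a \<noteq> 0 \<Longrightarrow> d \<noteq> 0 \<Longrightarrow> act (dg a d) (act ss f) = act ss (act (dg d a) f)"
proof -
  have "m2mult (dg a d) ss = m2mult ss (dg d a)" by (simp add: mdefs)
  thus "a \<noteq> 0 \<Longrightarrow> d \<noteq> 0 \<Longrightarrow> ?thesis" by (simp flip: act_mult)
qed

lemma dg_nn: "a \<noteq> 0 \<Longrightarrow> d \<noteq> 0 \<Longrightarrow> act (dg a d) (act (nn u) f) = act (nn (a / d * u)) (act (dg a d) f)"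
proof -
  assume a: "a \<noteq> 0" "d \<noteq> 0"
  have "m2mult (dg a d) (nn u) = m2mult (nn (a / d * u)) (dg a d)" using a by (simp add: mdefs)
  thus ?thesis using a by (simp flip: act_mult)
qed

lemma ss_nn_ss: "r \<noteq> 0 \<Longrightarrow> act ss (act (nn r) (act ss f)) =
  act (nn (1 / r)) (act (dg (- 1 / r) r) (act ss (act (nn (1 / r)) f)))"
proof -
  assume r: "r \<noteq> 0"
  have "m2mult ss (m2mult (nn r) ss) = m2mult (nn (1 / r)) (m2mult (dg (- 1 / r) r) (m2mult ss (nn (1 / r))))"
    using r by (simp add: mdefs)
  hence "act (m2mult ss (m2mult (nn r) ss)) f = act (m2mult (nn (1 / r)) (m2mult (dg (- 1 / r) r) (m2mult ss (nn (1 / r))))) f"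
    by simp
  thus ?thesis using r by (simp add: act_mult)
qed

lemma ss_nn_ss_small: assumes "kfix 1 f" "pw 1 u" shows "act ss (act (nn u) (act ss f)) = f"
proof -
  have "m2mult ss (m2mult (nn u) ss) = nb u" by (simp add: mdefs)
  hence "act ss (act (nn u) (act ss f)) = act (nb u) f" by (simp flip: act_mult)
  moreover have "nb u \<in> Kcong val 1" by (rule nb_Kcong) (use assms in simp)
  ultimately show ?thesis using assms(1) by (simp add: kfix_def)
qed

end

text \<open>An irreducible type. Level one makes it a representation of GL_2 over the residue field
  of F.\<close>

locale irr_rep = sigma_kill val uf p uE red sm ac Sg \<chi>
  for val :: "'f::field \<Rightarrow> int" and uf :: 'f and p :: nat
    and uE :: "'o::idom" and red :: "'o \<Rightarrow> 'k::field"
    and sm :: "'o \<Rightarrow> 'w::ab_group_add \<Rightarrow> 'w" and ac :: "'f m2 \<Rightarrow> 'w \<Rightarrow> 'w"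
    and Sg :: "('f m2 \<Rightarrow> 'w) set" and \<chi> :: "'f \<Rightarrow> 'o" +
  fixes \<rho> :: "('f m2 \<Rightarrow> 'w) set"
  assumes rho_sub: "S.subspace \<rho>" and rho_Sg: "\<rho> \<subseteq> Sg" and rho_Kst: "Kst \<rho>"
    and rho_kfix: "\<And>v. v \<in> \<rho> \<Longrightarrow> kfix 1 v" and rho_nz: "\<rho> \<noteq> {0}"
    and rho_irr: "\<And>V. V \<subseteq> \<rho> \<Longrightarrow> S.subspace V \<Longrightarrow> Kst V \<Longrightarrow> V = {0} \<or> V = \<rho>"
begin

lemma rhoC: "v \<in> \<rho> \<Longrightarrow> v \<in> C" using rho_Sg SgC by blast
lemma rho_act: "k \<in> KK \<Longrightarrow> v \<in> \<rho> \<Longrightarrow> act k v \<in> \<rho>" using rho_Kst by (simp add: Kst_def)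
lemma rho_nn: "pw 0 u \<Longrightarrow> v \<in> \<rho> \<Longrightarrow> act (nn u) v \<in> \<rho>" by (simp add: rho_act KK_gens)
lemma rho_ss: "v \<in> \<rho> \<Longrightarrow> act ss v \<in> \<rho>" by (simp add: rho_act KK_gens)
lemma rho_kill: "v \<in> \<rho> \<Longrightarrow> smf uE v = 0" using rho_Sg Sg_kill by blast
lemma rho_0: "0 \<in> \<rho>" using rho_sub S.subspace_0 by blast

lemma nn_cong: "v \<in> \<rho> \<Longrightarrow> pw 0 u \<Longrightarrow> pw 1 (u - u') \<Longrightarrow> act (nn u) v = act (nn u') v"
  using nn_mcong[OF rho_kfix, of v u u'] by simp

lemma sum_nn_shift:
  assumes "v \<in> \<rho>" "pw 0 c"
  shows "(\<Sum>r\<in>R. act (nn (r + c)) v) = (\<Sum>r\<in>R. act (nn r) v)"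
  by (rule sum_transv_shift[OF transv_R assms(2), of "\<lambda>r. act (nn r) v"]) (use nn_cong assms in auto)

definition weight :: "('f \<Rightarrow> 'f \<Rightarrow> 'o) \<Rightarrow> ('f m2 \<Rightarrow> 'w) \<Rightarrow> bool" where
  "weight \<psi> v \<longleftrightarrow> v \<in> \<rho> \<and> v \<noteq> 0 \<and> nfix v \<and> (\<forall>a d. ou a \<longrightarrow> ou d \<longrightarrow> act (dg a d) v = smf (\<psi> a d) v)"

definition ZZ :: "('f m2 \<Rightarrow> 'w) \<Rightarrow> ('f m2 \<Rightarrow> 'w) set" where
  "ZZ v = S.span ((\<lambda>u. act (nn u) (act ss v)) ` {u. pw 0 u})"

text \<open>A Hecke operator of the finite group: s followed by summation over the unipotents. On
  weight vectors it exchanges the two torus entries of the character.\<close>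

definition So :: "('f m2 \<Rightarrow> 'w) \<Rightarrow> 'f m2 \<Rightarrow> 'w" where
  "So v = (\<Sum>r\<in>R. act (nn r) (act ss v))"

lemma ZZ_base: "pw 0 u \<Longrightarrow> act (nn u) (act ss v) \<in> ZZ v"
  unfolding ZZ_def by (rule S.span_base) auto

lemma ZZ_scale: "w \<in> ZZ v \<Longrightarrow> smf a w \<in> ZZ v"
  unfolding ZZ_def by (rule S.span_scale)

lemma So_ZZ: "So v \<in> ZZ v"
  unfolding So_def ZZ_def by (rule S.span_sum) (rule ZZ_base[unfolded ZZ_def], rule R_pw)

lemma weight_dg_ss: "weight \<psi> v \<Longrightarrow> ou a \<Longrightarrow> ou d \<Longrightarrow> act (dg a d) (act ss v) = smf (\<psi> d a) (act ss v)"
  using dg_ss[of a d v] by (simp add: ou_def[of a] ou_def[of d]) (simp add: weight_def act_smf ou_def)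

lemma weight_ss_nn_ss:
  assumes v: "weight \<psi> v" and r: "ou r"
  shows "act ss (act (nn r) (act ss v)) = smf (\<psi> r (- 1 / r)) (act (nn (1 / r)) (act ss v))"
proof -
  have o: "ou (- 1 / r)" "ou (1 / r)" using ou_divide[OF ou_1 r] ou_divide[of "-1" r] r by simp_all
  have "act (nn (1 / r)) v = v" using v ou_pw[OF o(2)] by (simp add: weight_def nfix_def)
  thus ?thesis using ss_nn_ss[of r v] r weight_dg_ss[OF v o(1) r] by (simp add: ou_def act_smf)
qed

lemma sum_R_split: "(\<Sum>r\<in>R. f r) = f 0 + (\<Sum>r\<in>R - {0}. f r :: 'b::ab_group_add)"
  by (rule sum.remove[OF fin_R zero_R])

text \<open>For a unit r the matrix s n(r) s lies in the cell N T s N, which turns the term into a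
  translate of s v; r = 0 alone returns v.\<close>

lemma ss_So:
  assumes v: "weight \<psi> v"
  shows "act ss (So v) = v + (\<Sum>r\<in>R - {0}. smf (\<psi> r (- 1 / r)) (act (nn (1 / r)) (act ss v)))"
proof -
  have "v \<in> \<rho>" using v by (simp add: weight_def)
  hence "act ss (act (nn 0) (act ss v)) = v" by (simp add: rhoC rho_ss)
  moreover have "(\<Sum>r\<in>R - {0}. act ss (act (nn r) (act ss v))) =
     (\<Sum>r\<in>R - {0}. smf (\<psi> r (- 1 / r)) (act (nn (1 / r)) (act ss v)))"
    by (rule sum.cong[OF refl]) (use weight_ss_nn_ss[OF v] R_ou in blast)
  ultimately show ?thesis unfolding So_def act_sum
    by (subst sum_R_split) simp
qed

lemma weight_So_0: assumes v: "weight \<psi> v" and "So v = 0" shows "v \<in> ZZ v"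
proof -
  have "v = - (\<Sum>r\<in>R - {0}. smf (\<psi> r (- 1 / r)) (act (nn (1 / r)) (act ss v)))"
    using ss_So[OF v] assms(2) by (simp add: eq_neg_iff_add_eq_0)
  also have "\<dots> \<in> ZZ v"
  proof -
    have "smf (\<psi> r (- 1 / r)) (act (nn (1 / r)) (act ss v)) \<in> ZZ v" if "r \<in> R - {0}" for r
      by (rule ZZ_scale[OF ZZ_base[OF ou_pw[OF ou_divide[OF ou_1 R_ou]]]]) (use that in auto)
    thus ?thesis unfolding ZZ_def by (intro S.span_neg S.span_sum)
  qed
  finally show ?thesis .
qed

lemma weight_So: assumes v: "weight \<psi> v" and "So v \<noteq> 0" shows "weight (\<lambda>a d. \<psi> d a) (So v)"
proof -
  have vr: "v \<in> \<rho>" using v by (simp add: weight_def)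
  have "So v \<in> \<rho>" unfolding So_def by (intro S.subspace_sum[OF rho_sub] rho_nn rho_ss vr R_pw)
  moreover have "nfix (So v)" unfolding nfix_def
  proof (intro allI impI)
    fix u assume u: "pw 0 u"
    show "act (nn u) (So v) = So v"
      using sum_nn_shift[OF rho_ss[OF vr] u] by (simp add: So_def act_sum nn_nn add.commute)
  qed
  moreover have "act (dg a d) (So v) = smf (\<psi> d a) (So v)" if "ou a" "ou d" for a d
  proof -
    have ad: "a \<noteq> 0" "d \<noteq> 0" using that by (auto simp: ou_def)
    have "act (dg a d) (So v) = (\<Sum>r\<in>R. act (nn (a / d * r)) (act (dg a d) (act ss v)))"
      by (simp add: So_def act_sum dg_nn[OF ad])
    also have "\<dots> = smf (\<psi> d a) (\<Sum>r\<in>R. act (nn (a / d * r)) (act ss v))"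
      unfolding weight_dg_ss[OF v that] by (simp add: act_smf S.scale_sum_right)
    also have "(\<Sum>r\<in>R. act (nn (a / d * r)) (act ss v)) = So v"
      unfolding So_def
      by (rule sum_transv_mult[OF transv_R ou_divide[OF that], of "\<lambda>r. act (nn r) (act ss v)"])
        (use nn_cong rho_ss vr in auto)
    finally show ?thesis .
  qed
  ultimately show ?thesis using assms(2) by (simp add: weight_def)
qed

text \<open>The quadratic relation of the finite Hecke algebra. The term in v has coefficient
  \<open>card R\<close>, which is 0 in the residue field, so only a multiple of \<open>So v\<close>
  survives.\<close>

lemma So_So:
  assumes v: "weight \<psi> v"
  shows "So (So v) = smf (\<Sum>r\<in>R - {0}. \<psi> r (- 1 / r)) (So v)"
proof -
  have vr: "v \<in> \<rho>" using v by (simp add: weight_def)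
  have "So (So v) = (\<Sum>r'\<in>R. act (nn r') v + (\<Sum>r\<in>R - {0}. smf (\<psi> r (- 1 / r)) (act (nn (r' + 1 / r)) (act ss v))))"
    unfolding So_def[of "So v"] ss_So[OF v] by (simp add: act_add act_sum act_smf nn_nn)
  also have "\<dots> = (\<Sum>r'\<in>R. act (nn r') v) +
      (\<Sum>r\<in>R - {0}. smf (\<psi> r (- 1 / r)) (\<Sum>r'\<in>R. act (nn (r' + 1 / r)) (act ss v)))"
    by (simp only: sum.distrib S.scale_sum_right) (subst sum.swap, rule refl)
  also have "(\<Sum>r'\<in>R. act (nn r') v) = (\<Sum>r'\<in>R. v)"
    using v R_pw by (intro sum.cong) (auto simp: weight_def nfix_def)
  also have "\<dots> = smf (of_nat (card R)) v" by (rule S.sum_constant_scale)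
  also have "\<dots> = smf 0 v"
    by (rule sc_cong[OF module_smf rho_kill[OF vr]]) (simp add: p_dvd_zero[OF p_dvd_card_R])
  also have "(\<Sum>r\<in>R - {0}. smf (\<psi> r (- 1 / r)) (\<Sum>r'\<in>R. act (nn (r' + 1 / r)) (act ss v))) =
     (\<Sum>r\<in>R - {0}. smf (\<psi> r (- 1 / r)) (So v))"
  proof (intro sum.cong refl)
    fix r assume "r \<in> R - {0}"
    hence "pw 0 (1 / r)" using ou_pw[OF ou_divide[OF ou_1 R_ou]] by blast
    thus "smf (\<psi> r (- 1 / r)) (\<Sum>r'\<in>R. act (nn (r' + 1 / r)) (act ss v)) = smf (\<psi> r (- 1 / r)) (So v)"
      using sum_nn_shift[OF rho_ss[OF vr]] by (simp add: So_def)
  qed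
  finally show ?thesis by (simp add: S.scale_sum_left)
qed

text \<open>If \<open>So v\<close> vanishes, the formula for s \<open>So v\<close> solves for v.
  Otherwise the quadratic relation either kills \<open>So (So v)\<close>, and the same argument
  applies to \<open>So v\<close>, or recovers \<open>So v\<close> from
  \<open>So (So v)\<close>.\<close>

lemma ex_good_weight: "\<exists>\<psi> v. weight \<psi> v \<and> v \<in> ZZ v"
proof -
  obtain v \<psi> where v: "weight \<psi> v"
    using ex_weight_vector[OF rho_sub rho_Sg rho_Kst rho_kfix rho_nz] unfolding weight_def by blast
  show ?thesis
  proof (cases "So v = 0")
    case True
    thus ?thesis using weight_So_0 v by blast
  next
    case False
    define \<nu> where "\<nu> = (\<Sum>r\<in>R - {0}. \<psi> r (- 1 / r))"
    have w: "weight (\<lambda>a d. \<psi> d a) (So v)" by (rule weight_So[OF v False])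
    have k: "smf uE (So v) = 0" using w by (intro rho_kill) (simp add: weight_def)
    show ?thesis
    proof (cases "red \<nu> = 0")
      case True
      have "So (So v) = smf \<nu> (So v)" using So_So[OF v] by (simp only: \<nu>_def)
      also have "\<dots> = smf 0 (So v)" by (rule sc_cong[OF module_smf k]) (simp add: True)
      finally have "So (So v) = 0" by (simp only: S.scale_zero_left)
      thus ?thesis using weight_So_0[OF w] w by blast
    next
      case nz: False
      have "smf (lift (inverse (red \<nu>))) (So (So v)) \<in> ZZ (So v)"
        by (rule ZZ_scale[OF So_ZZ])
      moreover have "smf (lift (inverse (red \<nu>))) (So (So v)) = So v"
        unfolding So_So[OF v] \<nu>_def[symmetric] by (rule sc_unit[OF module_smf k nz])
      ultimately show ?thesis using w by auto
    qed
  qed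
qed

text \<open>The obstruction to stability under s is the term s n(u) s v with u in p, which equals v;
  there \<open>v \<in> ZZ v\<close> enters.\<close>

lemma ZZ_eq_rho: assumes v: "weight \<psi> v" "v \<in> ZZ v" shows "ZZ v = \<rho>"
proof -
  have vr: "v \<in> \<rho>" using v by (simp add: weight_def)
  have sub: "ZZ v \<subseteq> \<rho>" unfolding ZZ_def using rho_nn rho_ss vr by (intro S.span_minimal rho_sub) auto
  have lift_gen: "act k w \<in> ZZ v"
    if "\<And>u. pw 0 u \<Longrightarrow> act k (act (nn u) (act ss v)) \<in> ZZ v" "w \<in> ZZ v" for k w
  proof -
    have "S.span ((\<lambda>u. act (nn u) (act ss v)) ` {u. pw 0 u}) \<subseteq> {w. act k w \<in> ZZ v}"
      using that(1) unfolding ZZ_def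
      by (intro S.span_minimal S.subspaceI)
        (auto simp: act_add act_smf intro: S.span_add S.span_scale S.span_zero)
    thus ?thesis using that(2) unfolding ZZ_def by blast
  qed
  have "Kst (ZZ v)"
  proof (rule KstI)
    fix u w assume u: "pw 0 u" and w: "w \<in> ZZ v"
    show "act (nn u) w \<in> ZZ v"
    proof (rule lift_gen[OF _ w])
      show "act (nn u) (act (nn u') (act ss v)) \<in> ZZ v" if "pw 0 u'" for u'
        unfolding nn_nn by (rule ZZ_base[OF pw_add[OF u that]])
    qed
  next
    fix a d w assume ad: "ou a" "ou d" and w: "w \<in> ZZ v"
    show "act (dg a d) w \<in> ZZ v"
    proof (rule lift_gen[OF _ w])
      fix u assume u: "pw 0 u"
      have ad': "a \<noteq> 0" "d \<noteq> 0" using ad by (simp_all add: ou_def)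
      have "act (dg a d) (act (nn u) (act ss v)) = smf (\<psi> d a) (act (nn (a / d * u)) (act ss v))"
        by (simp only: dg_nn[OF ad'] weight_dg_ss[OF v(1) ad] act_smf)
      moreover have "pw 0 (a / d * u)" using ou_pw[OF ou_divide[OF ad]] u by (rule pw_mult_o)
      ultimately show "act (dg a d) (act (nn u) (act ss v)) \<in> ZZ v"
        by (simp only: ZZ_base ZZ_scale)
    qed
  next
    fix w assume w: "w \<in> ZZ v"
    show "act ss w \<in> ZZ v"
    proof (rule lift_gen[OF _ w])
      fix u assume u: "pw 0 u"
      show "act ss (act (nn u) (act ss v)) \<in> ZZ v"
      proof (cases "pw 1 u")
        case True
        thus ?thesis using ss_nn_ss_small[OF rho_kfix[OF vr]] v(2) by simp
      next
        case False
        hence o: "ou u" using u by (simp add: ou_iff)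
        show ?thesis unfolding weight_ss_nn_ss[OF v(1) o]
          by (rule ZZ_scale[OF ZZ_base[OF ou_pw[OF ou_divide[OF ou_1 o]]]])
      qed
    qed
  qed
  moreover have "S.subspace (ZZ v)" by (simp add: ZZ_def)
  ultimately have "ZZ v = {0} \<or> ZZ v = \<rho>" using rho_irr[OF sub] by blast
  thus ?thesis using v by (auto simp: weight_def)
qed

text \<open>The coinvariants of \<open>\<rho>\<close> under the upper unipotents are spanned by the image of
\<open>s v\<close>; \<open>lm\<close> is the coinvariant functional normalized at \<open>s v\<close>. The functionals
\<open>lm \<circ> s \<circ> n(u)\<close> have no common zero by irreducibility, so the invariants form a line.\<close>

theorem unipotent_invariants_line:
  "\<exists>\<psi> v lm. weight \<psi> v \<and> (\<forall>z\<in>\<rho>. \<forall>z'\<in>\<rho>. lm (z + z') = lm z + lm z') \<and>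
     (\<forall>a. \<forall>z\<in>\<rho>. lm (smf a z) = red a * lm z) \<and>
     (\<forall>u. \<forall>z\<in>\<rho>. pw 0 u \<longrightarrow> lm (act (nn u) z) = lm z) \<and>
     (\<forall>a d. \<forall>z\<in>\<rho>. ou a \<longrightarrow> ou d \<longrightarrow> lm (act (dg a d) z) = red (\<psi> d a) * lm z) \<and>
     lm (act ss v) = 1 \<and>
     (\<forall>y\<in>\<rho>. nfix y \<longrightarrow> y = smf (lift (lm (act ss y))) v)"
proof -
  obtain \<psi> v where v: "weight \<psi> v" "v \<in> ZZ v" using ex_good_weight by blast
  have vr: "v \<in> \<rho>" "v \<noteq> 0" "nfix v" using v by (simp_all add: weight_def)
  have sv: "act ss v \<in> \<rho>" by (rule rho_ss[OF vr(1)])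
  define e where "e r = act (nn r) (act ss v)" for r
  have er: "e r \<in> \<rho>" if "pw 0 r" for r unfolding e_def by (rule rho_nn[OF that sv])
  define V where "V = {z. \<exists>c. z = (\<Sum>r\<in>R. smf (c r) (e r))}"
  have VI: "z \<in> V" if "z = (\<Sum>r\<in>R. smf (c r) (e r))" for z c
    unfolding V_def by (rule CollectI, rule exI[of _ c]) (rule that)
  have Vsub: "S.subspace V"
  proof (rule S.subspaceI)
    have "0 = (\<Sum>r\<in>R. smf 0 (e r))" by (simp only: S.scale_zero_left sum.neutral_const)
    thus "0 \<in> V" by (rule VI)
  next
    fix x y assume "x \<in> V" "y \<in> V"
    then obtain c d where "x = (\<Sum>r\<in>R. smf (c r) (e r))" "y = (\<Sum>r\<in>R. smf (d r) (e r))" unfolding V_def by blast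
    hence "x + y = (\<Sum>r\<in>R. smf (c r + d r) (e r))" by (simp only: S.scale_left_distrib sum.distrib)
    thus "x + y \<in> V" by (rule VI)
  next
    fix a x assume "x \<in> V"
    then obtain c where "x = (\<Sum>r\<in>R. smf (c r) (e r))" unfolding V_def by blast
    hence "smf a x = (\<Sum>r\<in>R. smf (a * c r) (e r))" by (simp only: S.scale_sum_right S.scale_scale)
    thus "smf a x \<in> V" by (rule VI)
  qed
  have delta: "e r = (\<Sum>r'\<in>R. smf (if r' = r then 1 else 0) (e r'))" if "r \<in> R" for r
  proof -
    have "(\<Sum>r'\<in>R. smf (if r' = r then 1 else 0) (e r')) = (\<Sum>r'\<in>R. if r' = r then e r' else 0)"
      by (rule sum.cong[OF refl]) (simp only: S.scale_one S.scale_zero_left if_True if_False simp_thms split: if_split, blast)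
    also have "\<dots> = e r" using that by (simp only: sum.delta fin_R if_True)
    finally show ?thesis ..
  qed
  have e_rep: "\<exists>r\<in>R. e u = e r" if u: "pw 0 u" for u
  proof -
    obtain r where "r \<in> R" "pw 1 (u - r)" using transv_R u by (auto simp: transv_def)
    thus ?thesis using nn_cong[OF sv u] unfolding e_def by blast
  qed
  have "\<rho> \<subseteq> V"
  proof -
    have "e u \<in> V" if u: "pw 0 u" for u
    proof -
      obtain r where r: "r \<in> R" "e u = e r" using e_rep[OF u] by blast
      show ?thesis unfolding r(2) by (rule VI[OF delta[OF r(1)]])
    qed
    hence "ZZ v \<subseteq> V" unfolding ZZ_def using Vsub by (intro S.span_minimal) (auto simp: e_def)
    thus ?thesis using ZZ_eq_rho[OF v] by simp
  qed
  hence rep: "\<exists>c. z = (\<Sum>r\<in>R. smf (c r) (e r))" if "z \<in> \<rho>" for z using that unfolding V_def by blast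
  \<comment> \<open>This makes the sum of the coefficients well defined. The vectors killed by the
    operator with coefficients \<open>c\<close> include s v and are stable under the unipotents, so
    one of them is fixed; on it the operator is multiplication by the sum of the
    coefficients.\<close>
  have rel: "(\<Sum>r\<in>R. red (c r)) = 0" if c: "(\<Sum>r\<in>R. smf (c r) (e r)) = 0" for c
  proof -
    define V' where "V' = {x \<in> \<rho>. (\<Sum>r\<in>R. smf (c r) (act (nn r) x)) = 0}"
    have "\<exists>x\<in>V'. x \<noteq> 0 \<and> nfix x"
    proof (rule ex_nfix)
      show "S.subspace V'"
      proof (rule S.subspaceI)
        show "0 \<in> V'" by (simp add: V'_def rho_0 flip: zero_fun_def)
        show "x + y \<in> V'" if "x \<in> V'" "y \<in> V'" for x y
          using that S.subspace_add[OF rho_sub]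
          by (simp add: V'_def act_add S.scale_right_distrib sum.distrib)
        show "smf a x \<in> V'" if "x \<in> V'" for a x
        proof -
          have "(\<Sum>r\<in>R. smf (c r) (act (nn r) (smf a x))) = smf a (\<Sum>r\<in>R. smf (c r) (act (nn r) x))"
            by (simp add: act_smf S.scale_sum_right mult.commute)
          thus ?thesis using that S.subspace_scale[OF rho_sub] by (simp add: V'_def)
        qed
      qed
      show "V' \<subseteq> Sg" using rho_Sg by (auto simp: V'_def)
      show "kfix 1 x" if "x \<in> V'" for x using that rho_kfix by (simp add: V'_def)
      have "act ss v \<noteq> 0"
      proof
        assume "act ss v = 0"
        hence "act ss (act ss v) = 0" by simp
        thus False using vr rhoC by simp
      qed
      moreover have "act ss v \<in> V'" using sv c by (simp add: V'_def e_def)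
      ultimately show "V' \<noteq> {0}" by blast
      fix u x assume u: "pw 0 u" and x: "x \<in> V'"
      have "(\<Sum>r\<in>R. smf (c r) (act (nn r) (act (nn u) x))) = act (nn u) (\<Sum>r\<in>R. smf (c r) (act (nn r) x))"
        by (simp add: act_sum act_smf nn_nn add.commute)
      thus "act (nn u) x \<in> V'" using x rho_nn[OF u] by (simp add: V'_def)
    qed
    then obtain x where x: "x \<in> V'" "x \<noteq> 0" "nfix x" by blast
    have "(\<Sum>r\<in>R. smf (c r) (act (nn r) x)) = (\<Sum>r\<in>R. smf (c r) x)"
      by (rule sum.cong[OF refl]) (use x(3) R_pw in \<open>simp add: nfix_def\<close>)
    also have "\<dots> = smf (\<Sum>r\<in>R. c r) x" by (simp only: S.scale_sum_left)
    finally have "smf (\<Sum>r\<in>R. c r) x = 0" using x(1) by (simp add: V'_def)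
    moreover have "smf uE x = 0" using x(1) rho_kill by (simp add: V'_def)
    ultimately have "red (\<Sum>r\<in>R. c r) = 0" using sc_nz[OF module_smf] x(2) by blast
    thus ?thesis by simp
  qed
  define cf where "cf z = (SOME c. z = (\<Sum>r\<in>R. smf (c r) (e r)))" for z
  define lm where "lm z = (\<Sum>r\<in>R. red (cf z r))" for z
  have lam: "lm z = (\<Sum>r\<in>R. red (c r))" if z: "z = (\<Sum>r\<in>R. smf (c r) (e r))" for z c
  proof -
    have "z = (\<Sum>r\<in>R. smf (cf z r) (e r))" unfolding cf_def by (rule someI[of _ c]) (rule z)
    hence "(\<Sum>r\<in>R. smf (cf z r - c r) (e r)) = z - z"
      by (simp only: S.scale_left_diff_distrib sum_subtractf) (metis z)
    hence "(\<Sum>r\<in>R. red (cf z r - c r)) = 0" by (intro rel) simp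
    thus ?thesis by (simp add: lm_def sum_subtractf)
  qed
  have lam_add: "lm (z + z') = lm z + lm z'" if zz: "z \<in> \<rho>" "z' \<in> \<rho>" for z z'
  proof -
    obtain c c' where c: "z = (\<Sum>r\<in>R. smf (c r) (e r))" "z' = (\<Sum>r\<in>R. smf (c' r) (e r))"
      using rep zz by meson
    have "z + z' = (\<Sum>r\<in>R. smf (c r + c' r) (e r))"
      by (simp only: c S.scale_left_distrib sum.distrib)
    thus ?thesis using lam[OF c(1)] lam[OF c(2)] lam[of "z + z'" "\<lambda>r. c r + c' r"] by (simp add: sum.distrib)
  qed
  have lam_sc: "lm (smf a z) = red a * lm z" if z: "z \<in> \<rho>" for a z
  proof -
    obtain c where c: "z = (\<Sum>r\<in>R. smf (c r) (e r))" using rep z by meson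
    have "smf a z = (\<Sum>r\<in>R. smf (a * c r) (e r))"
      by (simp only: c S.scale_sum_right S.scale_scale)
    thus ?thesis using lam[OF c] lam[of "smf a z" "\<lambda>r. a * c r"] by (simp add: sum_distrib_left)
  qed
  have lam_0: "lm 0 = 0" using lam_sc[OF rho_0, of 0] by simp
  have lam_e: "lm (e u) = 1" if u: "pw 0 u" for u
  proof -
    obtain r where r: "r \<in> R" "e u = e r" using e_rep[OF u] by blast
    have "lm (e r) = (\<Sum>r'\<in>R. red (if r' = r then 1 else 0))" by (rule lam[OF delta[OF r(1)]])
    also have "\<dots> = (\<Sum>r'\<in>R. if r' = r then 1 else 0)" by (rule sum.cong) auto
    also have "\<dots> = 1" using r(1) by simp
    finally show ?thesis using r(2) by simp
  qed
  text \<open>A linear functional on \<open>\<rho>\<close> that is constant on the \<open>e u\<close> is a multiple of \<open>lm\<close>.\<close>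
  have proportional: "F z = F (act ss v) * lm z"
    if Fadd: "\<And>z z'. z \<in> \<rho> \<Longrightarrow> z' \<in> \<rho> \<Longrightarrow> F (z + z') = F z + F z'"
      and Fsc: "\<And>a z. z \<in> \<rho> \<Longrightarrow> F (smf a z) = red a * F z"
      and Fe: "\<And>r. r \<in> R \<Longrightarrow> F (e r) = F (act ss v)" and z: "z \<in> \<rho>"
    for F :: "('f m2 \<Rightarrow> 'w) \<Rightarrow> 'k" and z
  proof -
    obtain c where c: "z = (\<Sum>r\<in>R. smf (c r) (e r))" using rep z by meson
    have F0: "F 0 = 0" using Fsc[OF rho_0, of 0] by simp
    have m: "smf (c r) (e r) \<in> \<rho>" if "r \<in> R" for r
      using er[OF R_pw[OF that]] by (rule S.subspace_scale[OF rho_sub])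
    have "F (\<Sum>r\<in>B. smf (c r) (e r)) = (\<Sum>r\<in>B. F (smf (c r) (e r)))" if "finite B" "B \<subseteq> R" for B
      using that
    proof (induction B rule: finite_induct)
      case empty
      show ?case using F0 by (simp only: sum.empty)
    next
      case (insert r B)
      have B: "(\<Sum>r\<in>B. smf (c r) (e r)) \<in> \<rho>" using m insert.prems by (intro S.subspace_sum[OF rho_sub]) auto
      have "F (\<Sum>r\<in>B. smf (c r) (e r)) = (\<Sum>r\<in>B. F (smf (c r) (e r)))"
        using insert.IH insert.prems by blast
      moreover have "r \<in> R" using insert.prems by blast
      ultimately show ?case
        unfolding sum.insert[OF insert.hyps] by (simp only: Fadd[OF m B])
    qed
    hence "F z = (\<Sum>r\<in>R. F (smf (c r) (e r)))" using c by simp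
    also have "\<dots> = (\<Sum>r\<in>R. red (c r) * F (act ss v))"
      by (rule sum.cong[OF refl]) (use Fsc er R_pw Fe in auto)
    also have "\<dots> = F (act ss v) * lm z" by (simp add: lam[OF c] sum_distrib_left mult.commute)
    finally show ?thesis .
  qed
  have lam_ssv: "lm (act ss v) = 1" using lam_e[of 0] sv rhoC by (simp add: e_def)
  have lam_nn: "lm (act (nn u) z) = lm z" if u: "pw 0 u" and z: "z \<in> \<rho>" for u z
  proof -
    have "lm (act (nn u) z) = lm (act (nn u) (act ss v)) * lm z"
    proof (rule proportional[of "\<lambda>z. lm (act (nn u) z)", OF _ _ _ z])
      show "lm (act (nn u) (e r)) = lm (act (nn u) (act ss v))" if "r \<in> R" for r
        using lam_e[OF pw_add[OF u R_pw[OF that]]] lam_e[OF u] by (simp add: e_def nn_nn)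
    qed (use rho_nn[OF u] in \<open>auto simp: act_add act_smf lam_add lam_sc\<close>)
    thus ?thesis using lam_e[OF u] by (simp add: e_def)
  qed
  have lam_dg: "lm (act (dg a d) z) = red (\<psi> d a) * lm z" if ad: "ou a" "ou d" and z: "z \<in> \<rho>" for a d z
  proof -
    have 0: "lm (act (dg a d) (e u)) = red (\<psi> d a)" if u: "pw 0 u" for u
    proof -
      have pu: "pw 0 (a / d * u)" using ou_pw[OF ou_divide[OF ad]] u by (rule pw_mult_o)
      have "act (dg a d) (e u) = smf (\<psi> d a) (e (a / d * u))"
        using ad weight_dg_ss[OF v(1) ad] by (simp add: e_def dg_nn ou_def act_smf)
      thus ?thesis using lam_sc[OF er[OF pu]] lam_e[OF pu] by simp
    qed
    have 1: "e 0 = act ss v" using sv rhoC by (simp add: e_def)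
    have "lm (act (dg a d) z) = lm (act (dg a d) (act ss v)) * lm z"
    proof (rule proportional[of "\<lambda>z. lm (act (dg a d) z)", OF _ _ _ z])
      show "lm (act (dg a d) (e r)) = lm (act (dg a d) (act ss v))" if "r \<in> R" for r
        using 0[OF R_pw[OF that]] 0[of 0] 1 by simp
    qed (use rho_act[OF KK_gens(4)[OF ad]] in \<open>auto simp: act_add act_smf lam_add lam_sc\<close>)
    thus ?thesis using 0[of 0] 1 by simp
  qed
  have key: "lm (act ss (act (nn r) (act ss x))) = red (\<psi> r (- 1 / r)) * lm (act ss (act (nn (1 / r)) x))"
    if r: "ou r" and x: "x \<in> \<rho>" for r x
  proof -
    have o: "ou (- 1 / r)" "ou (1 / r)" using ou_divide[OF ou_1 r] ou_divide[of "-1" r] r by simp_all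
    have m: "act ss (act (nn (1 / r)) x) \<in> \<rho>" using rho_ss rho_nn ou_pw[OF o(2)] x by blast
    have "r \<noteq> 0" using r by (simp add: ou_def)
    hence "lm (act ss (act (nn r) (act ss x))) = lm (act (dg (- 1 / r) r) (act ss (act (nn (1 / r)) x)))"
      unfolding ss_nn_ss[OF \<open>r \<noteq> 0\<close>] using ou_pw[OF o(2)] rho_act[OF KK_gens(4)[OF o(1) r] m] by (intro lam_nn)
    thus ?thesis using lam_dg[OF o(1) r m] by simp
  qed
  define J where "J = {x \<in> \<rho>. \<forall>u. pw 0 u \<longrightarrow> lm (act ss (act (nn u) x)) = 0}"
  have Jsub: "S.subspace J"
  proof (rule S.subspaceI)
    show "0 \<in> J" using rho_0 lam_0 by (simp add: J_def)
    show "x + y \<in> J" if "x \<in> J" "y \<in> J" for x y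
      using that S.subspace_add[OF rho_sub] rho_ss rho_nn by (simp add: J_def act_add lam_add)
    show "smf a x \<in> J" if "x \<in> J" for a x
      using that S.subspace_scale[OF rho_sub] rho_ss rho_nn by (simp add: J_def act_smf lam_sc)
  qed
  \<comment> \<open>Stability of \<open>J\<close> under s needs \<open>lm\<close> itself to vanish
    on \<open>J\<close>. The sum \<mu> is a unipotent-invariant functional, hence a multiple of
    \<open>lm\<close>. If the multiple is nonzero, \<mu>(x) = 0 gives the claim; if it is zero,
    \<mu>(s x) = 0 does, as \<open>key\<close> leaves only the term r = 0.\<close>
  have J_lam: "lm x = 0" if x: "x \<in> J" for x
  proof -
    have xr: "x \<in> \<rho>" using x by (simp add: J_def)
    define \<mu> where "\<mu> z = (\<Sum>r\<in>R. lm (act ss (act (nn r) z)))" for z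
    have mem: "act ss (act (nn r) z) \<in> \<rho>" if "r \<in> R" "z \<in> \<rho>" for r z
      using that rho_ss rho_nn R_pw by blast
    have mu: "\<mu> z = \<mu> (act ss v) * lm z" if z: "z \<in> \<rho>" for z
    proof (rule proportional[OF _ _ _ z])
      show "\<mu> (z + z') = \<mu> z + \<mu> z'" if "z \<in> \<rho>" "z' \<in> \<rho>" for z z'
        using that mem by (simp add: \<mu>_def act_add lam_add sum.distrib)
      show "\<mu> (smf a z) = red a * \<mu> z" if "z \<in> \<rho>" for a z
        using that mem by (simp add: \<mu>_def act_smf lam_sc sum_distrib_left)
      show "\<mu> (e r) = \<mu> (act ss v)" if "r \<in> R" for r
      proof -
        have "\<mu> (e r) = (\<Sum>r'\<in>R. lm (act ss (act (nn (r' + r)) (act ss v))))"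
          by (simp add: \<mu>_def e_def nn_nn)
        also have "\<dots> = \<mu> (act ss v)" unfolding \<mu>_def
          by (rule sum_transv_shift[OF transv_R R_pw[OF that], of "\<lambda>r. lm (act ss (act (nn r) (act ss v)))"])
            (use nn_cong[OF sv] in auto)
        finally show ?thesis .
      qed
    qed
    show ?thesis
    proof (cases "\<mu> (act ss v) = 0")
      case False
      have "\<mu> x = 0" unfolding \<mu>_def using x R_pw by (intro sum.neutral) (auto simp: J_def)
      thus ?thesis using mu[OF xr] False by simp
    next
      case True
      hence "0 = \<mu> (act ss x)" using mu[OF rho_ss[OF xr]] by simp
      also have "\<dots> = lm (act ss (act (nn 0) (act ss x))) + (\<Sum>r\<in>R - {0}. lm (act ss (act (nn r) (act ss x))))"
        unfolding \<mu>_def by (rule sum_R_split)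
      also have "(\<Sum>r\<in>R - {0}. lm (act ss (act (nn r) (act ss x)))) = 0"
      proof (intro sum.neutral ballI)
        fix r assume "r \<in> R - {0}"
        hence r: "ou r" using R_ou by blast
        show "lm (act ss (act (nn r) (act ss x))) = 0"
          using x ou_pw[OF ou_divide[OF ou_1 r]] by (simp add: key[OF r xr] J_def)
      qed
      finally show ?thesis using xr rho_ss rhoC by simp
    qed
  qed
  have "Kst J"
  proof (rule KstI)
    show "act (nn u) x \<in> J" if "pw 0 u" "x \<in> J" for u x
      using that rho_nn pw_add by (simp add: J_def nn_nn)
    show "act (dg a d) x \<in> J" if ad: "ou a" "ou d" and x: "x \<in> J" for a d x
    proof -
      have ad': "a \<noteq> 0" "d \<noteq> 0" using ad by (auto simp: ou_def)
      have xr: "x \<in> \<rho>" using x by (simp add: J_def)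
      have "lm (act ss (act (nn u) (act (dg a d) x))) = 0" if u: "pw 0 u" for u
      proof -
        have pu: "pw 0 (d / a * u)" using ou_pw[OF ou_divide[OF ad(2,1)]] u by (rule pw_mult_o)
        have "act ss (act (nn u) (act (dg a d) x)) = act ss (act (dg a d) (act (nn (d / a * u)) x))"
          using ad' by (simp add: dg_nn)
        also have "\<dots> = act (dg d a) (act ss (act (nn (d / a * u)) x))" using ad' by (simp add: dg_ss)
        finally show ?thesis using x pu lam_dg[OF ad(2,1)] rho_ss[OF rho_nn[OF pu xr]] by (simp add: J_def)
      qed
      thus ?thesis using rho_act[OF KK_gens(4)[OF ad] xr] by (simp add: J_def)
    qed
    show "act ss x \<in> J" if x: "x \<in> J" for x
    proof -
      have xr: "x \<in> \<rho>" using x by (simp add: J_def)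
      have "lm (act ss (act (nn u) (act ss x))) = 0" if u: "pw 0 u" for u
      proof (cases "pw 1 u")
        case True
        thus ?thesis using ss_nn_ss_small[OF rho_kfix[OF xr]] J_lam[OF x] by simp
      next
        case False
        hence o: "ou u" using u by (simp add: ou_iff)
        show ?thesis using x ou_pw[OF ou_divide[OF ou_1 o]] by (simp add: key[OF o xr] J_def)
      qed
      thus ?thesis using rho_ss[OF xr] by (simp add: J_def)
    qed
  qed
  moreover have "J \<subseteq> \<rho>" by (auto simp: J_def)
  ultimately have "J = {0} \<or> J = \<rho>" using rho_irr Jsub by blast
  moreover have "v \<notin> J"
  proof
    assume "v \<in> J"
    hence "lm (act ss (act (nn 0) v)) = 0" by (simp add: J_def)
    thus False using lam_ssv vr rhoC by simp
  qed
  ultimately have J0: "J = {0}" using vr by blast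
  have line: "y = smf (lift (lm (act ss y))) v" if y: "y \<in> \<rho>" "nfix y" for y
  proof -
    define a where "a = lift (lm (act ss y))"
    define y' where "y' = y - smf a v"
    have m: "smf a v \<in> \<rho>" using vr(1) by (rule S.subspace_scale[OF rho_sub])
    have y'r: "y' \<in> \<rho>" unfolding y'_def by (rule S.subspace_diff[OF rho_sub y(1) m])
    have "act (nn u) y' = y'" if "pw 0 u" for u
      using y(2) vr(3) that by (simp add: y'_def act_diff act_smf nfix_def)
    moreover have "lm (act ss y') = 0"
    proof -
      have "act ss y = act ss y' + smf a (act ss v)" by (simp add: y'_def act_diff act_smf)
      hence "lm (act ss y) = lm (act ss y') + red a * lm (act ss v)"
        using lam_add[OF rho_ss[OF y'r] S.subspace_scale[OF rho_sub sv]] lam_sc[OF sv] by simp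
      thus ?thesis by (simp add: lam_ssv a_def)
    qed
    ultimately have "y' \<in> J" using y'r by (simp add: J_def)
    hence "y' = 0" using J0 by blast
    hence "y = smf a v" by (simp only: y'_def right_minus_eq)
    thus ?thesis by (simp only: a_def)
  qed
  show ?thesis using v(1) lam_add lam_sc lam_nn lam_dg lam_ssv line by (intro exI[of _ \<psi>] exI[of _ v] exI[of _ lm]) blast
qed

end

section \<open>The Hecke operator\<close>

context smooth_mod
begin

definition T :: "int \<Rightarrow> 'f m2" where "T j = dg (uf powi j) 1"

lemma T_GL2 [simp]: "T j \<in> GL2" and T_Borel [simp]: "T j \<in> Borel" by (simp_all add: T_def)

lemma T_T: "act (T i) (act (T j) f) = act (T (i + j)) f"
proof -
  have "m2mult (T i) (T j) = T (i + j)" by (simp add: T_def mdefs power_int_add)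
  thus ?thesis by (simp flip: act_mult)
qed

lemma T_0 [simp]: "f \<in> C \<Longrightarrow> act (T 0) f = f"
  using act_one[of f] by (simp add: T_def mdefs)

lemma T_nn: "act (T j) (act (nn u) f) = act (nn (uf powi j * u)) (act (T j) f)"
  using dg_nn[of "uf powi j" 1 u f] by (simp add: T_def)

lemma dg_T: "a \<noteq> 0 \<Longrightarrow> d \<noteq> 0 \<Longrightarrow> act (dg a d) (act (T j) f) = act (T j) (act (dg a d) f)"
proof -
  have "m2mult (dg a d) (T j) = m2mult (T j) (dg a d)" by (simp add: T_def mdefs)
  thus "a \<noteq> 0 \<Longrightarrow> d \<noteq> 0 \<Longrightarrow> ?thesis" by (simp flip: act_mult)
qed

text \<open>The Hecke operator attached to \<open>t = diag(uf, 1)\<close>.\<close>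

definition U :: "('f m2 \<Rightarrow> 'w) \<Rightarrow> 'f m2 \<Rightarrow> 'w" where
  "U f = (\<Sum>r\<in>R. act (nn r) (act (T 1) f))"

lemma U_add: "U (f + f') = U f + U f'" by (simp add: U_def act_add sum.distrib)
lemma U_smf: "U (smf a f) = smf a (U f)" by (simp add: U_def act_smf S.scale_sum_right)

text \<open>The digit expansion collapses n(r) t n(u) t^j to n(r + uf u) t^(j+1).\<close>

lemma U_pow: "f \<in> C \<Longrightarrow> (U ^^ j) f = (\<Sum>u\<in>RR j. act (nn u) (act (T (int j)) f))"
proof (induction j)
  case 0
  thus ?case by simp
next
  case (Suc j)
  have "(U ^^ Suc j) f = U (\<Sum>u\<in>RR j. act (nn u) (act (T (int j)) f))" using Suc by simp
  also have "\<dots> = (\<Sum>r\<in>R. \<Sum>u\<in>RR j. act (nn (r + uf * u)) (act (T (int (Suc j))) f))"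
    by (simp add: U_def act_sum T_nn nn_nn T_T)
  finally have "(U ^^ Suc j) f = (\<Sum>r\<in>R. \<Sum>u\<in>RR j. act (nn (r + uf * u)) (act (T (int (Suc j))) f))" .
  thus ?case by (simp only: sum_RR_Suc)
qed

lemma nn_T1_cong:
  assumes "nfix f" "pw 1 (u - u')"
  shows "act (nn u) (act (T 1) f) = act (nn u') (act (T 1) f)"
proof -
  have "pw 0 ((u - u') / uf)" using pw_divide[OF uf_nz assms(2)] by simp
  hence "act (T 1) (act (nn ((u - u') / uf)) f) = act (T 1) f" using assms(1) by (simp add: nfix_def)
  hence "act (nn (u - u')) (act (T 1) f) = act (T 1) f" by (simp add: T_nn)
  hence "act (nn u') (act (nn (u - u')) (act (T 1) f)) = act (nn u') (act (T 1) f)" by simp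
  thus ?thesis by (simp add: nn_nn)
qed

lemma kfix1_nb: "kfix 1 f \<Longrightarrow> pw 1 c \<Longrightarrow> act (nb c) f = f"
  using nb_Kcong[of 1 c] by (simp add: kfix_def)

text \<open>The translates occurring in \<open>U f\<close> are fixed by the principal congruence subgroup.\<close>

lemma kfix1_nn_T1:
  assumes f: "nfix f" "kfix 1 f" and u: "pw 0 u"
  shows "kfix 1 (act (nn u) (act (T 1) f))"
  unfolding kfix_def
proof
  fix k assume k: "k \<in> Kcong val 1"
  obtain a b c d where k': "k = M2 a b c d" by (cases k)
  have kc: "pw 1 (a - 1)" "pw 1 b" "pw 1 c" "pw 1 (d - 1)" using k by (auto simp: k' Kcong_def)
  define e where "e = c * u + d"
  have cu: "pw 1 (c * u)" by (rule pw_mult_o'[OF kc(3) u])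
  have e1: "pw 1 (e - 1)" using pw_add[OF cu kc(4)] by (simp add: e_def algebra_simps)
  hence e: "ou e" by (intro ou_cong[OF ou_1])
  hence e0: "e \<noteq> 0" "val e = 0" by (auto simp: ou_def)
  \<comment> \<open>The image of u under the fractional linear action of k; it is congruent to u
    modulo p, and the remaining right factor \<open>L\<close> lies in K(1).\<close>
  define u' where "u' = (a * u + b) / e"
  have "pw 1 ((a - 1) * u + b - (e - 1) * u)"
    using pw_diff[OF pw_add[OF pw_mult_o'[OF kc(1) u] kc(2)] pw_mult_o'[OF e1 u]] .
  hence "pw 1 (a * u + b - e * u)" by (simp add: algebra_simps)
  hence "pw 1 ((a * u + b - e * u) / e)" using pw_divide[OF e0(1), of 1] e0 by simp
  moreover have "(a * u + b - e * u) / e = u' - u" using e0 by (simp add: u'_def field_simps)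
  ultimately have uu: "pw 1 (u' - u)" by simp
  have u'o: "pw 0 u'" using pw_add[OF pw_mono[OF uu, of 0] u] by simp
  define L where "L = M2 (a - u' * c) 0 (c * uf) e"
  have det: "k \<in> GL2" using Kcong_KK[OF _ k] KK_GL2 by simp
  have "m2mult k (m2mult (nn u) (T 1)) = m2mult (nn u') (m2mult (T 1) L)"
  proof -
    have "c * u + d = e" by (simp add: e_def)
    moreover have "u' * e = a * u + b" using e0 by (simp add: u'_def)
    ultimately show ?thesis by (simp add: k' T_def mdefs L_def algebra_simps)
  qed
  moreover have L: "L \<in> Kcong val 1"
  proof -
    have "pw 1 (a - u' * c - 1)" using pw_diff[OF kc(1) pw_mult_o[OF u'o kc(3)]] by (simp add: algebra_simps)
    moreover have "pw 1 (c * uf)" by (rule pw_mult_o'[OF kc(3)]) (simp add: in_pow_def)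
    ultimately show ?thesis using e1 by (simp add: L_def Kcong_def)
  qed
  moreover have "L \<in> GL2" using Kcong_KK[OF _ L] KK_GL2 by simp
  ultimately have "act k (act (nn u) (act (T 1) f)) = act (nn u') (act (T 1) (act L f))"
    using det by (simp flip: act_mult)
  also have "act L f = f" using f(2) L by (simp add: kfix_def)
  also have "act (nn u') (act (T 1) f) = act (nn u) (act (T 1) f)" by (rule nn_T1_cong[OF f(1) uu])
  finally show "act k (act (nn u) (act (T 1) f)) = act (nn u) (act (T 1) f)" .
qed

lemma nfix_U: assumes f: "nfix f" shows "nfix (U f)"
  unfolding nfix_def
proof (intro allI impI)
  fix u assume u: "pw 0 u"
  have "(\<Sum>r\<in>R. act (nn (r + u)) (act (T 1) f)) = U f" unfolding U_def
    by (rule sum_transv_shift[OF transv_R u, of "\<lambda>r. act (nn r) (act (T 1) f)"])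
      (use nn_T1_cong[OF f] in auto)
  thus "act (nn u) (U f) = U f" by (simp add: U_def act_sum nn_nn add.commute)
qed

lemma kfix1_U: assumes f: "nfix f" "kfix 1 f" shows "kfix 1 (U f)"
  unfolding kfix_def
proof
  fix k assume k: "k \<in> Kcong val 1"
  have "act k (act (nn r) (act (T 1) f)) = act (nn r) (act (T 1) f)" if "r \<in> R" for r
    using kfix1_nn_T1[OF f R_pw[OF that]] k by (simp add: kfix_def)
  thus "act k (U f) = U f" unfolding U_def act_sum by (intro sum.cong refl)
qed

lemma nfix_dg: assumes "nfix f" "ou a" "ou d" shows "nfix (act (dg a d) f)"
  unfolding nfix_def
proof (intro allI impI)
  fix u assume u: "pw 0 u"
  have ad: "a \<noteq> 0" "d \<noteq> 0" using assms by (auto simp: ou_def)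
  have pu: "pw 0 (d / a * u)" by (rule pw_mult_o[OF ou_pw[OF ou_divide[OF assms(3,2)]] u])
  have "act (dg a d) (act (nn (d / a * u)) f) = act (nn u) (act (dg a d) f)"
    using ad by (simp add: dg_nn)
  thus "act (nn u) (act (dg a d) f) = act (dg a d) f" using assms(1) pu by (simp add: nfix_def)
qed

lemma U_dg: assumes f: "nfix f" and ad: "ou a" "ou d" shows "act (dg a d) (U f) = U (act (dg a d) f)"
proof -
  have ad': "a \<noteq> 0" "d \<noteq> 0" using ad by (auto simp: ou_def)
  have "act (dg a d) (U f) = (\<Sum>r\<in>R. act (nn (a / d * r)) (act (T 1) (act (dg a d) f)))"
    by (simp add: U_def act_sum dg_nn[OF ad'] dg_T[OF ad'])
  also have "\<dots> = U (act (dg a d) f)" unfolding U_def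
    by (rule sum_transv_mult[OF transv_R ou_divide[OF ad], of "\<lambda>r. act (nn r) (act (T 1) (act (dg a d) f))"])
      (use nn_T1_cong[OF nfix_dg[OF f ad]] in auto)
  finally show ?thesis .
qed

text \<open>Moves s past n(r) t^j at the cost of a lower unipotent. For a unit r and j = 1 its entry
  is in p, so it fixes level-one vectors and s disappears.\<close>

lemma ss_nn_T: assumes r: "r \<noteq> 0"
  shows "act ss (act (nn r) (act (T j) f)) =
    act (nn (1 / r)) (act (dg (- 1 / r) r) (act (T j) (act (nb (uf powi j / r)) f)))"
proof -
  have "m2mult ss (m2mult (nn r) (T j)) =
    m2mult (nn (1 / r)) (m2mult (dg (- 1 / r) r) (m2mult (T j) (nb (uf powi j / r))))"
    using r by (simp add: mdefs T_def field_simps)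
  hence "act (m2mult ss (m2mult (nn r) (T j))) f =
    act (m2mult (nn (1 / r)) (m2mult (dg (- 1 / r) r) (m2mult (T j) (nb (uf powi j / r))))) f" by simp
  thus ?thesis using r by (simp add: act_mult)
qed

text \<open>The effect of \<open>s\<close> on \<open>U f\<close>: apart from the term \<open>s t f = \<Pi> f\<close> it only involves Borel translates of \<open>f\<close>.\<close>

lemma ss_U:
  assumes f: "kfix 1 f"
  shows "act ss (U f) = act (dg 1 uf) (act ss f) + (\<Sum>r\<in>R - {0}. act (nn (1 / r)) (act (dg (- 1 / r) r) (act (T 1) f)))"
proof -
  have 1: "act ss (act (nn r) (act (T 1) f)) = act (nn (1 / r)) (act (dg (- 1 / r) r) (act (T 1) f))"
    if "r \<in> R - {0}" for r
  proof -
    have r: "r \<noteq> 0" "ou r" using that R_ou by auto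
    have "pw 1 (uf powi 1 / r)" using r pw_divide[of r 1 uf] by (simp add: ou_def in_pow_def)
    thus ?thesis using ss_nn_T[OF r(1), of 1 f] kfix1_nb[OF f] by simp
  qed
  have "m2mult ss (m2mult (nn 0) (T 1)) = m2mult (dg 1 uf) ss" by (simp add: mdefs T_def)
  hence "act (m2mult ss (m2mult (nn 0) (T 1))) f = act (m2mult (dg 1 uf) ss) f" by simp
  hence 0: "act ss (act (nn 0) (act (T 1) f)) = act (dg 1 uf) (act ss f)" by (simp add: act_mult)
  have "act ss (U f) = act ss (act (nn 0) (act (T 1) f)) + (\<Sum>r\<in>R - {0}. act ss (act (nn r) (act (T 1) f)))"
    unfolding U_def act_sum by (rule sum.remove[OF fin_R zero_R])
  also have "(\<Sum>r\<in>R - {0}. act ss (act (nn r) (act (T 1) f))) =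
    (\<Sum>r\<in>R - {0}. act (nn (1 / r)) (act (dg (- 1 / r) r) (act (T 1) f)))"
    by (rule sum.cong[OF refl 1])
  finally show ?thesis by (simp only: 0)
qed

end

context sigma_kill
begin

text \<open>The invariants of the pro-p Iwahori subgroup \<open>Iwahori1 val\<close>, which is
  generated by K(1) and the integral upper unipotents.\<close>

definition A :: "('f m2 \<Rightarrow> 'w) set" where "A = {f \<in> Sg. kfix 1 f \<and> nfix f}"

lemma A_sub: "S.subspace A"
  using Sg_sub by (intro S.subspaceI)
    (auto simp: A_def kfix_def nfix_def act_add act_smf S.subspace_0 S.subspace_add S.subspace_scale)

lemma A_Sg: "A \<subseteq> Sg" by (auto simp: A_def)

lemma A_U: "f \<in> A \<Longrightarrow> U f \<in> A"
proof -
  assume f: "f \<in> A"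
  have "U f \<in> Sg" unfolding U_def
    by (rule S.subspace_sum[OF Sg_sub]) (use f Sg_act in \<open>auto simp: A_def\<close>)
  thus ?thesis using f kfix1_U nfix_U by (simp add: A_def)
qed

lemma lin_on_U: "lin_on smf A U"
  using A_U by (auto simp: lin_on_def U_add U_smf)

lemma kill_A: "kill smf A" by (rule kill_Sg[OF A_Sg])

end

locale inv_line = irr_rep val uf p uE red sm ac Sg \<chi> \<rho>
  for val :: "'f::field \<Rightarrow> int" and uf :: 'f and p :: nat
    and uE :: "'o::idom" and red :: "'o \<Rightarrow> 'k::field"
    and sm :: "'o \<Rightarrow> 'w::ab_group_add \<Rightarrow> 'w" and ac :: "'f m2 \<Rightarrow> 'w \<Rightarrow> 'w"
    and Sg :: "('f m2 \<Rightarrow> 'w) set" and \<chi> :: "'f \<Rightarrow> 'o" and \<rho> :: "('f m2 \<Rightarrow> 'w) set" +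
  fixes \<psi> and v :: "'f m2 \<Rightarrow> 'w" and lm :: "('f m2 \<Rightarrow> 'w) \<Rightarrow> 'k"
  assumes v_weight: "weight \<psi> v"
    and lm_add: "\<And>z z'. z \<in> \<rho> \<Longrightarrow> z' \<in> \<rho> \<Longrightarrow> lm (z + z') = lm z + lm z'"
    and lm_smf: "\<And>a z. z \<in> \<rho> \<Longrightarrow> lm (smf a z) = red a * lm z"
    and lm_nn: "\<And>u z. z \<in> \<rho> \<Longrightarrow> pw 0 u \<Longrightarrow> lm (act (nn u) z) = lm z"
    and lm_dg: "\<And>a d z. z \<in> \<rho> \<Longrightarrow> ou a \<Longrightarrow> ou d \<Longrightarrow> lm (act (dg a d) z) = red (\<psi> d a) * lm z"
    and lm_ssv: "lm (act ss v) = 1"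
    and line: "\<And>y. y \<in> \<rho> \<Longrightarrow> nfix y \<Longrightarrow> y = smf (lift (lm (act ss y))) v"
begin

lemma v_rho: "v \<in> \<rho>" using v_weight by (simp add: weight_def)
lemma v_A: "v \<in> A" using v_weight rho_kfix rho_Sg by (auto simp: weight_def A_def)

section \<open>Formal combinations of translates and their total coinvariant\<close>

definition EV :: "('f \<times> int \<times> ('f m2 \<Rightarrow> 'w)) list \<Rightarrow> 'f m2 \<Rightarrow> 'w" where
  "EV xs = (\<Sum>(u, j, z)\<leftarrow>xs. act (nn u) (act (T j) z))"
definition LM :: "('f \<times> int \<times> ('f m2 \<Rightarrow> 'w)) list \<Rightarrow> 'k" where
  "LM xs = (\<Sum>(u, j, z)\<leftarrow>xs. lm z)"
definition okl :: "('f \<times> int \<times> ('f m2 \<Rightarrow> 'w)) list \<Rightarrow> bool" where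
  "okl xs \<longleftrightarrow> (\<forall>(u, j, z)\<in>set xs. z \<in> \<rho>)"

text \<open>\<open>Rel w c\<close>: some expression of \<open>w\<close> as a combination of Borel translates of elements of \<open>\<rho>\<close>
has total coinvariant \<open>c\<close>. If \<open>Rel\<close> is not single-valued, there is a relation between the translates.\<close>

definition Rel :: "('f m2 \<Rightarrow> 'w) \<Rightarrow> 'k \<Rightarrow> bool" where
  "Rel w c \<longleftrightarrow> (\<exists>xs. okl xs \<and> EV xs = w \<and> LM xs = c)"

lemma EV_simps [simp]: "EV [] = 0" "EV ((u, j, z) # xs) = act (nn u) (act (T j) z) + EV xs"
  by (simp_all add: EV_def)
lemma LM_simps [simp]: "LM [] = 0" "LM ((u, j, z) # xs) = lm z + LM xs"
  by (simp_all add: LM_def)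
lemma okl_simps [simp]: "okl []" "okl ((u, j, z) # xs) \<longleftrightarrow> z \<in> \<rho> \<and> okl xs"
  by (simp_all add: okl_def)

lemma EV_append: "EV (xs @ ys) = EV xs + EV ys" by (simp add: EV_def)
lemma LM_append: "LM (xs @ ys) = LM xs + LM ys" by (simp add: LM_def)
lemma okl_append: "okl (xs @ ys) \<longleftrightarrow> okl xs \<and> okl ys" by (simp add: okl_def ball_Un)

lemma EV_Sg: "okl xs \<Longrightarrow> EV xs \<in> Sg"
proof (induction xs)
  case Nil
  show ?case by (simp only: EV_simps Sg0)
next
  case (Cons x xs)
  obtain u j z where x: "x = (u, j, z)" by (cases x)
  have "act (nn u) (act (T j) z) \<in> Sg" using Cons.prems rho_Sg by (auto simp: x intro!: Sg_act)
  moreover have "EV xs \<in> Sg" using Cons by (simp add: x)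
  ultimately show ?case unfolding x EV_simps by (rule S.subspace_add[OF Sg_sub])
qed

lemma Rel_0: "Rel 0 0" unfolding Rel_def by (rule exI[of _ "[]"]) simp

lemma Rel_add: "Rel w c \<Longrightarrow> Rel w' c' \<Longrightarrow> Rel (w + w') (c + c')"
  unfolding Rel_def using okl_append EV_append LM_append by metis

lemma Rel_sum: "finite B \<Longrightarrow> (\<And>b. b \<in> B \<Longrightarrow> Rel (f b) (c b)) \<Longrightarrow> Rel (\<Sum>b\<in>B. f b) (\<Sum>b\<in>B. c b)"
proof (induction B rule: finite_induct)
  case empty
  show ?case using Rel_0 by (simp only: sum.empty)
next
  case (insert b B)
  show ?case unfolding sum.insert[OF insert.hyps] by (rule Rel_add) (use insert in auto)
qed

lemma Rel_map:
  assumes "Rel w c"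
    and "\<And>u j z. z \<in> \<rho> \<Longrightarrow> \<exists>u' j' z'. z' \<in> \<rho> \<and> lm z' = \<kappa> * lm z \<and>
       g (act (nn u) (act (T j) z)) = act (nn u') (act (T j') z')"
    and "g 0 = 0" "\<And>x y. g (x + y) = g x + g y"
  shows "Rel (g w) (\<kappa> * c)"
proof -
  obtain xs where xs: "okl xs" "EV xs = w" "LM xs = c" using assms(1) by (auto simp: Rel_def)
  have "\<exists>ys. okl ys \<and> EV ys = g (EV xs) \<and> LM ys = \<kappa> * LM xs" using xs(1)
  proof (induction xs)
    case Nil
    have "okl [] \<and> EV [] = g (EV []) \<and> LM [] = \<kappa> * LM []"
      by (simp only: EV_simps assms(3) LM_simps okl_simps mult_zero_right simp_thms)
    thus ?case by blast
  next
    case (Cons x xs)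
    obtain u j z where x: "x = (u, j, z)" by (cases x)
    obtain ys where ys: "okl ys" "EV ys = g (EV xs)" "LM ys = \<kappa> * LM xs"
      using Cons by (auto simp: x)
    obtain u' j' z' where 1: "z' \<in> \<rho>" "lm z' = \<kappa> * lm z"
       "g (act (nn u) (act (T j) z)) = act (nn u') (act (T j') z')"
      using assms(2)[of z u j] Cons.prems by (auto simp: x)
    have "EV ((u', j', z') # ys) = g (EV (x # xs))" by (simp only: x EV_simps assms(4) 1(3) ys(2))
    moreover have "LM ((u', j', z') # ys) = \<kappa> * LM (x # xs)"
      by (simp only: x LM_simps 1(2) ys(3) distrib_left)
    moreover have "okl ((u', j', z') # ys)" using 1(1) ys(1) by simp
    ultimately show ?case by blast
  qed
  thus ?thesis using xs unfolding Rel_def by blast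
qed

lemma Rel_smf: assumes w: "Rel w c" shows "Rel (smf a w) (red a * c)"
proof (rule Rel_map[OF w, where \<kappa> = "red a" and g = "smf a"])
  fix u j z assume "z \<in> \<rho>"
  thus "\<exists>u' j' z'. z' \<in> \<rho> \<and> lm z' = red a * lm z \<and>
       smf a (act (nn u) (act (T j) z)) = act (nn u') (act (T j') z')"
    using S.subspace_scale[OF rho_sub] lm_smf
    by (intro exI[of _ u] exI[of _ j] exI[of _ "smf a z"]) (simp add: act_smf)
qed (simp_all add: S.scale_right_distrib)

lemma Rel_nn: "Rel w c \<Longrightarrow> Rel (act (nn a) w) c"
proof -
  assume w: "Rel w c"
  have "Rel (act (nn a) w) (1 * c)"
  proof (rule Rel_map[OF w, where g = "act (nn a)"])
    fix u j z assume "z \<in> \<rho>"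
    thus "\<exists>u' j' z'. z' \<in> \<rho> \<and> lm z' = 1 * lm z \<and>
       act (nn a) (act (nn u) (act (T j) z)) = act (nn u') (act (T j') z')"
      by (intro exI[of _ "a + u"] exI[of _ j] exI[of _ z]) (simp add: nn_nn)
  qed (simp_all add: act_add)
  thus ?thesis by simp
qed

lemma Rel_T: "Rel w c \<Longrightarrow> Rel (act (T i) w) c"
proof -
  assume w: "Rel w c"
  have "Rel (act (T i) w) (1 * c)"
  proof (rule Rel_map[OF w, where g = "act (T i)"])
    fix u j z assume "z \<in> \<rho>"
    thus "\<exists>u' j' z'. z' \<in> \<rho> \<and> lm z' = 1 * lm z \<and>
       act (T i) (act (nn u) (act (T j) z)) = act (nn u') (act (T j') z')"
      by (intro exI[of _ "uf powi i * u"] exI[of _ "i + j"] exI[of _ z]) (simp add: T_nn T_T)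
  qed (simp_all add: act_add)
  thus ?thesis by simp
qed

lemma Rel_dg: assumes w: "Rel w c" and ad: "ou a" "ou d" shows "Rel (act (dg a d) w) (red (\<psi> d a) * c)"
proof (rule Rel_map[OF w, where g = "act (dg a d)"])
  have ad': "a \<noteq> 0" "d \<noteq> 0" using ad by (auto simp: ou_def)
  fix u j z assume "z \<in> \<rho>"
  thus "\<exists>u' j' z'. z' \<in> \<rho> \<and> lm z' = red (\<psi> d a) * lm z \<and>
       act (dg a d) (act (nn u) (act (T j) z)) = act (nn u') (act (T j') z')"
    using lm_dg ad rho_act KK_gens(4)[OF ad]
    by (intro exI[of _ "a / d * u"] exI[of _ j] exI[of _ "act (dg a d) z"]) (simp add: dg_nn[OF ad'] dg_T[OF ad'])
qed (simp_all add: act_add)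

lemma Rel_Sg: "Rel w c \<Longrightarrow> w \<in> Sg" unfolding Rel_def using EV_Sg by blast

text \<open>Unipotents and powers of t keep the total, unit diagonal matrices and scalars multiply
  it. In particular a total 0 stays 0.\<close>

lemma Rel_Borel: assumes w: "Rel w c" and b: "b \<in> Borel" shows "\<exists>\<kappa>. Rel (act b w) (\<kappa> * c)"
proof -
  obtain \<alpha> \<beta> \<gamma> where b': "b = M2 \<alpha> \<beta> 0 \<gamma>" "\<alpha> \<noteq> 0" "\<gamma> \<noteq> 0" using b by (cases b) auto
  define j where "j = val (\<alpha> / \<gamma>)"
  define \<epsilon> where "\<epsilon> = \<alpha> / \<gamma> / uf powi j"
  have \<epsilon>: "ou \<epsilon>" using b' by (auto simp: \<epsilon>_def j_def ou_def val_divide val_mult)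
  have \<epsilon>0: "\<epsilon> \<noteq> 0" using \<epsilon> by (simp add: ou_def)
  have \<alpha>: "\<alpha> = \<gamma> * (uf powi j * \<epsilon>)" using b' by (simp add: \<epsilon>_def)
  have "b = m2mult (nn (\<beta> / \<gamma>)) (m2mult (T j) (m2mult (dg \<epsilon> 1) (scalar_m2 \<gamma>)))"
    unfolding b'(1) using b'(3) by (subst \<alpha>) (simp add: mdefs T_def mult_ac)
  hence "act b w = act (nn (\<beta> / \<gamma>)) (act (T j) (act (dg \<epsilon> 1) (act (scalar_m2 \<gamma>) w)))"
    using b' \<epsilon>0 by (simp add: act_mult)
  also have "act (scalar_m2 \<gamma>) w = smf (\<chi> \<gamma>) w" using b' Rel_Sg[OF w] by (intro central)
  finally have "act b w = act (nn (\<beta> / \<gamma>)) (act (T j) (act (dg \<epsilon> 1) (smf (\<chi> \<gamma>) w)))" .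
  moreover have "Rel (act (nn (\<beta> / \<gamma>)) (act (T j) (act (dg \<epsilon> 1) (smf (\<chi> \<gamma>) w)))) (red (\<psi> 1 \<epsilon>) * (red (\<chi> \<gamma>) * c))"
    by (intro Rel_nn Rel_T Rel_dg Rel_smf w \<epsilon> ou_1)
  ultimately show ?thesis by (metis mult.assoc)
qed

lemma Rel_rho: "z \<in> \<rho> \<Longrightarrow> Rel z (lm z)"
  unfolding Rel_def by (rule exI[of _ "[(0, 0, z)]"]) (simp add: rhoC)

text \<open>The \<open>card R\<close> translates in \<open>U w\<close> all carry the same total, and
  \<open>card R\<close> is 0 in characteristic p.\<close>

lemma Rel_U: "Rel w c \<Longrightarrow> Rel (U w) 0"
proof -
  assume w: "Rel w c"
  have "Rel (U w) (\<Sum>r\<in>R. c)" unfolding U_def by (intro Rel_sum fin_R Rel_nn Rel_T w)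
  thus ?thesis by (simp add: p_dvd_zero[OF p_dvd_card_R])
qed

lemma Rel_ss_U:
  assumes "kfix 1 w" "Rel w c" "Rel (act ss w) c'"
  shows "\<exists>c''. Rel (act ss (U w)) c''"
proof -
  have "\<exists>c. Rel (act (dg 1 uf) (act ss w)) c" using Rel_Borel[OF assms(3), of "dg 1 uf"] by auto
  then obtain c0 where c0: "Rel (act (dg 1 uf) (act ss w)) c0" by blast
  have "\<exists>c. Rel (act (nn (1 / r)) (act (dg (- 1 / r) r) (act (T 1) w))) c" if "r \<in> R - {0}" for r
  proof -
    have "dg (- 1 / r) r \<in> Borel" using that by simp
    thus ?thesis using Rel_Borel[OF Rel_T[OF assms(2)]] Rel_nn by blast
  qed
  then obtain cr where cr: "\<And>r. r \<in> R - {0} \<Longrightarrow> Rel (act (nn (1 / r)) (act (dg (- 1 / r) r) (act (T 1) w))) (cr r)"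
    by metis
  show ?thesis unfolding ss_U[OF assms(1)]
    by (rule exI, rule Rel_add[OF c0 Rel_sum[OF _ cr]]) auto
qed

text \<open>The vectors all of whose translates have total 0 form a G-stable subspace, which
  contains w by the Iwasawa decomposition and is therefore everything. But s v also has total 1, and
  the difference of the two expressions is a relation with total -1.\<close>

lemma Rel_zero_if:
  assumes w: "w \<in> A" "w \<noteq> 0" "Rel w 0" "Rel (act ss w) 0"
  shows "\<exists>c. c \<noteq> 0 \<and> Rel 0 c"
proof -
  define N where "N = {f \<in> Sg. \<forall>g\<in>GL2. Rel (act g f) 0}"
  have b0: "Rel (act b w') 0" if "Rel w' 0" "b \<in> Borel" for b w'
    using Rel_Borel[OF that] by simp
  have "Rel (act g w) 0" if "g \<in> GL2" for g
    using that
  proof (cases rule: Iwasawa)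
    case (big b u)
    have "M2 0 1 1 u = m2mult ss (nn u)" by (simp add: mdefs)
    hence "act g w = act b (act ss (act (nn u) w))" using big by (simp add: act_mult Borel_GL2)
    thus ?thesis using b0[OF w(4) big(1)] w(1) big(2) by (simp add: A_def nfix_def)
  next
    case (small b c)
    hence "act g w = act b (act (nb c) w)" by (simp add: act_mult Borel_GL2)
    thus ?thesis using b0[OF w(3) small(1)] w(1) small(2) kfix1_nb by (simp add: A_def)
  qed
  hence wN: "w \<in> N" using w by (auto simp: N_def A_def)
  have "N = {0} \<or> N = Sg"
  proof (rule irr)
    show "N \<subseteq> Sg" by (auto simp: N_def)
    show "S.subspace N"
    proof (rule S.subspaceI)
      show "0 \<in> N" using Sg0 Rel_0 by (simp only: N_def act_0 mem_Collect_eq) blast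
      show "x + y \<in> N" if "x \<in> N" "y \<in> N" for x y
        using that S.subspace_add[OF Sg_sub] Rel_add[of _ 0 _ 0] by (simp add: N_def act_add)
      show "smf a x \<in> N" if "x \<in> N" for a x
        using that S.subspace_scale[OF Sg_sub] Rel_smf[of _ 0 a] by (simp add: N_def act_smf)
    qed
    show "act g f \<in> N" if "g \<in> GL2" "f \<in> N" for g f
      using that Sg_act by (auto simp: N_def simp flip: act_mult)
  qed
  hence "N = Sg" using wN w(2) by blast
  moreover have "act ss v \<in> Sg" using rho_ss[OF v_rho] rho_Sg by blast
  ultimately have "act ss v \<in> N" by simp
  hence "Rel (act m2one (act ss v)) 0" unfolding N_def using m2one_GL2 by blast
  hence "Rel (act ss v) 0" using act_one[OF rhoC[OF rho_ss[OF v_rho]]] by simp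
  moreover have "Rel (smf (- 1) (act ss v)) (red (- 1) * 1)"
    using Rel_rho[OF rho_ss[OF v_rho]] by (intro Rel_smf) (simp add: lm_ssv)
  ultimately have "Rel (act ss v + smf (- 1) (act ss v)) (0 + red (- 1) * 1)" by (rule Rel_add)
  moreover have "act ss v + smf (- 1) (act ss v) = 0" by (simp only: S.scale_minus_left S.scale_one add.right_inverse)
  ultimately show ?thesis by (intro exI[of _ "- 1"]) simp
qed

text \<open>\<open>U v\<close> and \<open>U (U v)\<close> have total 0, and their images under s
  have totals c1 and c2. The combination c2 \<open>U v\<close> - c1 \<open>U (U v)\<close> cancels
  both kinds of totals; it is 0 or a case of \<open>Rel_zero_if\<close>. If c1 = 0, then
  \<open>U v\<close> alone serves, which avoids the zero polynomial.\<close>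

lemma torsion_or_relation:
  "(\<exists>q. q \<noteq> 0 \<and> evk smf U q v = 0) \<or> (\<exists>c. c \<noteq> 0 \<and> Rel 0 c)"
proof -
  note evs = evk_diff[OF module_smf A_sub kill_A lin_on_U v_A] evk_smult[OF module_smf A_sub kill_A lin_on_U v_A]
    evk_monom[OF module_smf A_sub kill_A lin_on_U v_A]
  have A1: "U v \<in> A" "U (U v) \<in> A" using v_A A_U by auto
  have kf: "kfix 1 v" "kfix 1 (U v)" using v_A A1 by (auto simp: A_def)
  have R1: "Rel (U v) 0" "Rel (U (U v)) 0" using Rel_U Rel_rho v_rho by blast+
  obtain c1 where c1: "Rel (act ss (U v)) c1"
    using Rel_ss_U[OF kf(1) Rel_rho[OF v_rho] Rel_rho[OF rho_ss[OF v_rho]]] by blast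
  obtain c2 where c2: "Rel (act ss (U (U v))) c2"
    using Rel_ss_U[OF kf(2) R1(1) c1] by blast
  show ?thesis
  proof (cases "c1 = 0")
    case True
    show ?thesis
    proof (cases "U v = 0")
      case True
      hence "evk smf U (monom 1 1) v = 0" using evs(3)[of 1] by simp
      moreover have "monom (1::'k) 1 \<noteq> 0" by simp
      ultimately show ?thesis by blast
    next
      case False
      thus ?thesis using Rel_zero_if[OF A1(1) False R1(1)] c1 True by blast
    qed
  next
    case False
    define q where "q = smult c2 (monom 1 1) - smult c1 (monom (1::'k) 2)"
    have "coeff q 2 \<noteq> 0" using False by (simp add: q_def)
    hence q0: "q \<noteq> 0" by auto
    define w where "w = evk smf U q v"
    have w: "w = smf (lift c2) (U v) - smf (lift c1) (U (U v))"
      unfolding w_def q_def evs by (simp add: numeral_2_eq_2)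
    have w': "w = smf (lift c2) (U v) + smf (- lift c1) (U (U v))"
      unfolding w by (simp only: S.scale_minus_left diff_conv_add_uminus)
    have "w \<in> A" unfolding w using A1 A_sub by (intro S.subspace_diff S.subspace_scale)
    moreover have "Rel w 0" unfolding w'
      using Rel_add[OF Rel_smf[OF R1(1)] Rel_smf[OF R1(2)], of "lift c2" "- lift c1"] by simp
    moreover have "Rel (act ss w) 0" unfolding w' act_add act_smf
      using Rel_add[OF Rel_smf[OF c1] Rel_smf[OF c2], of "lift c2" "- lift c1"] by (simp add: mult.commute)
    ultimately show ?thesis using Rel_zero_if[of w] q0 w_def by (cases "w = 0") auto
  qed
qed

end

lemma sum_single:
  fixes h :: "'i \<Rightarrow> 'b::comm_monoid_add"
  assumes "finite B" "b \<in> B" "\<And>x. x \<in> B \<Longrightarrow> x \<noteq> b \<Longrightarrow> h x = 0"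
  shows "sum h B = h b"
  using assms by (subst sum.remove[of B b]) (auto intro: sum.neutral)

context inv_line
begin

text \<open>\<open>Mf J\<close> models the formal sums of \<open>n(u) t\<^sup>j z\<close> with \<open>j \<le> J\<close>, \<open>u\<close> integral and
\<open>z\<close> in \<open>\<rho>\<close>; the last condition accounts for \<open>n(u + uf\<^sup>j a) t\<^sup>j z = n(u) t\<^sup>j n(a) z\<close>.
The translation-invariant elements are formal combinations of the \<open>U\<^sup>j v\<close>.\<close>

definition Mf :: "nat \<Rightarrow> (nat \<Rightarrow> 'f \<Rightarrow> 'f m2 \<Rightarrow> 'w) set" where
  "Mf J = {f. (\<forall>j u. f j u \<in> \<rho>) \<and> (\<forall>j u. J < j \<or> \<not> pw 0 u \<longrightarrow> f j u = 0) \<and>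
     (\<forall>j u a. j \<le> J \<longrightarrow> pw 0 u \<longrightarrow> pw 0 a \<longrightarrow> f j (u + uf ^ j * a) = act (nn (- a)) (f j u))}"

definition ER :: "nat \<Rightarrow> (nat \<Rightarrow> 'f \<Rightarrow> 'f m2 \<Rightarrow> 'w) \<Rightarrow> 'f m2 \<Rightarrow> 'w" where
  "ER J f = (\<Sum>j\<le>J. \<Sum>u\<in>RR j. act (nn u) (act (T (int j)) (f j u)))"

definition LR :: "nat \<Rightarrow> (nat \<Rightarrow> 'f \<Rightarrow> 'f m2 \<Rightarrow> 'w) \<Rightarrow> 'k" where
  "LR J f = (\<Sum>j\<le>J. \<Sum>u\<in>RR j. lm (f j u))"

definition smM :: "'o \<Rightarrow> (nat \<Rightarrow> 'f \<Rightarrow> 'f m2 \<Rightarrow> 'w) \<Rightarrow> nat \<Rightarrow> 'f \<Rightarrow> 'f m2 \<Rightarrow> 'w" where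
  "smM a f = (\<lambda>j u. smf a (f j u))"

lemma module_smM: "module smM"
  by unfold_locales
    (simp_all add: smM_def fun_eq_iff smf_def W.scale_right_distrib W.scale_left_distrib)

lemma Mf_plus: "(f + g) j u = f j u + g j u" for f g :: "nat \<Rightarrow> 'f \<Rightarrow> 'f m2 \<Rightarrow> 'w"
  by simp

lemma lm_0: "lm 0 = 0" using lm_smf[OF rho_0, of 0] by simp

lemma MfI:
  assumes "\<And>j u. f j u \<in> \<rho>" "\<And>j u. J < j \<or> \<not> pw 0 u \<Longrightarrow> f j u = 0"
    "\<And>j u a. j \<le> J \<Longrightarrow> pw 0 u \<Longrightarrow> pw 0 a \<Longrightarrow> f j (u + uf ^ j * a) = act (nn (- a)) (f j u)"
  shows "f \<in> Mf J"
  using assms unfolding Mf_def by blast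

lemma MfD:
  assumes "f \<in> Mf J"
  shows "f j u \<in> \<rho>" "J < j \<or> \<not> pw 0 u \<Longrightarrow> f j u = 0"
    "j \<le> J \<Longrightarrow> pw 0 u \<Longrightarrow> pw 0 a \<Longrightarrow> f j (u + uf ^ j * a) = act (nn (- a)) (f j u)"
  using assms unfolding Mf_def by blast+

lemma Mf_sub: "module.subspace smM (Mf J)"
proof -
  interpret M: module smM by (rule module_smM)
  show ?thesis
  proof (rule M.subspaceI)
    show "0 \<in> Mf J" by (rule MfI) (simp_all add: rho_0 zero_fun_def[symmetric])
    show "f + g \<in> Mf J" if f: "f \<in> Mf J" and g: "g \<in> Mf J" for f g
    proof (rule MfI)
      show "(f + g) j u \<in> \<rho>" for j u
        unfolding Mf_plus by (rule S.subspace_add[OF rho_sub MfD(1)[OF f] MfD(1)[OF g]])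
      show "(f + g) j u = 0" if "J < j \<or> \<not> pw 0 u" for j u
        unfolding Mf_plus MfD(2)[OF f that] MfD(2)[OF g that] by (rule add_0_left)
      show "(f + g) j (u + uf ^ j * a) = act (nn (- a)) ((f + g) j u)" if "j \<le> J" "pw 0 u" "pw 0 a" for j u a
        unfolding Mf_plus MfD(3)[OF f that] MfD(3)[OF g that] by (rule act_add[symmetric])
    qed
    show "smM c f \<in> Mf J" if f: "f \<in> Mf J" for c f
    proof (rule MfI)
      show "smM c f j u \<in> \<rho>" for j u
        unfolding smM_def by (rule S.subspace_scale[OF rho_sub MfD(1)[OF f]])
      show "smM c f j u = 0" if "J < j \<or> \<not> pw 0 u" for j u
        unfolding smM_def MfD(2)[OF f that] by (rule S.scale_zero_right)
      show "smM c f j (u + uf ^ j * a) = act (nn (- a)) (smM c f j u)" if "j \<le> J" "pw 0 u" "pw 0 a" for j u a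
        unfolding smM_def MfD(3)[OF f that] by (rule act_smf[symmetric])
    qed
  qed
qed

lemma ER_add: "ER J (f + g) = ER J f + ER J g"
  unfolding ER_def Mf_plus act_add sum.distrib ..

lemma ER_smM: "ER J (smM a f) = smf a (ER J f)"
  unfolding ER_def smM_def act_smf S.scale_sum_right ..

lemma LR_add: "f \<in> Mf J \<Longrightarrow> g \<in> Mf J \<Longrightarrow> LR J (f + g) = LR J f + LR J g"
  unfolding LR_def Mf_plus by (simp add: lm_add MfD(1) sum.distrib)

text \<open>One translate corresponds to a function supported on the coset u' + p^j0, with values
  there dictated by the compatibility condition.\<close>

lemma ex_single:
  assumes "pw 0 u'" "j0 \<le> J" "z \<in> \<rho>"
  shows "\<exists>f\<in>Mf J. ER J f = act (nn u') (act (T (int j0)) z) \<and> LR J f = lm z"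
proof -
  define f where "f j u = (if j = j0 \<and> pw 0 u \<and> pw (int j0) (u' - u) then act (nn ((u' - u) / uf ^ j0)) z else 0)" for j u
  have o: "pw 0 ((u' - u) / uf ^ j0)" if "pw (int j0) (u' - u)" for u
    using that pw_Suc_uf by blast
  have fM: "f \<in> Mf J"
  proof (rule MfI)
    show "f j u \<in> \<rho>" for j u
      using o rho_nn[OF _ assms(3)] rho_0 unfolding f_def by (cases "j = j0 \<and> pw 0 u \<and> pw (int j0) (u' - u)") simp_all
    show "f j u = 0" if "J < j \<or> \<not> pw 0 u" for j u
      using that assms(2) unfolding f_def by auto
    fix j u a assume 1: "j \<le> J" "pw 0 u" "pw 0 a"
    show "f j (u + uf ^ j * a) = act (nn (- a)) (f j u)"
    proof (cases "j = j0")
      case False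
      thus ?thesis unfolding f_def by (simp only: simp_thms if_False act_0)
    next
      case True
      have ua: "pw (int j0) (uf ^ j0 * a)" using 1 by (simp add: pw_mult_iff)
      have "pw (int j0) (u' - (u + uf ^ j0 * a)) \<longleftrightarrow> pw (int j0) (u' - u)"
        using pw_diff[OF _ ua, of "u' - u"] pw_add[OF _ ua, of "u' - (u + uf ^ j0 * a)"]
        by (auto simp: algebra_simps)
      moreover have "pw 0 (u + uf ^ j0 * a)" using 1 pw_mono[OF ua, of 0] by (simp add: pw_add)
      moreover have "(u' - (u + uf ^ j0 * a)) / uf ^ j0 = - a + (u' - u) / uf ^ j0" by (simp add: field_simps)
      ultimately show ?thesis unfolding f_def using True 1
        by (cases "pw (int j0) (u' - u)") (simp_all only: simp_thms if_True if_False act_0 nn_nn)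
    qed
  qed
  obtain r where r: "r \<in> RR j0" "pw (int j0) (u' - r)" using transv_rep[OF transv_RR assms(1), of j0] by blast
  have fr: "f j0 r = act (nn ((u' - r) / uf ^ j0)) z" unfolding f_def using r RR_pw by (simp only: simp_thms if_True)
  have f0: "f j u = 0" if "j \<noteq> j0 \<or> (u \<in> RR j0 \<and> u \<noteq> r)" for j u
    using that transv_unique[OF transv_RR _ r(1) _ r(2)] unfolding f_def by auto
  have "ER J f = (\<Sum>u\<in>RR j0. act (nn u) (act (T (int j0)) (f j0 u)))"
    unfolding ER_def by (rule sum_single) (use assms(2) f0 in \<open>auto intro!: sum.neutral\<close>)
  also have "\<dots> = act (nn r) (act (T (int j0)) (f j0 r))"
    by (rule sum_single) (use r f0 in auto)
  also have "\<dots> = act (nn u') (act (T (int j0)) z)" unfolding fr T_nn nn_nn by simp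
  finally have 1: "ER J f = act (nn u') (act (T (int j0)) z)" .
  have "LR J f = (\<Sum>u\<in>RR j0. lm (f j0 u))"
    unfolding LR_def by (rule sum_single) (use assms(2) f0 lm_0 in \<open>auto intro!: sum.neutral\<close>)
  also have "\<dots> = lm (f j0 r)" by (rule sum_single) (use r f0 lm_0 in auto)
  also have "\<dots> = lm z" unfolding fr using o[OF r(2)] assms(3) by (intro lm_nn)
  finally show ?thesis using fM 1 by blast
qed

lemma ex_formal:
  assumes "\<forall>(u, j, z)\<in>set xs. z \<in> \<rho> \<and> pw 0 u \<and> 0 \<le> j \<and> j \<le> int J"
  shows "\<exists>f\<in>Mf J. ER J f = EV xs \<and> LR J f = LM xs"
  using assms
proof (induction xs)
  case Nil
  have "(0 :: nat \<Rightarrow> 'f \<Rightarrow> 'f m2 \<Rightarrow> 'w) \<in> Mf J"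
    using module.subspace_0[OF module_smM Mf_sub] .
  moreover have "ER J 0 = 0" unfolding ER_def zero_fun_apply act_0 sum.neutral_const ..
  moreover have "LR J 0 = 0" unfolding LR_def zero_fun_apply lm_0 sum.neutral_const ..
  ultimately show ?case by (intro bexI[of _ 0]) (simp_all only: EV_simps LM_simps simp_thms)
next
  case (Cons x xs)
  obtain u j z where x: "x = (u, j, z)" by (cases x)
  obtain f where f: "f \<in> Mf J" "ER J f = EV xs" "LR J f = LM xs" using Cons by auto
  obtain g where g: "g \<in> Mf J" "ER J g = act (nn u) (act (T j) z)" "LR J g = lm z"
  proof -
    have "z \<in> \<rho>" "pw 0 u" "0 \<le> j" "nat j \<le> J" using Cons.prems by (auto simp: x)
    thus ?thesis using ex_single[of u "nat j" J z] that by auto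
  qed
  have "f + g \<in> Mf J" by (rule module.subspace_add[OF module_smM Mf_sub f(1) g(1)])
  moreover have "ER J (g + f) = EV (x # xs)" unfolding ER_add f g x EV_simps ..
  moreover have "LR J (g + f) = LM (x # xs)" unfolding LR_add[OF g(1) f(1)] f g x LM_simps ..
  ultimately show ?case by (metis add.commute)
qed

lemma EV_shift: "EV (map (\<lambda>(u, j, z). (uf powi N * u, N + j, z)) xs) = act (T N) (EV xs)"
proof (induction xs)
  case Nil
  show ?case by (simp only: list.map EV_simps act_0)
next
  case (Cons x xs)
  show ?case by (cases x) (simp only: list.map EV_simps Cons.IH act_add T_nn T_T prod.case)
qed

lemma Mf_translate:
  assumes f: "f \<in> Mf J" and c: "pw 0 c"
  shows "(\<lambda>j u. f j (u + c)) \<in> Mf J" "ER J (\<lambda>j u. f j (u + c)) = act (nn (- c)) (ER J f)"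
proof -
  have iff: "pw 0 (u + c) \<longleftrightarrow> pw 0 u" for u using pw_add[of 0 u c] pw_diff[of 0 "u + c" c] c by auto
  show "(\<lambda>j u. f j (u + c)) \<in> Mf J"
  proof (rule MfI)
    show "f j (u + c) \<in> \<rho>" for j u by (rule MfD(1)[OF f])
    show "f j (u + c) = 0" if "J < j \<or> \<not> pw 0 u" for j u using MfD(2)[OF f] that iff by blast
    show "f j (u + uf ^ j * a + c) = act (nn (- a)) (f j (u + c))" if "j \<le> J" "pw 0 u" "pw 0 a" for j u a
    proof -
      have "f j (u + c + uf ^ j * a) = act (nn (- a)) (f j (u + c))"
        by (rule MfD(3)[OF f that(1)]) (use that iff in auto)
      moreover have "u + c + uf ^ j * a = u + uf ^ j * a + c" by (simp add: add_ac)
      ultimately show ?thesis by simp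
    qed
  qed
  have cong: "act (nn u) (act (T (int j)) (f j u)) = act (nn u') (act (T (int j)) (f j u'))"
    if j: "j \<le> J" and u: "pw 0 u" "pw 0 u'" "pw (int j) (u - u')" for j u u'
  proof -
    define a where "a = (u - u') / uf ^ j"
    have a: "pw 0 a" unfolding a_def using u(3) pw_Suc_uf by blast
    have uu: "u = u' + uf ^ j * a" by (simp add: a_def)
    have "f j u = act (nn (- a)) (f j u')" unfolding uu by (rule MfD(3)[OF f j u(2) a])
    hence "act (nn u) (act (T (int j)) (f j u)) = act (nn (u - uf ^ j * a)) (act (T (int j)) (f j u'))"
      by (simp add: T_nn nn_nn)
    also have "u - uf ^ j * a = u'" using uu by simp
    finally show ?thesis .
  qed
  have 1: "(\<Sum>u\<in>RR j. act (nn u) (act (T (int j)) (f j (u + c)))) =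
      act (nn (- c)) (\<Sum>u\<in>RR j. act (nn u) (act (T (int j)) (f j u)))" if "j \<le> J" for j
  proof -
    have "(\<Sum>u\<in>RR j. act (nn u) (act (T (int j)) (f j (u + c)))) =
      act (nn (- c)) (\<Sum>u\<in>RR j. act (nn (u + c)) (act (T (int j)) (f j (u + c))))"
      by (simp add: act_sum nn_nn)
    also have "(\<Sum>u\<in>RR j. act (nn (u + c)) (act (T (int j)) (f j (u + c)))) =
      (\<Sum>u\<in>RR j. act (nn u) (act (T (int j)) (f j u)))"
      by (rule sum_transv_shift[OF transv_RR c, where g = "\<lambda>u. act (nn u) (act (T (int j)) (f j u))"])
        (rule cong[OF that])
    finally show ?thesis .
  qed
  show "ER J (\<lambda>j u. f j (u + c)) = act (nn (- c)) (ER J f)"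
    unfolding ER_def act_sum[of _ _ "{..J}"] by (rule sum.cong[OF refl]) (rule 1, simp)
qed

text \<open>At depth j the shift becomes n(a) with a in p, which fixes the level-one type. So
  integral translations act on \<open>Mf J\<close> through the finite group o/p^(J+1).\<close>

lemma translate_small:
  assumes f: "f \<in> Mf J" and c: "pw (int (Suc J)) c"
  shows "f j (u + c) = f j u"
proof (cases "j \<le> J \<and> pw 0 u")
  case True
  define a where "a = c / uf ^ j"
  have "pw (int (Suc J) - int j) a" unfolding a_def using pw_divide[of "uf ^ j", OF _ c] by simp
  hence a: "pw 1 a" by (rule pw_mono) (use True in auto)
  have "f j (u + uf ^ j * a) = act (nn (- a)) (f j u)"
    by (rule MfD(3)[OF f]) (use True pw_mono[OF a, of 0] in auto)
  also have "\<dots> = f j u"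
    using rho_kfix[OF MfD(1)[OF f]] nn_Kcong[of 1 "- a"] a by (simp add: kfix_def)
  finally show ?thesis by (simp add: a_def)
next
  case False
  have "pw 0 c" using c by (rule pw_mono) simp
  hence "pw 0 (u + c) \<longleftrightarrow> pw 0 u" using pw_add[of 0 u c] pw_diff[of 0 "u + c" c] by auto
  thus ?thesis using False MfD(2)[OF f, of j u] MfD(2)[OF f, of j "u + c"] by auto
qed

text \<open>A nonzero total means that the formal combination is nonzero although its value is 0.
  The kernel of evaluation is stable under integral translations, hence has a nonzero invariant
  element; at depth j this is the constant b j times v, with value b j times U^j v.\<close>

lemma relation_torsion:
  assumes c: "c \<noteq> 0" "Rel 0 c"
  shows "\<exists>q. q \<noteq> 0 \<and> evk smf U q v = 0"
proof -
  interpret M: module smM by (rule module_smM)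
  obtain xs where xs: "okl xs" "EV xs = 0" "LM xs = c" using c(2) by (auto simp: Rel_def)
  have "\<exists>N. \<forall>x\<in>set xs. (case x of (u, j, z) \<Rightarrow> max (nat (- val u)) (nat (- j))) \<le> N"
    by (rule exI[of _ "Max ((\<lambda>x. case x of (u, j, z) \<Rightarrow> max (nat (- val u)) (nat (- j))) ` set xs)"]) simp
  then obtain N where N: "\<And>u j z. (u, j, z) \<in> set xs \<Longrightarrow> max (nat (- val u)) (nat (- j)) \<le> N" by fastforce
  \<comment> \<open>Applying t^N makes all unipotent entries integral and all exponents nonnegative,
    as \<open>Mf\<close> demands.\<close>
  define ys where "ys = map (\<lambda>(u, j, z). (uf powi int N * u, int N + j, z)) xs"
  have "\<exists>J. \<forall>y\<in>set ys. (case y of (u, j, z) \<Rightarrow> nat j) \<le> J"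
    by (rule exI[of _ "Max ((\<lambda>y. case y of (u, j, z) \<Rightarrow> nat j) ` set ys)"]) simp
  then obtain J where J: "\<And>u j z. (u, j, z) \<in> set ys \<Longrightarrow> nat j \<le> J" by fastforce
  have EVys: "EV ys = 0" unfolding ys_def EV_shift xs(2) by (rule act_0)
  have LMys: "LM ys = c" unfolding xs(3)[symmetric] LM_def ys_def by (simp add: case_prod_unfold comp_def)
  have ys_ok: "\<forall>(u, j, z)\<in>set ys. z \<in> \<rho> \<and> pw 0 u \<and> 0 \<le> j \<and> j \<le> int J"
  proof (clarify)
    fix u j z assume m: "(u, j, z) \<in> set ys"
    then obtain u0 j0 where 0: "(u0, j0, z) \<in> set xs" "u = uf powi int N * u0" "j = int N + j0"
      by (auto simp: ys_def)
    have "z \<in> \<rho>" using xs(1) 0(1) by (auto simp: okl_def)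
    moreover have "0 \<le> j" using N[OF 0(1)] 0(3) by linarith
    moreover have "j \<le> int J" using J[OF m] by simp
    moreover have "pw 0 u"
    proof (cases "u0 = 0")
      case False
      have "val u = int N + val u0" using False 0(2) by (simp add: val_mult)
      hence "0 \<le> val u" using N[OF 0(1)] by linarith
      thus ?thesis by (simp add: in_pow_def)
    qed (simp add: 0(2))
    ultimately show "z \<in> \<rho> \<and> pw 0 u \<and> 0 \<le> j \<and> j \<le> int J" by blast
  qed
  obtain f0 where f0: "f0 \<in> Mf J" "ER J f0 = 0" "LR J f0 = c"
    using ex_formal[OF ys_ok] unfolding EVys LMys by blast
  define Ker where "Ker = {f \<in> Mf J. ER J f = 0}"
  have f0nz: "f0 \<noteq> 0"
  proof
    assume "f0 = 0"
    hence "LR J f0 = 0" by (simp add: LR_def lm_0)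
    thus False using f0(3) c(1) by simp
  qed
  have Ksub: "M.subspace Ker"
  proof (rule M.subspaceI)
    show "0 \<in> Ker" using M.subspace_0[OF Mf_sub] by (simp add: Ker_def ER_def)
    show "f + g \<in> Ker" if "f \<in> Ker" "g \<in> Ker" for f g
    proof -
      have fg: "f \<in> Mf J" "g \<in> Mf J" "ER J f = 0" "ER J g = 0" using that by (simp_all only: Ker_def mem_Collect_eq)
      have "ER J (f + g) = 0" unfolding ER_add fg by (rule add_0_left)
      thus ?thesis unfolding Ker_def using M.subspace_add[OF Mf_sub fg(1,2)] by blast
    qed
    show "smM a f \<in> Ker" if "f \<in> Ker" for a f
    proof -
      have fg: "f \<in> Mf J" "ER J f = 0" using that by (simp_all only: Ker_def mem_Collect_eq)
      have "ER J (smM a f) = 0" unfolding ER_smM fg by (rule S.scale_zero_right)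
      thus ?thesis unfolding Ker_def using M.subspace_scale[OF Mf_sub fg(1)] by blast
    qed
  qed
  define tr where "tr c f = (\<lambda>(j::nat) u. f j (u + c))" for c :: 'f and f :: "nat \<Rightarrow> 'f \<Rightarrow> 'f m2 \<Rightarrow> 'w"
  have trK: "tr c f \<in> Ker" if "pw 0 c" "f \<in> Ker" for c f
  proof -
    have fg: "f \<in> Mf J" "ER J f = 0" using that(2) by (simp_all only: Ker_def mem_Collect_eq)
    show ?thesis unfolding Ker_def tr_def
      using Mf_translate[OF fg(1) that(1)] fg(2) by (simp only: mem_Collect_eq act_0 simp_thms)
  qed
  have tr_pow: "(tr c ^^ i) f = tr (of_nat i * c) f" for c i f
    by (induction i) (simp_all add: tr_def algebra_simps)
  have "\<exists>f\<in>Ker. f \<noteq> 0 \<and> (\<forall>g\<in>tr ` RR (Suc J). g f = f)"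
  proof (rule p_power_fixed_vector[OF module_smM, where e = "Suc J"])
    show "finite (tr ` RR (Suc J))" by (rule finite_imageI[OF fin_RR])
    show "M.subspace Ker" by (rule Ksub)
    show "kill smM Ker" unfolding kill_def
    proof
      fix f assume "f \<in> Ker"
      hence "f \<in> Mf J" by (simp add: Ker_def)
      hence "smf uE (f j u) = 0" for j u using rho_kill MfD(1) by blast
      thus "smM uE f = 0" by (simp add: smM_def fun_eq_iff)
    qed
    show "Ker \<noteq> {0}" using f0 f0nz by (auto simp: Ker_def)
    show "lin_on smM Ker g" if g: "g \<in> tr ` RR (Suc J)" for g
    proof -
      obtain d where d: "d \<in> RR (Suc J)" "g = tr d" using g by blast
      have "tr d (f + f') = tr d f + tr d f'" "tr d (smM a f) = smM a (tr d f)" for f f' a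
        by (simp_all add: tr_def smM_def fun_eq_iff)
      thus ?thesis using trK[OF RR_pw[OF d(1)]] by (simp only: lin_on_def d(2)) blast
    qed
    show "g (h x) = h (g x)" if gh: "g \<in> tr ` RR (Suc J)" "h \<in> tr ` RR (Suc J)" for g h x
    proof -
      obtain d d' where "g = tr d" "h = tr d'" using gh by blast
      thus ?thesis by (simp add: tr_def add_ac)
    qed
    fix g f assume "g \<in> tr ` RR (Suc J)" and f: "f \<in> Ker"
    then obtain d where d: "d \<in> RR (Suc J)" "g = tr d" by blast
    have fM: "f \<in> Mf J" using f by (simp add: Ker_def)
    have "pw (int (Suc J)) (of_nat (p ^ Suc J) * d)"
      using pw_mult_o'[OF pw_of_nat_pow RR_pw[OF d(1)]] .
    from translate_small[OF fM this] show "(g ^^ (p ^ Suc J)) f = f"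
      unfolding d(2) tr_pow by (intro ext) (simp only: tr_def)
  qed
  then obtain f where f: "f \<in> Ker" "f \<noteq> 0" "\<And>d. d \<in> RR (Suc J) \<Longrightarrow> tr d f = f" by blast
  have fM: "f \<in> Mf J" and ERf: "ER J f = 0" using f(1) by (simp_all add: Ker_def)
  have inv: "f j (u + d) = f j u" if d: "pw 0 d" for j u d
  proof -
    obtain r where r: "r \<in> RR (Suc J)" "pw (int (Suc J)) (d - r)" using transv_rep[OF transv_RR d] by blast
    have "f j (u + d) = f j ((u + r) + (d - r))" by simp
    also have "\<dots> = f j (u + r)" by (rule translate_small[OF fM r(2)])
    also have "\<dots> = tr r f j u" by (simp only: tr_def)
    also have "\<dots> = f j u" by (simp only: f(3)[OF r(1)])
    finally show ?thesis .
  qed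
  have const: "f j u = f j 0" if "pw 0 u" for j u using inv[OF that, of j 0] by simp
  have nf: "nfix (f j 0)" if j: "j \<le> J" for j unfolding nfix_def
  proof (intro allI impI)
    fix a assume a: "pw 0 a"
    have "f j (0 + uf ^ j * (- a)) = act (nn (- (- a))) (f j 0)"
      by (rule MfD(3)[OF fM j]) (use a in auto)
    moreover have "pw 0 (uf ^ j * (- a))" using a by (intro pw_mult_o) (auto simp: in_pow_def)
    ultimately show "act (nn a) (f j 0) = f j 0" using const[of "uf ^ j * (- a)" j] by simp
  qed
  define b where "b j = lm (act ss (f j 0))" for j
  have fj: "f j 0 = smf (lift (b j)) v" if "j \<le> J" for j
    unfolding b_def by (rule line[OF MfD(1)[OF fM] nf[OF that]])
  define q where "q = (\<Sum>j\<le>J. smult (b j) (monom (1::'k) j))"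
  have vC: "v \<in> C" by (rule rhoC[OF v_rho])
  have "evk smf U q v = (\<Sum>j\<le>J. smf (lift (b j)) ((U ^^ j) v))"
    unfolding q_def by (rule evk_sum_monom[OF module_smf A_sub kill_A lin_on_U v_A]) simp
  also have "\<dots> = ER J f" unfolding ER_def
  proof (rule sum.cong[OF refl])
    fix j assume "j \<in> {..J}"
    hence j: "j \<le> J" by simp
    have "(\<Sum>u\<in>RR j. act (nn u) (act (T (int j)) (f j u))) =
      (\<Sum>u\<in>RR j. smf (lift (b j)) (act (nn u) (act (T (int j)) v)))"
      by (rule sum.cong[OF refl]) (simp only: const[OF RR_pw] fj[OF j] act_smf)
    thus "smf (lift (b j)) ((U ^^ j) v) = (\<Sum>u\<in>RR j. act (nn u) (act (T (int j)) (f j u)))"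
      by (simp only: U_pow[OF vC] S.scale_sum_right)
  qed
  finally have ev0: "evk smf U q v = 0" using ERf by (simp only:)
  have "q \<noteq> 0"
  proof
    assume q0: "q = 0"
    have b0: "b j = 0" if "j \<le> J" for j
    proof -
      have "coeff q j = (\<Sum>i\<le>J. if i = j then b i else 0)"
        unfolding q_def coeff_sum by (rule sum.cong) auto
      thus ?thesis using that q0 by simp
    qed
    have "f j u = 0" for j u
    proof (cases "j \<le> J \<and> pw 0 u")
      case True
      have "f j u = smf (lift 0) v" using const[of u j] fj[of j] b0[of j] True by simp
      also have "\<dots> = smf 0 v" by (rule sc_cong[OF module_smf rho_kill[OF v_rho]]) simp
      finally show ?thesis by (simp only: S.scale_zero_left)
    next
      case False
      thus ?thesis using MfD(2)[OF fM, of j u] by auto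
    qed
    hence "f = 0" by (intro ext) (simp only: zero_fun_apply)
    thus False using f(2) by blast
  qed
  thus ?thesis using ev0 by blast
qed

lemma torsion: "\<exists>q. q \<noteq> 0 \<and> evk smf U q v = 0"
  using torsion_or_relation relation_torsion by blast

end

section \<open>An eigenvector with nonzero Hecke eigenvalue\<close>

context smooth_mod
begin

text \<open>The bound is p^(1-n), so that n = 1 means support in o, where the contraction by
  \<open>U\<close> comes to rest.\<close>

definition Vs :: "nat \<Rightarrow> ('f m2 \<Rightarrow> 'w) set" where
  "Vs n = {f \<in> C. \<forall>u. FF f u \<noteq> 0 \<longrightarrow> pw (1 - int n) u}"

lemma FF_T: "f \<in> C \<Longrightarrow> FF (act (T j) f) u = th j (FF f (u / uf powi j))"
  using FF_dg[of f "uf powi j" 1 u] by (simp add: T_def th_def)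

end

context sigma_kill
begin

lemma FF_nn_T: "f \<in> Sg \<Longrightarrow> FF (act (nn r) (act (T j) f)) u = th j (FF f ((u + r) / uf powi j))"
proof -
  assume f: "f \<in> Sg"
  have "act (T j) f \<in> C" using f by (intro SgC Sg_act T_GL2)
  thus ?thesis using FF_T[OF SgC[OF f]] by (simp add: FF_nn)
qed

text \<open>t multiplies the support by uf and n(r) shifts it by an integer, so it shrinks by one
  step until it lies in o; hence the maximum with 1.\<close>

lemma Vs_nn_T:
  assumes f: "f \<in> Sg" "f \<in> Vs n" and r: "pw 0 r" and n: "1 \<le> n"
  shows "act (nn r) (act (T 1) f) \<in> Vs (max 1 (n - 1))"
proof -
  have "pw (1 - int (max 1 (n - 1))) u" if "FF (act (nn r) (act (T 1) f)) u \<noteq> 0" for u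
  proof -
    have "FF f ((u + r) / uf) \<noteq> 0" using that FF_nn_T[OF f(1), of r 1 u] by (auto simp: th_eq_0)
    hence "pw (1 - int n) ((u + r) / uf)" using f(2) by (simp add: Vs_def)
    hence "pw (2 - int n) (u + r)" by (simp add: pw_divide_iff)
    hence "pw (1 - int (max 1 (n - 1))) (u + r)" by (rule pw_mono) (use n in \<open>auto simp: max_def\<close>)
    moreover have "pw (1 - int (max 1 (n - 1))) r" using r by (rule pw_mono) simp
    ultimately show ?thesis using pw_diff[of _ "u + r" r] by simp
  qed
  moreover have "act (nn r) (act (T 1) f) \<in> C" by (intro SgC Sg_act f(1)) simp_all
  ultimately show ?thesis by (simp add: Vs_def)
qed

lemma Vs_sub: "S.subspace (Sg \<inter> Vs n)"
proof (rule S.subspaceI)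
  show "0 \<in> Sg \<inter> Vs n" using Sg0 by (simp add: Vs_def)
  show "f + g \<in> Sg \<inter> Vs n" if "f \<in> Sg \<inter> Vs n" "g \<in> Sg \<inter> Vs n" for f g
  proof -
    have "f + g \<in> Sg" using that S.subspace_add[OF Sg_sub] by blast
    moreover have "pw (1 - int n) u" if "FF f u + FF g u \<noteq> 0" for u
      using that \<open>f \<in> Sg \<inter> Vs n\<close> \<open>g \<in> Sg \<inter> Vs n\<close> by (cases "FF f u = 0") (auto simp: Vs_def)
    ultimately show ?thesis using SgC[of "f + g"] by (simp add: Vs_def FF_add)
  qed
  show "smf c f \<in> Sg \<inter> Vs n" if "f \<in> Sg \<inter> Vs n" for c f
  proof -
    have "smf c f \<in> Sg" using that S.subspace_scale[OF Sg_sub] by blast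
    moreover have "pw (1 - int n) u" if "sm c (FF f u) \<noteq> 0" for u
      using that \<open>f \<in> Sg \<inter> Vs n\<close> by (cases "FF f u = 0") (auto simp: Vs_def)
    ultimately show ?thesis using SgC[of "smf c f"] by (simp add: Vs_def FF_smf)
  qed
qed

lemma Vs_U: assumes f: "f \<in> Sg" "f \<in> Vs n" and n: "1 \<le> n" shows "U f \<in> Sg \<inter> Vs (max 1 (n - 1))"
  unfolding U_def
  by (rule S.subspace_sum[OF Vs_sub]) (use Vs_nn_T[OF f R_pw n] f(1) Sg_act in auto)

lemma Vs_mono: "f \<in> Vs n \<Longrightarrow> n \<le> m \<Longrightarrow> f \<in> Vs m"
  unfolding Vs_def by (auto intro: pw_mono)

definition Teig :: "('f \<Rightarrow> 'f \<Rightarrow> 'o) \<Rightarrow> ('f m2 \<Rightarrow> 'w) \<Rightarrow> bool" where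
  "Teig \<psi> f \<longleftrightarrow> (\<forall>a d. ou a \<longrightarrow> ou d \<longrightarrow> act (dg a d) f = smf (\<psi> a d) f)"

definition Kfg :: "('f m2 \<Rightarrow> 'w) set \<Rightarrow> bool" where
  "Kfg Z \<longleftrightarrow> (\<exists>E. finite E \<and> Z = S.span E) \<and> Kst Z \<and> Z \<subseteq> Sg \<and> (\<forall>z\<in>Z. kfix 1 z) \<and> Z \<noteq> {0}"

text \<open>The polynomial killing v is applied inside the subspace \<open>Y\<close> cut out by the
  support bound and the torus character. \<open>U\<close> preserves both, so the eigenvector keeps
  them.\<close>

lemma ex_U_eigenvector:
  assumes Z: "Kfg Z" "Z \<subseteq> Vs n" and n: "1 \<le> n"
  shows "\<exists>y a \<psi>. y \<in> A \<and> y \<noteq> 0 \<and> y \<in> Vs n \<and> U y = smf a y \<and> Teig \<psi> y"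
proof -
  obtain E where E: "finite E" "Z = S.span E" using Z by (auto simp: Kfg_def)
  have Z': "Kst Z" "Z \<subseteq> Sg" "\<And>z. z \<in> Z \<Longrightarrow> kfix 1 z" "Z \<noteq> {0}" using Z by (auto simp: Kfg_def)
  obtain \<rho> where \<rho>: "\<rho> \<subseteq> Z" "S.subspace \<rho>" "Kst \<rho>" "\<rho> \<noteq> {0}"
    "\<And>V. V \<subseteq> \<rho> \<Longrightarrow> S.subspace V \<Longrightarrow> Kst V \<Longrightarrow> V = {0} \<or> V = \<rho>"
    using ex_irreducible[OF E(1)] Z' unfolding E(2)[symmetric] by blast
  interpret irr_rep val uf p uE red sm ac Sg \<chi> \<rho>
    by unfold_locales (use \<rho> Z' in blast)+
  obtain \<psi> v lm where v: "weight \<psi> v" "\<forall>z\<in>\<rho>. \<forall>z'\<in>\<rho>. lm (z + z') = lm z + lm z'"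
     "\<forall>a. \<forall>z\<in>\<rho>. lm (smf a z) = red a * lm z"
     "\<forall>u. \<forall>z\<in>\<rho>. pw 0 u \<longrightarrow> lm (act (nn u) z) = lm z"
     "\<forall>a d. \<forall>z\<in>\<rho>. ou a \<longrightarrow> ou d \<longrightarrow> lm (act (dg a d) z) = red (\<psi> d a) * lm z"
     "lm (act ss v) = 1" "\<forall>y\<in>\<rho>. nfix y \<longrightarrow> y = smf (lift (lm (act ss y))) v"
    using unipotent_invariants_line by blast
  interpret inv_line val uf p uE red sm ac Sg \<chi> \<rho> \<psi> v lm
    by unfold_locales (use v in blast)+
  obtain q where q: "q \<noteq> 0" "evk smf U q v = 0" using torsion by blast
  define Y where "Y = {f \<in> A. f \<in> Vs n \<and> Teig \<psi> f}"
  have vY: "v \<in> Y" using v_A v_weight Z(2) \<rho>(1) by (auto simp: Y_def Teig_def weight_def)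
  have Ysub: "S.subspace Y"
  proof -
    have "S.subspace {f. Teig \<psi> f}"
      by (rule S.subspaceI) (simp_all add: Teig_def act_add act_smf S.scale_right_distrib mult.commute)
    moreover have "Y = (A \<inter> (Sg \<inter> Vs n)) \<inter> {f. Teig \<psi> f}" using A_Sg by (auto simp: Y_def)
    ultimately show ?thesis using S.subspace_inter[OF S.subspace_inter[OF A_sub Vs_sub]] by simp
  qed
  have YU: "U f \<in> Y" if f: "f \<in> Y" for f
  proof -
    have fA: "f \<in> A" "f \<in> Vs n" "Teig \<psi> f" "f \<in> Sg" using f A_Sg by (auto simp: Y_def)
    have "max 1 (n - 1) \<le> n" using n by simp
    hence "U f \<in> Vs n" using Vs_mono Vs_U[OF fA(4,2) n] by blast
    moreover have "Teig \<psi> (U f)" unfolding Teig_def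
    proof (intro allI impI)
      fix a d assume ad: "ou a" "ou d"
      have nf: "nfix f" using fA(1) by (simp add: A_def)
      show "act (dg a d) (U f) = smf (\<psi> a d) (U f)"
        unfolding U_dg[OF nf ad] using fA(3) ad by (simp add: Teig_def U_smf)
    qed
    ultimately show ?thesis using A_U[OF fA(1)] by (simp add: Y_def)
  qed
  have "lin_on smf Y U" using YU by (simp add: lin_on_def U_add U_smf)
  moreover have "kill smf Y" using A_Sg by (intro kill_Sg) (auto simp: Y_def)
  moreover have "v \<noteq> 0" using v_weight by (simp add: weight_def)
  ultimately obtain a y where "y \<in> Y" "y \<noteq> 0" "U y = smf a y"
    using eigenvector_exists[OF module_smf Ysub _ _ vY _ q] by blast
  thus ?thesis by (auto simp: Y_def)
qed

text \<open>Since \<open>U y = 0\<close> expresses \<open>\<Pi> y\<close> through \<open>n(u) t y\<close> with \<open>u \<noteq> 0\<close>, the \<open>K\<close>-span of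
\<open>\<Pi> y\<close> consists of combinations of the \<open>n(u) t y\<close>, whose functions have smaller support.\<close>

lemma descent:
  assumes y: "y \<in> A" "y \<noteq> 0" "y \<in> Vs n" "Teig \<psi> y" and n: "1 \<le> n" and U0: "U y = 0"
  shows "\<exists>Z. Kfg Z \<and> Z \<subseteq> Vs (max 1 (n - 1))"
proof -
  have yS: "y \<in> Sg" "nfix y" "kfix 1 y" using y(1) by (simp_all add: A_def)
  define e where "e u = act (nn u) (act (T 1) y)" for u
  define Z where "Z = S.span (e ` R)"
  have econg: "e u = e u'" if "pw 1 (u - u')" for u u'
    unfolding e_def by (rule nn_T1_cong[OF yS(2) that])
  have eZ: "e u \<in> Z" if u: "pw 0 u" for u
  proof -
    obtain r where "r \<in> R" "pw 1 (u - r)" using transv_R u by (auto simp: transv_def)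
    thus ?thesis using econg[of u r] unfolding Z_def by (auto intro: S.span_base)
  qed
  have ZI: "Z \<subseteq> V" if "S.subspace V" "\<And>u. pw 0 u \<Longrightarrow> e u \<in> V" for V
    unfolding Z_def using that R_pw by (intro S.span_minimal) auto
  have Zsub: "S.subspace Z" by (simp add: Z_def)
  have pre: "S.subspace {z. act k z \<in> Z}" for k
    using Zsub by (intro S.subspaceI)
      (auto simp: act_add act_smf intro: S.subspace_0 S.subspace_add S.subspace_scale)
  have eSg: "e u \<in> Sg" for u unfolding e_def using yS by (intro Sg_act) simp_all
  have "Kst Z"
  proof (rule KstI)
    fix u z assume u: "pw 0 u" and z: "z \<in> Z"
    have "act (nn u) (e u') \<in> Z" if "pw 0 u'" for u'
      using eZ[OF pw_add[OF u that]] by (simp add: e_def nn_nn)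
    hence "Z \<subseteq> {z. act (nn u) z \<in> Z}" using pre by (intro ZI) auto
    thus "act (nn u) z \<in> Z" using z by blast
  next
    fix a d z assume ad: "ou a" "ou d" and z: "z \<in> Z"
    have ad': "a \<noteq> 0" "d \<noteq> 0" using ad by (auto simp: ou_def)
    have "act (dg a d) (e u) \<in> Z" if u: "pw 0 u" for u
    proof -
      have "act (dg a d) (e u) = smf (\<psi> a d) (e (a / d * u))"
        using y(4) ad by (simp add: e_def dg_nn[OF ad'] dg_T[OF ad'] Teig_def act_smf)
      thus ?thesis using eZ[OF pw_mult_o[OF ou_pw[OF ou_divide[OF ad]] u]] Zsub
        by (simp add: S.subspace_scale)
    qed
    hence "Z \<subseteq> {z. act (dg a d) z \<in> Z}" using pre by (intro ZI) auto
    thus "act (dg a d) z \<in> Z" using z by blast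
  next
    fix z assume z: "z \<in> Z"
    have unit: "act (nn (1 / u)) (act (dg (- 1 / u) u) (act (T 1) y)) \<in> Z" if u: "ou u" for u
    proof -
      have o: "ou (- 1 / u)" "ou (1 / u)" using ou_divide[OF ou_1 u] ou_divide[of "-1" u] u by simp_all
      have "- 1 / u \<noteq> 0" "u \<noteq> 0" using u by (auto simp: ou_def)
      have "act (nn (1 / u)) (act (dg (- 1 / u) u) (act (T 1) y)) = smf (\<psi> (- 1 / u) u) (e (1 / u))"
      proof -
        have 1: "act (dg (- 1 / u) u) y = smf (\<psi> (- 1 / u) u) y"
          using y(4) o(1) u unfolding Teig_def by blast
        show ?thesis unfolding dg_T[OF \<open>- 1 / u \<noteq> 0\<close> \<open>u \<noteq> 0\<close>] 1 act_smf e_def ..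
      qed
      thus ?thesis using eZ[OF ou_pw[OF o(2)]] Zsub by (simp add: S.subspace_scale)
    qed
    have "act ss (e u) \<in> Z" if u: "pw 0 u" for u
    proof (cases "pw 1 u")
      case False
      hence o: "ou u" "u \<noteq> 0" using u by (auto simp: ou_iff)
      have "pw 1 (uf powi 1 / u)" using o(1) pw_divide[of u 1 uf] by (simp add: ou_def in_pow_def)
      hence "act ss (e u) = act (nn (1 / u)) (act (dg (- 1 / u) u) (act (T 1) y))"
        unfolding e_def ss_nn_T[OF o(2)] using kfix1_nb[OF yS(3)] by simp
      thus ?thesis using unit[OF o(1)] by simp
    next
      case True
      have "m2mult ss (T 1) = m2mult (dg 1 uf) ss" by (simp add: mdefs T_def)
      hence "act (m2mult ss (T 1)) y = act (m2mult (dg 1 uf) ss) y" by simp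
      hence 1: "act ss (act (T 1) y) = act (dg 1 uf) (act ss y)" by (simp add: act_mult)
      have "e u = e 0" using True by (intro econg) simp
      hence "act ss (e u) = act (dg 1 uf) (act ss y)"
        using 1 SgC[OF Sg_act[OF T_GL2 yS(1)]] by (simp add: e_def)
      also have "\<dots> = - (\<Sum>r\<in>R - {0}. act (nn (1 / r)) (act (dg (- 1 / r) r) (act (T 1) y)))"
        using ss_U[OF yS(3)] unfolding U0 act_0 by (simp only: eq_neg_iff_add_eq_0)
      also have "\<dots> \<in> Z" using unit R_ou by (intro S.subspace_neg[OF Zsub] S.subspace_sum[OF Zsub]) auto
      finally show ?thesis .
    qed
    hence "Z \<subseteq> {z. act ss z \<in> Z}" using pre by (intro ZI) auto
    thus "act ss z \<in> Z" using z by blast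
  qed
  moreover have "Z \<subseteq> Sg" using eSg by (intro ZI Sg_sub)
  moreover have "Z \<subseteq> {z. kfix 1 z}"
  proof (rule ZI)
    show "S.subspace {z. kfix 1 z}" by (intro S.subspaceI) (simp_all add: kfix_def act_add act_smf)
    show "e u \<in> {z. kfix 1 z}" if "pw 0 u" for u
      using kfix1_nn_T1[OF yS(2,3) that] by (simp add: e_def)
  qed
  moreover have "Z \<noteq> {0}"
  proof
    assume "Z = {0}"
    hence "act (nn 0) (act (T 1) y) = 0" using eZ[of 0] by (simp add: e_def)
    hence "act (T (- 1)) (act (T 1) y) = 0" using SgC[OF Sg_act[OF T_GL2 yS(1)]] by simp
    thus False using y(2) SgC[OF yS(1)] by (simp add: T_T)
  qed
  moreover have "Z \<subseteq> Sg \<inter> Vs (max 1 (n - 1))"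
    using Vs_nn_T[OF yS(1) y(3) _ n] eSg by (intro ZI Vs_sub) (auto simp: e_def)
  moreover have "\<exists>E. finite E \<and> Z = S.span E" unfolding Z_def by (rule exI[of _ "e ` R"]) simp
  ultimately show ?thesis by (intro exI[of _ Z]) (auto simp: Kfg_def)
qed

text \<open>Only r = 0 contributes, because r / uf is not integral for a unit r. As \<theta> is
  injective, the eigenvalue of a nonzero eigenvector of \<open>A\<close> supported in o cannot be 0,
  which ends the descent.\<close>

lemma FF_U_0: assumes f: "f \<in> Sg" "f \<in> Vs 1" shows "FF (U f) 0 = th 1 (FF f 0)"
proof -
  have "FF (U f) 0 = (\<Sum>r\<in>R. th 1 (FF f (r / uf)))"
    using f(1) by (simp add: U_def FF_sum FF_nn_T)
  also have "\<dots> = th 1 (FF f (0 / uf))"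
  proof (rule sum_single[OF fin_R zero_R])
    fix r assume "r \<in> R" "r \<noteq> 0"
    hence "ou r" by (rule R_ou)
    hence "\<not> pw 0 (r / uf)" by (simp add: pw_divide_iff ou_iff)
    hence "FF f (r / uf) = 0" using f(2) by (auto simp: Vs_def)
    thus "th 1 (FF f (r / uf)) = 0" by simp
  qed
  finally show ?thesis by simp
qed

lemma nfix_FF: assumes "f \<in> C" "nfix f" "pw 0 u" shows "FF f u = FF f 0"
  using FF_nn[OF assms(1), of u 0] assms(2,3) by (simp add: nfix_def)

lemma A_Vs1_zero: assumes "f \<in> A" "f \<in> Vs 1" "FF f 0 = 0" shows "f = 0"
proof (rule C_eq_0)
  show fC: "f \<in> C" using assms(2) by (simp add: Vs_def)
  fix u
  show "FF f u = 0"
  proof (cases "pw 0 u")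
    case True
    thus ?thesis using nfix_FF[OF fC] assms(1,3) by (simp add: A_def)
  next
    case False
    thus ?thesis using assms(2) by (auto simp: Vs_def)
  qed
qed

lemma ex_unit_eigenvector:
  "\<exists>y a \<psi>. y \<in> A \<and> y \<noteq> 0 \<and> U y = smf a y \<and> red a \<noteq> 0 \<and> Teig \<psi> y"
proof -
  have main: "\<exists>y a \<psi>. y \<in> A \<and> y \<noteq> 0 \<and> U y = smf a y \<and> red a \<noteq> 0 \<and> Teig \<psi> y"
    if "Kfg Z" "Z \<subseteq> Vs (Suc n)" for n Z
    using that
  proof (induction n arbitrary: Z)
    case (0 Z)
    obtain y a \<psi> where y: "y \<in> A" "y \<noteq> 0" "y \<in> Vs 1" "U y = smf a y" "Teig \<psi> y"
      using ex_U_eigenvector[of Z 1] 0 by auto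
    have "red a \<noteq> 0"
    proof
      assume a0: "red a = 0"
      have "smf a y = smf 0 y" by (rule sc_cong[OF module_smf]) (use y(1) A_Sg Sg_kill a0 in auto)
      hence "U y = 0" using y(4) by (simp only: S.scale_zero_left)
      hence "th 1 (FF y 0) = 0" using FF_U_0[OF _ y(3)] y(1) A_Sg by auto
      hence "y = 0" using A_Vs1_zero[OF y(1,3)] by (simp add: th_eq_0)
      thus False using y(2) by blast
    qed
    thus ?case using y by blast
  next
    case (Suc n Z)
    obtain y a \<psi> where y: "y \<in> A" "y \<noteq> 0" "y \<in> Vs (Suc (Suc n))" "U y = smf a y" "Teig \<psi> y"
      using ex_U_eigenvector[OF Suc.prems] by auto
    show ?case
    proof (cases "red a = 0")
      case True
      have "smf a y = smf 0 y" by (rule sc_cong[OF module_smf]) (use y(1) A_Sg Sg_kill True in auto)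
      hence "U y = 0" using y(4) by (simp only: S.scale_zero_left)
      then obtain Z' where "Kfg Z'" "Z' \<subseteq> Vs (max 1 (Suc (Suc n) - 1))"
        using descent[OF y(1,2,3,5)] by auto
      thus ?thesis using Suc.IH[of Z'] by simp
    next
      case False
      thus ?thesis using y by blast
    qed
  qed
  obtain w where w: "w \<in> Sg" "w \<noteq> 0" "kfix 1 w" using ex_kfix1 by blast
  let ?E = "(\<lambda>k. act k w) ` KK"
  note orb = KK_orbit_span[OF w(1)]
  have "Kfg (S.span ?E)"
    unfolding Kfg_def using orb w kfix_span[of 1 w] by auto
  moreover have "\<exists>n. S.span ?E \<subseteq> Vs (Suc n)"
  proof -
    have "\<exists>n. f \<in> Vs n" if fC: "f \<in> C" for f
    proof -
      obtain m :: nat where "\<forall>u. FF f u \<noteq> 0 \<longrightarrow> pw (- int m) u" using FF_support[OF fC] by blast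
      hence "f \<in> Vs (Suc m)" using fC by (simp add: Vs_def)
      thus ?thesis by blast
    qed
    then obtain lev where lev: "\<And>f. f \<in> C \<Longrightarrow> f \<in> Vs (lev f)" by metis
    define n where "n = Max (lev ` ?E)"
    have "f \<in> Sg \<inter> Vs (Suc n)" if "f \<in> ?E" for f
    proof -
      have "f \<in> Sg" using that orb(3) S.span_superset[of ?E] by blast
      moreover have "lev f \<le> n" unfolding n_def using that orb(1) by (intro Max_ge) auto
      ultimately show ?thesis using Vs_mono[OF lev[OF SgC]] by auto
    qed
    hence "S.span ?E \<subseteq> Sg \<inter> Vs (Suc n)" by (intro S.span_minimal Vs_sub) auto
    thus ?thesis by blast
  qed
  ultimately show ?thesis using main by blast
qed

text \<open>y is a multiple of \<open>U y\<close>, so it inherits the smaller support of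
  \<open>U y\<close>, again and again down to o.\<close>

lemma unit_eigenvector_Vs1:
  assumes y: "y \<in> A" "U y = smf a y" "red a \<noteq> 0"
  shows "y \<in> Vs 1"
proof -
  have yS: "y \<in> Sg" using y(1) A_Sg by blast
  have step: "y \<in> Vs (max 1 (n - 1))" if "y \<in> Vs n" "1 \<le> n" for n
  proof -
    have "smf (lift (inverse (red a))) (U y) \<in> Sg \<inter> Vs (max 1 (n - 1))"
      using Vs_U[OF yS that] by (intro S.subspace_scale[OF Vs_sub])
    moreover have "smf (lift (inverse (red a))) (U y) = y"
      unfolding y(2) by (rule sc_unit[OF module_smf Sg_kill[OF yS] y(3)])
    ultimately show ?thesis by simp
  qed
  obtain m :: nat where "\<forall>u. FF y u \<noteq> 0 \<longrightarrow> pw (- int m) u" using FF_support[OF SgC[OF yS]] by blast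
  hence "y \<in> Vs (Suc m)" using SgC[OF yS] by (simp add: Vs_def)
  thus ?thesis
  proof (induction m)
    case (Suc m)
    have "y \<in> Vs (Suc m)" using step[OF Suc.prems] by simp
    thus ?case by (rule Suc.IH)
  qed simp
qed

end

section \<open>The isomorphism with the twisted Steinberg module\<close>

context local_field
begin

lemma complete:
  fixes s :: "nat \<Rightarrow> 'f"
  assumes "\<And>N. \<exists>M. \<forall>m\<ge>M. \<forall>n\<ge>M. pw N (s m - s n)"
  shows "\<exists>L. \<forall>N. \<exists>M. \<forall>n\<ge>M. pw N (s n - L)"
  using nalf assms unfolding nonarch_local_field_def by blast

end

context smooth_mod
begin

lemma Iwahori1_KK: assumes "k \<in> Iwahori1 val" shows "k \<in> KK"
proof -
  obtain a b c d where k: "k = M2 a b c d" by (cases k)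
  have kc: "pw 1 (a - 1)" "pw 0 b" "pw 1 c" "pw 1 (d - 1)" using assms by (auto simp: k Iwahori1_def)
  have o: "ou a" "ou d" using kc ou_cong[OF ou_1] by auto
  have "pw 1 (a * d - b * c - a * d)" using pw_mult_o[OF kc(2,3)] by simp
  hence "ou (a * d - b * c)" using ou_cong[OF ou_mult[OF o]] by blast
  thus ?thesis using o kc ou_pw pw_mono[OF kc(3), of 0] by (auto simp: k)
qed

lemma Kcong_mono: assumes "m \<le> n" "k \<in> Kcong val n" shows "k \<in> Kcong val m"
proof -
  have "pw (int m) y" if "pw (int n) y" for y by (rule pw_mono[OF that]) (use assms(1) in simp)
  thus ?thesis using assms(2) unfolding Kcong_def by blast
qed

end

locale eigen_line = sigma_kill val uf p uE red sm ac Sg \<chi>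
  for val :: "'f::field \<Rightarrow> int" and uf :: 'f and p :: nat
    and uE :: "'o::idom" and red :: "'o \<Rightarrow> 'k::field"
    and sm :: "'o \<Rightarrow> 'w::ab_group_add \<Rightarrow> 'w" and ac :: "'f m2 \<Rightarrow> 'w \<Rightarrow> 'w"
    and Sg :: "('f m2 \<Rightarrow> 'w) set" and \<chi> :: "'f \<Rightarrow> 'o" +
  fixes w :: "'f m2 \<Rightarrow> 'w" and \<alpha> :: 'o and \<psi>
  assumes wA: "w \<in> A" and w_nz: "w \<noteq> 0" and Uw: "U w = smf \<alpha> w" and \<alpha>_nz: "red \<alpha> \<noteq> 0" and w_Teig: "Teig \<psi> w"
begin

lemma wS: "w \<in> Sg" and wC: "w \<in> C" and w_nfix: "nfix w" and w_kfix: "kfix 1 w"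
  using wA SgC by (auto simp: A_def)

lemma w_Vs: "w \<in> Vs 1" by (rule unit_eigenvector_Vs1[OF wA Uw \<alpha>_nz])

definition x :: 'w where "x = FF w 0"

lemma FF_w: "FF w u = (if pw 0 u then x else 0)"
proof (cases "pw 0 u")
  case True
  thus ?thesis using nfix_FF[OF wC w_nfix True] by (simp add: x_def)
next
  case False
  have "FF w u = 0 \<or> pw (1 - int 1) u" using w_Vs unfolding Vs_def by blast
  thus ?thesis using False by simp
qed

lemma x_nz: "x \<noteq> 0" using A_Vs1_zero[OF wA w_Vs] w_nz by (auto simp: x_def)

lemma kill_val: "f \<in> Sg \<Longrightarrow> sm uE (f g) = 0"
proof -
  assume "f \<in> Sg"
  hence "smf uE f g = 0" using Sg_kill by simp
  thus ?thesis by (simp add: smf_def)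
qed

lemma x_kill: "sm uE x = 0" unfolding x_def FF_def by (rule kill_val[OF wS])

lemma sm_x_eq: "sm a x = sm b x \<longleftrightarrow> red a = red b"
  by (rule sc_eq_iff[OF module_sm x_kill x_nz])

lemma th_x: "th 1 x = sm \<alpha> x"
  using FF_U_0[OF wS w_Vs] by (simp add: Uw FF_smf x_def)

lemma th_pow_x: "th (int j) x = sm (\<alpha> ^ j) x"
proof (induction j)
  case (Suc j)
  have "th (int (Suc j)) x = th 1 (th (int j) x)" by (simp add: th_th)
  thus ?case using Suc by (simp add: th_sm th_x mult.commute)
qed simp

text \<open>For c in p the translate of w by \<open>nb c\<close> is w. Evaluated at s this gives
  n(c) x = x, because s \<open>nb c\<close> = n(c) s and the correction w(\<open>nb c\<close>)
  vanishes, 1 / c not being integral. A general u is reduced to this by \<theta>^j, which acts on x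
  by an invertible scalar.\<close>

lemma nn_x: "ac (nn u) x = x"
proof -
  have small: "ac (nn c) x = x" if c: "pw 1 c" for c
  proof -
    have "act (nb c) w ss = x" using kfix1_nb[OF w_kfix c] by (simp add: x_def FF_def mdefs)
    moreover have "w (nb c) = 0"
    proof (cases "c = 0")
      case True
      have "nb 0 = (m2one :: 'f m2)" by (simp add: mdefs)
      thus ?thesis using True C_one[OF wC] by simp
    next
      case False
      have "pw 1 (c * (1 / c)) \<Longrightarrow> False" using False by simp
      hence "\<not> pw 0 (1 / c)" using pw_mult_o'[OF c, of "1 / c"] by blast
      thus ?thesis using False by (simp add: C_nb[OF wC] FF_w)
    qed
    moreover have "m2mult ss (nb c) = m2mult (nn c) ss" by (simp add: mdefs)
    moreover have "w (m2mult (nn c) ss) = ac (nn c) x"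
      using C_Borel[OF wC, of "nn c" ss] by (simp add: x_def FF_def) (simp add: mdefs)
    ultimately show ?thesis by (simp add: act_def)
  qed
  define j where "j = nat (1 - val u)"
  have "pw 1 (u * uf powi int j)"
    by (cases "u = 0") (auto simp: in_pow_def val_mult j_def)
  hence "ac (nn u) (th (int j) x) = th (int j) x" by (simp add: nn_th small)
  hence "sm (\<alpha> ^ j) (ac (nn u) x - x) = 0"
    by (simp add: th_pow_x ac_sm W.scale_right_diff_distrib)
  moreover have "sm uE (ac (nn u) x - x) = 0"
    using ac_sm[of "nn u" uE x] by (simp add: W.scale_right_diff_distrib x_kill)
  moreover have "red (\<alpha> ^ j) \<noteq> 0" using \<alpha>_nz by simp
  ultimately have "ac (nn u) x - x = 0" using sc_nz[OF module_sm] by blast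
  thus ?thesis by simp
qed

lemma ac_x: "g \<in> GL2 \<Longrightarrow> ac g x = ac (dg 1 (m2det g)) x"
  by (rule unipotent_fixed_det[OF nn_x])

text \<open>Units act on x through the torus character of w, and powers of uf through the invertible
  eigenvalue \<alpha>.\<close>

lemma ac_x_scalar: "e \<noteq> 0 \<Longrightarrow> \<exists>c. ac (dg 1 e) x = sm c x"
proof -
  assume e: "e \<noteq> 0"
  define j where "j = val e"
  define \<epsilon> where "\<epsilon> = e / uf powi j"
  have \<epsilon>: "ou \<epsilon>" using e by (simp add: \<epsilon>_def j_def ou_def val_divide)
  have "ac (dg 1 \<epsilon>) x = FF (act (dg \<epsilon> 1) w) 0"
    using FF_dg[OF wC, of \<epsilon> 1 0] \<epsilon> by (simp add: ou_def x_def)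
  also have "act (dg \<epsilon> 1) w = smf (\<psi> \<epsilon> 1) w" using w_Teig \<epsilon> by (simp add: Teig_def)
  finally have u: "ac (dg 1 \<epsilon>) x = sm (\<psi> \<epsilon> 1) x" by (simp add: FF_smf x_def)
  have t: "\<exists>c. th j x = sm c x"
  proof (cases "j \<ge> 0")
    case True
    thus ?thesis using th_pow_x[of "nat j"] by auto
  next
    case False
    define i where "i = nat (- j)"
    have "th (int i) (th j x) = x" using False by (simp add: th_th i_def)
    hence "sm (\<alpha> ^ i) (th j x) = x" by (metis th_pow_x th_sm th_th add.commute)
    moreover have "sm uE (th j x) = 0" by (simp add: x_kill flip: th_sm)
    moreover have "red (\<alpha> ^ i) \<noteq> 0" using \<alpha>_nz by simp
    ultimately have "th j x = sm (lift (inverse (red (\<alpha> ^ i)))) x"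
      using sc_unit[OF module_sm] by metis
    thus ?thesis by blast
  qed
  have "dg 1 e = m2mult (dg 1 \<epsilon>) (dg 1 (uf powi j))" by (simp add: mdefs \<epsilon>_def)
  hence "ac (dg 1 e) x = ac (dg 1 \<epsilon>) (th j x)" using \<epsilon> by (simp add: ac_mult th_def ou_def)
  moreover obtain c where "th j x = sm c x" using t by blast
  ultimately have "ac (dg 1 e) x = sm (c * \<psi> \<epsilon> 1) x" using u \<epsilon> by (simp add: ac_sm ou_def)
  thus ?thesis by blast
qed

definition \<delta> :: "'f \<Rightarrow> 'k" where "\<delta> e = red (SOME c. ac (dg 1 e) x = sm c x)"

lemma delta_eq: "e \<noteq> 0 \<Longrightarrow> ac (dg 1 e) x = sm c x \<longleftrightarrow> red c = \<delta> e"
proof -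
  assume e: "e \<noteq> 0"
  define d where "d = (SOME c. ac (dg 1 e) x = sm c x)"
  have "ac (dg 1 e) x = sm d x" unfolding d_def using ac_x_scalar[OF e] by (rule someI_ex)
  thus ?thesis using sm_x_eq[of d c] by (auto simp: \<delta>_def d_def)
qed

lemma ac_x_delta: "g \<in> GL2 \<Longrightarrow> red c = \<delta> (m2det g) \<Longrightarrow> ac g x = sm c x"
  using ac_x[of g] delta_eq[of "m2det g" c] by (simp add: GL2_def)

lemma smooth_char_delta: "smooth_char val \<delta>"
  unfolding smooth_char_def
proof (intro conjI allI impI)
  show "\<delta> e \<noteq> 0" if "e \<noteq> 0" for e
  proof
    assume "\<delta> e = 0"
    hence "ac (dg 1 e) x = sm 0 x" using delta_eq[OF that, of 0] by simp
    thus False using x_nz that by (simp add: ac_eq_0)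
  qed
  show "\<delta> (e * e') = \<delta> e * \<delta> e'" if e: "e \<noteq> 0" "e' \<noteq> 0" for e e'
  proof -
    have "dg 1 (e * e') = m2mult (dg 1 e) (dg 1 e')" by (simp add: mdefs)
    hence "ac (dg 1 (e * e')) x = ac (dg 1 e) (ac (dg 1 e') x)" using e by (simp add: ac_mult)
    also have "ac (dg 1 e') x = sm (lift (\<delta> e')) x" using delta_eq[OF e(2)] by simp
    also have "ac (dg 1 e) (sm (lift (\<delta> e')) x) = sm (lift (\<delta> e')) (sm (lift (\<delta> e)) x)"
      using delta_eq[OF e(1), of "lift (\<delta> e)"] e by (simp add: ac_sm)
    finally have "ac (dg 1 (e * e')) x = sm (lift (\<delta> e') * lift (\<delta> e)) x" by simp
    hence "red (lift (\<delta> e') * lift (\<delta> e)) = \<delta> (e * e')"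
      using delta_eq[of "e * e'" "lift (\<delta> e') * lift (\<delta> e)"] e by (simp only: mult_eq_0_iff) simp
    thus ?thesis by (simp add: mult.commute)
  qed
  obtain n where n: "n \<ge> 1" "\<And>k. k \<in> Kcong val n \<Longrightarrow> ac k x = x" using ac_smooth[of x] by blast
  have "\<delta> u = 1" if u: "pw (int n) (u - 1)" for u
  proof -
    have "pw 1 (u - 1)" using u n(1) by (auto intro: pw_mono)
    hence "u \<noteq> 0" using ou_cong[OF ou_1] by (auto simp: ou_def)
    moreover have "ac (dg 1 u) x = sm 1 x" using n(2)[of "dg 1 u"] u by (simp add: Kcong_def dg_def)
    ultimately show ?thesis using delta_eq[of u 1] by simp
  qed
  thus "\<exists>n\<ge>1. \<forall>u. pw (int n) (u - 1) \<longrightarrow> \<delta> u = 1" using n(1) by blast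
qed

lemma delta_mult: "e \<noteq> 0 \<Longrightarrow> e' \<noteq> 0 \<Longrightarrow> \<delta> (e * e') = \<delta> e * \<delta> e'"
  and delta_nz: "e \<noteq> 0 \<Longrightarrow> \<delta> e \<noteq> 0"
  using smooth_char_delta unfolding smooth_char_def by blast+

lemma ac_sm_x: "g \<in> GL2 \<Longrightarrow> ac g (sm c x) = sm (c * lift (\<delta> (m2det g))) x"
  using ac_x_delta[of g "lift (\<delta> (m2det g))"] by (simp add: ac_sm)

lemma values_line: assumes "f \<in> Sg" "g \<in> GL2" shows "\<exists>c. f g = sm c x"
proof -
  define N where "N = {f \<in> Sg. \<forall>g\<in>GL2. \<exists>c. f g = sm c x}"
  have NI: "f \<in> N" if "f \<in> Sg" "\<And>g. g \<in> GL2 \<Longrightarrow> \<exists>c. f g = sm c x" for f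
    unfolding N_def using that by blast
  have NS: "N \<subseteq> Sg" unfolding N_def by blast
  have "N = {0} \<or> N = Sg"
  proof (rule irr)
    show "N \<subseteq> Sg" by (rule NS)
    show "S.subspace N"
    proof (rule S.subspaceI)
      have "\<exists>c. (0 :: 'f m2 \<Rightarrow> 'w) g = sm c x" for g by (rule exI[of _ 0]) simp
      thus "0 \<in> N" by (intro NI Sg0)
      show "f + f' \<in> N" if ff: "f \<in> N" "f' \<in> N" for f f'
      proof -
        have 1: "\<exists>c. (f + f') g = sm c x" if g: "g \<in> GL2" for g
        proof -
          obtain c c' where "f g = sm c x" "f' g = sm c' x" using ff g unfolding N_def by blast
          thus ?thesis by (intro exI[of _ "c + c'"]) (simp add: W.scale_left_distrib)
        qed
        have "f \<in> Sg" "f' \<in> Sg" using ff NS by blast+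
        from NI[OF S.subspace_add[OF Sg_sub this] 1] show ?thesis .
      qed
      show "smf a f \<in> N" if ff: "f \<in> N" for a f
      proof -
        have 1: "\<exists>c. smf a f g = sm c x" if g: "g \<in> GL2" for g
        proof -
          obtain c where "f g = sm c x" using ff g unfolding N_def by blast
          thus ?thesis by (intro exI[of _ "a * c"]) (simp add: smf_def)
        qed
        have "f \<in> Sg" using ff NS by blast
        from NI[OF S.subspace_scale[OF Sg_sub this] 1] show ?thesis .
      qed
    qed
    show "act h f \<in> N" if h: "h \<in> GL2" and f: "f \<in> N" for h f
    proof -
      have 1: "\<exists>c. act h f g = sm c x" if g: "g \<in> GL2" for g
      proof -
        obtain c c' where c: "f (m2mult g h) = sm c x" "f h = sm c' x"
          using f GL2_mult[OF g h] h unfolding N_def by blast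
        show ?thesis
          by (rule exI[of _ "c - c' * lift (\<delta> (m2det g))"])
            (use c g in \<open>simp add: act_def ac_sm_x W.scale_left_diff_distrib\<close>)
      qed
      have "f \<in> Sg" using f NS by blast
      from NI[OF Sg_act[OF h this] 1] show ?thesis .
    qed
  qed
  moreover have "w \<in> N"
  proof -
    have "\<exists>c. w g = sm c x" if g: "g \<in> GL2" for g
    proof -
      obtain a b c d where g': "g = M2 a b c d" by (cases g)
      have zero: "\<exists>c. 0 = sm c x" by (rule exI[of _ 0]) simp
      show ?thesis
      proof (cases "c = 0")
        case True
        thus ?thesis using C_on_Borel[OF wC, of g] g zero by (simp add: g')
      next
        case False
        have m: "M2 (b - a * d / c) a 0 c \<in> GL2" using False g by (auto simp: g' field_simps)
        have "w g = ac (M2 (b - a * d / c) a 0 c) (if pw 0 (d / c) then x else 0)"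
          using C_formula[OF wC False, of a d b] g by (simp add: g' FF_w)
        thus ?thesis using ac_sm_x[OF m, of 1] m zero by (cases "pw 0 (d / c)") auto
      qed
    qed
    from NI[OF wS this] show ?thesis .
  qed
  ultimately have "N = Sg" using w_nz by blast
  thus ?thesis using assms unfolding N_def by blast
qed

section \<open>Scalar-valued functions on the quotient of G by P\<close>

definition cf :: "('f m2 \<Rightarrow> 'w) \<Rightarrow> 'f m2 \<Rightarrow> 'k" where "cf f g = red (SOME c. f g = sm c x)"

lemma cf_eq: assumes "f \<in> Sg" "g \<in> GL2" shows "f g = sm c x \<longleftrightarrow> red c = cf f g"
proof -
  define d where "d = (SOME c. f g = sm c x)"
  have "f g = sm d x" unfolding d_def using values_line[OF assms] by (rule someI_ex)
  thus ?thesis using sm_x_eq[of d c] by (auto simp: cf_def d_def)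
qed

lemma cfI: "f \<in> Sg \<Longrightarrow> g \<in> GL2 \<Longrightarrow> f g = sm c x \<Longrightarrow> cf f g = red c"
  by (simp add: cf_eq)

lemma cf_val: "f \<in> Sg \<Longrightarrow> g \<in> GL2 \<Longrightarrow> f g = sm (lift (cf f g)) x" by (simp add: cf_eq)

text \<open>Dividing by \<open>\<delta> \<circ> det\<close> turns the Borel equivariance of \<open>cf f\<close> into invariance.\<close>

definition hh :: "('f m2 \<Rightarrow> 'w) \<Rightarrow> 'f m2 \<Rightarrow> 'k" where
  "hh f g = (if g \<in> GL2 then inverse (\<delta> (m2det g)) * cf f g else 0)"

lemma det_nz: "g \<in> GL2 \<Longrightarrow> m2det g \<noteq> 0" by (simp add: GL2_def)

lemma hh_zero_iff: "f \<in> Sg \<Longrightarrow> g \<in> GL2 \<Longrightarrow> hh f g = 0 \<longleftrightarrow> f g = 0"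
  using cf_eq[of f g 0] delta_nz[OF det_nz] by (auto simp: hh_def)

lemma hh_add: "f \<in> Sg \<Longrightarrow> f' \<in> Sg \<Longrightarrow> hh (f + f') g = hh f g + hh f' g"
proof (cases "g \<in> GL2")
  case True
  assume f: "f \<in> Sg" "f' \<in> Sg"
  have v: "(f + f') g = sm (lift (cf f g) + lift (cf f' g)) x"
    using cf_val[OF f(1) True] cf_val[OF f(2) True] by (simp add: W.scale_left_distrib)
  have "cf (f + f') g = red (lift (cf f g) + lift (cf f' g))"
    by (rule cfI[where f="f + f'", OF S.subspace_add[OF Sg_sub f] True v])
  hence "cf (f + f') g = cf f g + cf f' g" by (simp only: red_add red_lift)
  thus ?thesis using True by (simp add: hh_def algebra_simps)
qed (simp add: hh_def)

lemma hh_smf: "f \<in> Sg \<Longrightarrow> hh (smf a f) g = red a * hh f g"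
proof (cases "g \<in> GL2")
  case True
  assume f: "f \<in> Sg"
  have "(smf a f) g = sm (a * lift (cf f g)) x"
    using cf_val[OF f True] by (simp add: smf_def)
  from cfI[where f="smf a f", OF S.subspace_scale[OF Sg_sub f] True this]
  have "cf (smf a f) g = red a * cf f g" by simp
  thus ?thesis using True by (simp add: hh_def)
qed (simp add: hh_def)

text \<open>After division by \<delta>(det g) the cocycle correction g f(h) becomes the constant
  \<open>cf f h\<close>; this is why the target is the quotient by constants.\<close>

lemma hh_act:
  assumes f: "f \<in> Sg" and h: "h \<in> GL2" and g: "g \<in> GL2"
  shows "hh (act h f) g = \<delta> (m2det h) * hh f (m2mult g h) - cf f h"
proof -
  have gh: "m2mult g h \<in> GL2" using g h by simp
  have "act h f g = sm (lift (cf f (m2mult g h)) - lift (cf f h) * lift (\<delta> (m2det g))) x"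
    using g cf_val[OF f gh] cf_val[OF f h] ac_sm_x[OF g, of "lift (cf f h)"]
    by (simp add: act_def W.scale_left_diff_distrib)
  from cfI[where f="act h f", OF Sg_act[OF h f] g this]
  have "cf (act h f) g = cf f (m2mult g h) - cf f h * \<delta> (m2det g)" by simp
  thus ?thesis using g gh delta_nz[OF det_nz[OF g]] delta_nz[OF det_nz[OF h]]
    by (simp add: hh_def m2det_mult delta_mult det_nz h field_simps)
qed

lemma hh_one: "f \<in> Sg \<Longrightarrow> hh f m2one = 0"
  using hh_zero_iff[of f m2one] C_one[OF SgC] by simp

lemma hh_Borel: assumes f: "f \<in> Sg" and b: "b \<in> Borel" and g: "g \<in> GL2" shows "hh f (m2mult b g) = hh f g"
proof -
  have bG: "b \<in> GL2" by (rule Borel_GL2[OF b])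
  have bg: "m2mult b g \<in> GL2" using bG g by simp
  have "f (m2mult b g) = sm (lift (cf f g) * lift (\<delta> (m2det b))) x"
    using C_Borel[OF SgC[OF f] b g] cf_val[OF f g] ac_sm_x[OF bG] by simp
  from cfI[OF f bg this] have "cf f (m2mult b g) = cf f g * \<delta> (m2det b)" by simp
  thus ?thesis using g bg delta_nz[OF det_nz[OF bG]] delta_nz[OF det_nz[OF g]]
    by (simp add: hh_def m2det_mult delta_mult det_nz bG field_simps)
qed

lemma det_Kcong: assumes "n \<ge> 1" "k \<in> Kcong val n" shows "pw (int n) (m2det k - 1)"
proof -
  obtain a b c d where k: "k = M2 a b c d" by (cases k)
  have kc: "pw (int n) (a - 1)" "pw (int n) b" "pw (int n) c" "pw (int n) (d - 1)" using assms by (auto simp: k Kcong_def)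
  have "pw 0 d" using pw_add[of 0 "d - 1" 1] pw_mono[OF kc(4), of 0] by simp
  hence "pw (int n) ((a - 1) * d + (d - 1) - b * c)"
    using kc(1) kc(4) pw_mult_o'[OF kc(2) pw_mono[OF kc(3), of 0]]
    by (intro pw_diff pw_add[OF pw_mult_o'[OF kc(1)] kc(4)]) auto
  thus ?thesis by (simp add: k algebra_simps)
qed

lemma hh_IndP1: assumes f: "f \<in> Sg" shows "hh f \<in> IndP1 val"
  unfolding IndP1_def
proof (intro CollectI conjI allI impI ballI)
  show "hh f g = 0" if "g \<notin> GL2" for g using that by (simp add: hh_def)
  show "hh f (m2mult b g) = hh f g" if "b \<in> Borel" "g \<in> GL2" for b g using hh_Borel[OF f that] .
  fix g :: "'f m2" assume g: "g \<in> GL2"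
  obtain n where n: "n \<ge> 1" "\<And>k g. k \<in> Kcong val n \<Longrightarrow> g \<in> GL2 \<Longrightarrow> f (m2mult g k) = f g"
    using C_smooth[OF SgC[OF f]] by metis
  obtain m where m: "m \<ge> 1" "\<And>u. pw (int m) (u - 1) \<Longrightarrow> \<delta> u = 1"
    using smooth_char_delta unfolding smooth_char_def by blast
  have "hh f (m2mult g k) = hh f g" if k: "k \<in> Kcong val (max m n)" for k
  proof -
    have km: "k \<in> Kcong val m" "k \<in> Kcong val n" using Kcong_mono[OF _ k] by auto
    have kG: "k \<in> GL2" using Kcong_KK[OF n(1) km(2)] KK_GL2 by blast
    have gk: "m2mult g k \<in> GL2" using g kG by simp
    have d1: "\<delta> (m2det k) = 1" by (rule m(2)[OF det_Kcong[OF m(1) km(1)]])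
    have "f (m2mult g k) = sm (lift (cf f g)) x" using n(2)[OF km(2) g] cf_val[OF f g] by simp
    from cfI[OF f gk this] have "cf f (m2mult g k) = cf f g" by simp
    moreover have "\<delta> (m2det (m2mult g k)) = \<delta> (m2det g)"
      using d1 by (simp add: m2det_mult delta_mult[OF det_nz[OF g] det_nz[OF kG]])
    ultimately show ?thesis using g gk by (simp add: hh_def)
  qed
  thus "\<exists>n\<ge>1. \<forall>k\<in>Kcong val n. hh f (m2mult g k) = hh f g" using m(1) by (intro exI[of _ "max m n"]) auto
qed

section \<open>Surjectivity onto the locally constant functions modulo constants\<close>

definition ball_lift :: "('f \<Rightarrow> 'k) \<Rightarrow> 'f \<Rightarrow> int \<Rightarrow> bool" where
  "ball_lift \<Phi> u j \<longleftrightarrow> (\<exists>f\<in>Sg. \<forall>v. FF f v = (if pw j (v - u) then sm (lift (\<Phi> v)) x else 0))"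

lemma ball_lift_const: assumes "\<And>v. pw j (v - u) \<Longrightarrow> \<Phi> v = \<Phi> u" shows "ball_lift \<Phi> u j"
proof -
  obtain \<kappa> where \<kappa>: "th j x = sm \<kappa> x" using ac_x_scalar[of "uf powi j"] by (auto simp: th_def)
  have \<kappa>0: "red \<kappa> \<noteq> 0"
  proof
    assume "red \<kappa> = 0"
    hence "th j x = sm 0 x" unfolding \<kappa> by (simp only: sm_x_eq red_0)
    thus False using x_nz by (simp add: th_eq_0)
  qed
  define c where "c = lift (\<Phi> u) * lift (inverse (red \<kappa>))"
  define f where "f = smf c (act (nn (- u)) (act (T j) w))"
  have "f \<in> Sg" unfolding f_def by (intro S.subspace_scale[OF Sg_sub] Sg_act wS) simp_all
  moreover have "FF f v = (if pw j (v - u) then sm (lift (\<Phi> v)) x else 0)" for v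
  proof -
    have "FF f v = sm c (th j (FF w ((v - u) / uf powi j)))"
      using FF_nn_T[OF wS, of "- u" j v] by (simp add: f_def FF_smf)
    moreover have "pw 0 ((v - u) / uf powi j) \<longleftrightarrow> pw j (v - u)" by (subst pw_divide_iff) auto
    moreover have "sm c (sm \<kappa> x) = sm (lift (\<Phi> u)) x"
      using \<kappa>0 sm_x_eq[of "c * \<kappa>" "lift (\<Phi> u)"] by (simp add: c_def)
    ultimately show ?thesis using assms[of v] by (simp add: FF_w \<kappa>)
  qed
  ultimately show ?thesis unfolding ball_lift_def by blast
qed

lemma ball_lift_refine: assumes "\<And>r. r \<in> R \<Longrightarrow> ball_lift \<Phi> (u + uf powi j * r) (j + 1)" shows "ball_lift \<Phi> u j"
proof -
  have "\<forall>r\<in>R. \<exists>f. f \<in> Sg \<and> (\<forall>v. FF f v = (if pw (j + 1) (v - (u + uf powi j * r)) then sm (lift (\<Phi> v)) x else 0))"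
    using assms unfolding ball_lift_def by blast
  then obtain f where f: "\<And>r. r \<in> R \<Longrightarrow> f r \<in> Sg"
    "\<And>r v. r \<in> R \<Longrightarrow> FF (f r) v = (if pw (j + 1) (v - (u + uf powi j * r)) then sm (lift (\<Phi> v)) x else 0)" by metis
  have iff: "pw (j + 1) (v - (u + uf powi j * r)) \<longleftrightarrow> pw 1 ((v - u) / uf powi j - r)" for v r
  proof -
    have "v - (u + uf powi j * r) = uf powi j * ((v - u) / uf powi j - r)" using uf_nz by (simp add: field_simps)
    thus ?thesis by (simp add: pw_mult_iff)
  qed
  have "(\<Sum>r\<in>R. f r) \<in> Sg" using f(1) by (rule S.subspace_sum[OF Sg_sub])
  moreover have "FF (\<Sum>r\<in>R. f r) v = (if pw j (v - u) then sm (lift (\<Phi> v)) x else 0)" for v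
  proof -
    have s: "FF (\<Sum>r\<in>R. f r) v = (\<Sum>r\<in>R. if pw 1 ((v - u) / uf powi j - r) then sm (lift (\<Phi> v)) x else 0)"
      unfolding FF_sum by (rule sum.cong[OF refl]) (simp only: f(2) iff)
    have o: "pw 0 ((v - u) / uf powi j) \<longleftrightarrow> pw j (v - u)" by (subst pw_divide_iff) auto
    show ?thesis
    proof (cases "pw j (v - u)")
      case True
      then obtain r where r: "r \<in> R" "pw 1 ((v - u) / uf powi j - r)"
        using transv_R o unfolding transv_def by (metis of_nat_1)
      have "(\<Sum>r\<in>R. if pw 1 ((v - u) / uf powi j - r) then sm (lift (\<Phi> v)) x else 0) =
        (if pw 1 ((v - u) / uf powi j - r) then sm (lift (\<Phi> v)) x else 0)"
      proof (rule sum_single[OF fin_R r(1)])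
        fix r' assume r': "r' \<in> R" "r' \<noteq> r"
        hence "\<not> pw 1 ((v - u) / uf powi j - r')"
          using transv_unique[OF transv_R r'(1) r(1), of "(v - u) / uf powi j"] r(2) by auto
        thus "(if pw 1 ((v - u) / uf powi j - r') then sm (lift (\<Phi> v)) x else 0) = 0" by simp
      qed
      thus ?thesis using s r(2) True by simp
    next
      case False
      have "\<not> pw 1 ((v - u) / uf powi j - r)" if "r \<in> R" for r
        using pw_add[OF pw_mono[of 1 "(v - u) / uf powi j - r" 0] R_pw[OF that]] o False by auto
      hence "(\<Sum>r\<in>R. if pw 1 ((v - u) / uf powi j - r) then sm (lift (\<Phi> v)) x else 0) = 0"
        by (intro sum.neutral) auto
      thus ?thesis using s False by simp
    qed
  qed
  ultimately show ?thesis unfolding ball_lift_def by blast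
qed

text \<open>Compactness of a ball, in the form: a bad ball contains a bad ball of the next smaller radius,
and the centres of such a chain converge.\<close>

lemma ball_lift_all:
  assumes "\<And>u. \<exists>n. \<forall>v. pw n (v - u) \<longrightarrow> \<Phi> v = \<Phi> u"
  shows "ball_lift \<Phi> u0 j0"
proof (rule ccontr)
  assume bad: "\<not> ball_lift \<Phi> u0 j0"
  have "\<exists>s. s 0 = u0 \<and> (\<forall>i. \<not> ball_lift \<Phi> (s i) (j0 + int i) \<and> pw (j0 + int i) (s (Suc i) - s i))"
  proof -
    have step: "\<exists>u'. \<not> ball_lift \<Phi> u' (j + 1) \<and> pw j (u' - u)" if bad': "\<not> ball_lift \<Phi> u j" for u j
    proof -
      obtain r where "r \<in> R" "\<not> ball_lift \<Phi> (u + uf powi j * r) (j + 1)" using ball_lift_refine[of \<Phi> u j] bad' by blast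
      moreover have "pw j (uf powi j * r)" if "r \<in> R" for r using R_pw[OF that] by (subst pw_mult_iff) auto
      ultimately show ?thesis by (intro exI[of _ "u + uf powi j * r"]) simp
    qed
    define s where "s = rec_nat u0 (\<lambda>i u. SOME u'. \<not> ball_lift \<Phi> u' (j0 + int i + 1) \<and> pw (j0 + int i) (u' - u))"
    have sS: "s (Suc i) = (SOME u'. \<not> ball_lift \<Phi> u' (j0 + int i + 1) \<and> pw (j0 + int i) (u' - s i))" for i
      by (simp add: s_def)
    have s0: "s 0 = u0" by (simp add: s_def)
    have s1: "\<not> ball_lift \<Phi> (s (Suc i)) (j0 + int i + 1) \<and> pw (j0 + int i) (s (Suc i) - s i)"
      if "\<not> ball_lift \<Phi> (s i) (j0 + int i)" for i
      unfolding sS by (rule someI_ex[OF step[OF that]])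
    have s2: "\<not> ball_lift \<Phi> (s i) (j0 + int i)" for i
    proof (induction i)
      case 0
      show ?case using bad s0 by simp
    next
      case (Suc i)
      thus ?case using s1[OF Suc] by (simp add: add_ac)
    qed
    show ?thesis using s0 s1 s2 by blast
  qed
  then obtain s where s: "\<And>i. \<not> ball_lift \<Phi> (s i) (j0 + int i)" "\<And>i. pw (j0 + int i) (s (Suc i) - s i)" by blast
  have cau: "pw (j0 + int i) (s (i + k) - s i)" for i k
  proof (induction k)
    case (Suc k)
    have "pw (j0 + int i) (s (Suc (i + k)) - s (i + k))" by (rule pw_mono[OF s(2)]) simp
    thus ?case using pw_trans[OF _ Suc] by simp
  qed simp
  have cau2: "pw (j0 + int i) (s m - s n)" if "m \<ge> i" "n \<ge> i" for i m n
    using pw_trans[OF cau[of i "m - i"] pw_diff_commute[OF cau[of i "n - i"]]] that by simp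
  have "\<exists>L. \<forall>N. \<exists>M. \<forall>n\<ge>M. pw N (s n - L)"
  proof (rule complete)
    fix N
    have "pw N (s m - s n)" if "m \<ge> nat (N - j0)" "n \<ge> nat (N - j0)" for m n
      by (rule pw_mono[OF cau2[OF that]]) simp
    thus "\<exists>M. \<forall>m\<ge>M. \<forall>n\<ge>M. pw N (s m - s n)" by blast
  qed
  then obtain L where L: "\<And>N. \<exists>M. \<forall>n\<ge>M. pw N (s n - L)" by blast
  obtain n where n: "\<And>v. pw n (v - L) \<Longrightarrow> \<Phi> v = \<Phi> L" using assms by blast
  obtain M where M: "\<And>i. i \<ge> M \<Longrightarrow> pw n (s i - L)" using L[of n] by blast
  define i where "i = max M (nat (n - j0))"
  have iM: "pw n (s i - L)" using M by (simp add: i_def)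
  have "ball_lift \<Phi> (s i) (j0 + int i)"
  proof (rule ball_lift_const)
    fix v assume "pw (j0 + int i) (v - s i)"
    hence "pw n (v - s i)" by (rule pw_mono) (simp add: i_def)
    hence "pw n (v - L)" using iM by (rule pw_trans)
    thus "\<Phi> v = \<Phi> (s i)" using n[of v] n[OF iM] by simp
  qed
  thus False using s(1) by blast
qed

lemma hh_surj: assumes \<Psi>: "\<Psi> \<in> IndP1 val" shows "\<exists>f\<in>Sg. \<forall>g\<in>GL2. hh f g = \<Psi> g - \<Psi> m2one"
proof -
  have PB: "\<Psi> (m2mult b g) = \<Psi> g" if "b \<in> Borel" "g \<in> GL2" for b g
    using \<Psi> that unfolding IndP1_def by blast
  have Ps: "\<exists>n\<ge>1. \<forall>k\<in>Kcong val n. \<Psi> (m2mult g k) = \<Psi> g" if "g \<in> GL2" for g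
    using \<Psi> that unfolding IndP1_def by blast
  \<comment> \<open>Subtracting the value at 1 makes the function vanish on P and, by local
    constancy at 1, have bounded support on the big cell. The factor is \<delta> of the determinant
    -1 of s n(v) and undoes the division in \<open>hh\<close>.\<close>
  define \<Phi> where "\<Phi> v = \<delta> (- 1) * (\<Psi> (M2 0 1 1 v) - \<Psi> m2one)" for v
  have loc: "\<exists>n. \<forall>v. pw n (v - u) \<longrightarrow> \<Phi> v = \<Phi> u" for u
  proof -
    obtain n where n: "\<And>k. k \<in> Kcong val n \<Longrightarrow> \<Psi> (m2mult (M2 0 1 1 u) k) = \<Psi> (M2 0 1 1 u)"
      using Ps[of "M2 0 1 1 u"] by auto
    have "\<Phi> v = \<Phi> u" if "pw (int n) (v - u)" for v
    proof -
      have "m2mult (M2 0 1 1 u) (nn (v - u)) = M2 0 1 1 v" by (simp add: nn_def)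
      thus ?thesis using n[OF nn_Kcong[OF that]] by (simp add: \<Phi>_def)
    qed
    thus ?thesis by blast
  qed
  have formula: "\<Psi> (M2 a b c d) = \<Psi> (M2 0 1 1 (d / c))" if "c \<noteq> 0" "a * d - b * c \<noteq> 0" for a b c d
  proof -
    have "m2mult (M2 (b - a * d / c) a 0 c) (M2 0 1 1 (d / c)) = M2 a b c d"
      using that by (simp add: field_simps)
    moreover have "b - a * d / c \<noteq> 0" using that by (auto simp: field_simps)
    ultimately show ?thesis using PB[of "M2 (b - a * d / c) a 0 c" "M2 0 1 1 (d / c)"] that by simp
  qed
  obtain m where m: "\<And>k. k \<in> Kcong val m \<Longrightarrow> \<Psi> (m2mult m2one k) = \<Psi> m2one" using Ps[OF m2one_GL2] by blast
  have supp: "\<Phi> v = 0" if v: "\<not> pw (- int m) v" for v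
  proof -
    have v0: "v \<noteq> 0" using v by auto
    have "pw (int m) (1 / v)" using v v0 by (auto simp: in_pow_def val_divide)
    hence "\<Psi> (nb (1 / v)) = \<Psi> m2one" using m[OF nb_Kcong] by simp
    moreover have "\<Psi> (nb (1 / v)) = \<Psi> (M2 0 1 1 v)"
      using formula[of "1 / v" 1 1 0] v0 by (simp add: nb_def)
    ultimately show ?thesis by (simp add: \<Phi>_def)
  qed
  have "ball_lift \<Phi> 0 (- int m)" by (rule ball_lift_all[OF loc])
  then obtain f where f: "f \<in> Sg" "\<And>v. FF f v = (if pw (- int m) v then sm (lift (\<Phi> v)) x else 0)"
    unfolding ball_lift_def by auto
  have FFf: "FF f v = sm (lift (\<Phi> v)) x" for v
  proof (cases "pw (- int m) v")
    case False
    have "sm (lift (\<Phi> v)) x = sm 0 x" unfolding sm_x_eq using supp[OF False] by simp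
    thus ?thesis using f(2)[of v] False by simp
  qed (simp add: f(2))
  have ssnn: "hh f (M2 0 1 1 v) = \<Psi> (M2 0 1 1 v) - \<Psi> m2one" for v
  proof -
    have "cf f (M2 0 1 1 v) = red (lift (\<Phi> v))"
      by (rule cfI[OF f(1)]) (use FFf[of v] in \<open>simp_all add: FF_def\<close>)
    hence "cf f (M2 0 1 1 v) = \<Phi> v" by simp
    thus ?thesis using delta_nz[of "- 1"] by (simp add: hh_def \<Phi>_def)
  qed
  have "hh f g = \<Psi> g - \<Psi> m2one" if g: "g \<in> GL2" for g
  proof -
    obtain a b c d where g': "g = M2 a b c d" by (cases g)
    show ?thesis
    proof (cases "c = 0")
      case True
      hence "g \<in> Borel" using g by (simp add: g')
      thus ?thesis using hh_Borel[OF f(1), of g m2one] hh_one[OF f(1)] PB[of g m2one] by simp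
    next
      case False
      have e: "m2mult (M2 (b - a * d / c) a 0 c) (M2 0 1 1 (d / c)) = g"
        using False by (simp add: g' field_simps)
      have "b - a * d / c \<noteq> 0" using False g by (auto simp: field_simps g')
      hence "hh f g = hh f (M2 0 1 1 (d / c))"
        using hh_Borel[OF f(1), of "M2 (b - a * d / c) a 0 c" "M2 0 1 1 (d / c)", unfolded e] False by simp
      thus ?thesis using ssnn formula[OF False] g by (simp add: g')
    qed
  qed
  thus ?thesis using f(1) by blast
qed

text \<open>Any \<open>I\<^sub>1\<close>-fixed vector of which \<open>w\<close> is a multiple has a nonzero value at \<open>\<Pi>\<close>.\<close>

lemma value_at_Pi:
  assumes f: "f \<in> Sg" "w = smf a f"
  shows "f (PiElt uf) \<noteq> 0" "sm uE (f (PiElt uf)) = 0"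
    "\<And>g b. g \<in> GL2 \<Longrightarrow> red b = \<delta> (m2det g) \<Longrightarrow> ac g (f (PiElt uf)) = sm b (f (PiElt uf))"
proof -
  have G: "PiElt uf \<in> GL2" by (simp add: PiElt_def)
  \<comment> \<open>\<Pi> is diag(1, uf) s, so the value at \<Pi> is \<theta> applied to the value
    at s.\<close>
  have D: "f (PiElt uf) = ac (M2 1 0 0 uf) (FF f 0)"
    using C_formula[OF SgC[OF f(1)], of uf 0 0 1] by (simp add: PiElt_def)
  have "x = FF (smf a f) 0" unfolding x_def by (rule arg_cong[OF f(2), of "\<lambda>h. FF h 0"])
  hence "sm a (FF f 0) = x" by (simp only: FF_smf)
  hence "FF f 0 \<noteq> 0" using x_nz by auto
  thus "f (PiElt uf) \<noteq> 0" unfolding D by (simp add: ac_eq_0)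
  show "sm uE (f (PiElt uf)) = 0" by (rule kill_val[OF f(1)])
  fix g b assume g: "g \<in> GL2" "red b = \<delta> (m2det g)"
  have "ac g (f (PiElt uf)) = ac g (sm (lift (cf f (PiElt uf))) x)" using cf_val[OF f(1) G] by simp
  also have "\<dots> = sm (lift (cf f (PiElt uf))) (sm b x)" using g by (simp add: ac_sm ac_x_delta)
  also have "\<dots> = sm b (f (PiElt uf))" using cf_val[OF f(1) G] by (simp add: mult.commute)
  finally show "ac g (f (PiElt uf)) = sm b (f (PiElt uf))" .
qed

text \<open>Modulo p such a matrix is n(b) with b integral, and w has level one.\<close>

lemma w_Iwahori: assumes "k \<in> Iwahori1 val" shows "act k w = w"
proof -
  obtain a b c d where k: "k = M2 a b c d" by (cases k)
  have kc: "pw 1 (a - 1)" "pw 0 b" "pw 1 c" "pw 1 (d - 1)" using assms by (auto simp: k Iwahori1_def)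
  have "k \<in> KK" by (rule Iwahori1_KK[OF assms])
  moreover have "mcong 1 k (nn b)"
    using kc pw_diff_commute by (simp add: k mcong_def nn_def)
  ultimately have "act k w = act (nn b) w"
    by (intro act_mcong[OF w_kfix] KK_gens) (use kc in auto)
  thus ?thesis using w_nfix kc(2) by (simp add: nfix_def)
qed

end

section \<open>The defect of equivariance\<close>

locale borel_map = smooth_mod val uf p uE red sm' ac' + src: smooth_mod val uf p uE red sm ac
  for val :: "'f::field \<Rightarrow> int" and uf :: 'f and p :: nat
    and uE :: "'o::idom" and red :: "'o \<Rightarrow> 'k::field"
    and sm :: "'o \<Rightarrow> 'v::ab_group_add \<Rightarrow> 'v" and ac :: "'f m2 \<Rightarrow> 'v \<Rightarrow> 'v"
    and sm' :: "'o \<Rightarrow> 'w::ab_group_add \<Rightarrow> 'w" and ac' :: "'f m2 \<Rightarrow> 'w \<Rightarrow> 'w" +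
  fixes \<phi> :: "'v \<Rightarrow> 'w"
  assumes phi_add: "\<And>x y. \<phi> (x + y) = \<phi> x + \<phi> y"
    and phi_sm: "\<And>a x. \<phi> (sm a x) = sm' a (\<phi> x)"
    and phi_Borel: "\<And>b x. b \<in> Borel \<Longrightarrow> \<phi> (ac b x) = ac' b (\<phi> x)"
begin

definition defect :: "'v \<Rightarrow> 'f m2 \<Rightarrow> 'w" where
  "defect s = (\<lambda>g. if g \<in> GL2 then ac' g (\<phi> s) - \<phi> (ac g s) else 0)"

definition equiv_part :: "'v set" where
  "equiv_part = {s. \<forall>g\<in>GL2. \<phi> (ac g s) = ac' g (\<phi> s)}"

lemma phi_diff: "\<phi> (x - y) = \<phi> x - \<phi> y" using phi_add[of "x - y" y] by (simp add: eq_diff_eq)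

lemma defect_add: "defect (s + t) = defect s + defect t"
  by (auto simp: defect_def fun_eq_iff phi_add ac_add src.ac_add)
lemma defect_diff: "defect (s - t) = defect s - defect t"
  by (auto simp: defect_def fun_eq_iff phi_diff ac_diff src.ac_diff)
lemma defect_0 [simp]: "defect 0 = 0" using defect_diff[of 0 0] by simp
lemma defect_minus: "defect (- s) = - defect s" using defect_diff[of 0 s] by simp
lemma defect_sm: "defect (sm a s) = smf a (defect s)"
  by (auto simp: defect_def smf_def fun_eq_iff phi_sm ac_sm src.ac_sm W.scale_right_diff_distrib)
lemma defect_ac: "h \<in> GL2 \<Longrightarrow> defect (ac h s) = act h (defect s)"
  by (auto simp: defect_def act_def fun_eq_iff ac_mult src.ac_mult ac_diff)

lemma defect_eq_0: "defect s = 0 \<longleftrightarrow> s \<in> equiv_part"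
  by (auto simp: defect_def equiv_part_def fun_eq_iff)

lemma defect_eq_iff: "defect s = defect t \<longleftrightarrow> s - t \<in> equiv_part"
  by (simp add: defect_diff flip: defect_eq_0)

lemma defect_C: "defect s \<in> C"
proof -
  obtain m where m: "m \<ge> 1" "\<And>k. k \<in> Kcong val m \<Longrightarrow> ac k s = s" using src.ac_smooth by blast
  obtain n where n: "n \<ge> 1" "\<And>k. k \<in> Kcong val n \<Longrightarrow> ac' k (\<phi> s) = \<phi> s" using ac_smooth by blast
  have "defect s (m2mult g k) = defect s g" if k: "k \<in> Kcong val (max m n)" and g: "g \<in> GL2" for k g
  proof -
    have km: "k \<in> Kcong val m" "k \<in> Kcong val n" using Kcong_mono[OF _ k] by auto
    have kG: "k \<in> GL2" using Kcong_KK[OF n(1) km(2)] KK_GL2 by blast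
    show ?thesis using g kG by (simp add: defect_def ac_mult src.ac_mult m(2)[OF km(1)] n(2)[OF km(2)])
  qed
  hence "\<exists>n\<ge>1. \<forall>k\<in>Kcong val n. \<forall>g\<in>GL2. defect s (m2mult g k) = defect s g"
    using m(1) by (intro exI[of _ "max m n"]) auto
  moreover have "defect s (m2mult b g) = ac' b (defect s g)" if "b \<in> Borel" "g \<in> GL2" for b g
    using that Borel_GL2[OF that(1)] by (simp add: defect_def ac_mult src.ac_mult phi_Borel ac_diff)
  ultimately show ?thesis by (simp add: C_def defect_def)
qed

lemma OG_submodule_preimage:
  assumes S: "OG_submodule sm ac S" and N: "S.subspace N" "\<And>g f. g \<in> GL2 \<Longrightarrow> f \<in> N \<Longrightarrow> act g f \<in> N"
  shows "OG_submodule sm ac {s \<in> S. defect s \<in> N}"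
  using S S.subspace_0[OF N(1)] S.subspace_add[OF N(1)] S.subspace_neg[OF N(1)] S.subspace_scale[OF N(1)] N(2)
  by (simp add: OG_submodule_def defect_add defect_minus defect_sm defect_ac)

text \<open>On S the map \<open>defect\<close> has kernel \<open>equiv_part\<close>, so G-stable
  subspaces of the image correspond to submodules between \<open>equiv_part\<close> and S;
  irreducibility and the central character pass to the image.\<close>

lemma sigma_defect:
  assumes irr: "irred_subquot sm ac equiv_part S" and cc: "has_central_char sm ac equiv_part S"
  shows "\<exists>\<chi>. sigma val uf p uE red sm' ac' (defect ` S) \<chi>"
proof -
  have S: "OG_submodule sm ac S" and ES: "equiv_part \<subset> S"
    and max: "\<And>N. OG_submodule sm ac N \<Longrightarrow> equiv_part \<subseteq> N \<Longrightarrow> N \<subseteq> S \<Longrightarrow> N = equiv_part \<or> N = S"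
    using irr unfolding irred_subquot_def by blast+
  obtain \<chi> where \<chi>: "\<And>z s. z \<noteq> 0 \<Longrightarrow> s \<in> S \<Longrightarrow> ac (scalar_m2 z) s - sm (\<chi> z) s \<in> equiv_part"
    using cc unfolding has_central_char_def by blast
  have "sigma val uf p uE red sm' ac' (defect ` S) \<chi>"
  proof unfold_locales
    show "defect ` S \<subseteq> C" using defect_C by blast
    show "S.subspace (defect ` S)"
    proof (rule S.subspaceI)
      show "0 \<in> defect ` S" using S unfolding OG_submodule_def by (intro image_eqI[of _ _ 0]) simp_all
      show "f + f' \<in> defect ` S" if "f \<in> defect ` S" "f' \<in> defect ` S" for f f'
      proof -
        obtain s t where st: "s \<in> S" "t \<in> S" "f = defect s" "f' = defect t" using \<open>f \<in> _\<close> \<open>f' \<in> _\<close> by blast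
        have "s + t \<in> S" using S st(1,2) by (simp add: OG_submodule_def)
        thus ?thesis unfolding st(3,4) defect_add[symmetric] by (rule imageI)
      qed
      show "smf a f \<in> defect ` S" if "f \<in> defect ` S" for a f
      proof -
        obtain s where s: "s \<in> S" "f = defect s" using \<open>f \<in> _\<close> by blast
        have "sm a s \<in> S" using S s(1) by (simp add: OG_submodule_def)
        thus ?thesis unfolding s(2) defect_sm[symmetric] by (rule imageI)
      qed
    qed
    show "act g f \<in> defect ` S" if g: "g \<in> GL2" and f: "f \<in> defect ` S" for g f
    proof -
      obtain s where s: "s \<in> S" "f = defect s" using f by blast
      have "ac g s \<in> S" using S s(1) g by (simp add: OG_submodule_def)
      thus ?thesis unfolding s(2) defect_ac[OF g, symmetric] by (rule imageI)
    qed
    show "N = {0} \<or> N = defect ` S" if N: "N \<subseteq> defect ` S" "S.subspace N"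
      "\<And>g f. g \<in> GL2 \<Longrightarrow> f \<in> N \<Longrightarrow> act g f \<in> N" for N
    proof -
      define M where "M = {s \<in> S. defect s \<in> N}"
      have N0: "0 \<in> N" by (rule S.subspace_0[OF N(2)])
      have "M = equiv_part \<or> M = S"
      proof (rule max)
        show "OG_submodule sm ac M" unfolding M_def by (rule OG_submodule_preimage[OF S N(2,3)])
        show "M \<subseteq> S" by (auto simp: M_def)
        show "equiv_part \<subseteq> M"
        proof
          fix s assume s: "s \<in> equiv_part"
          hence "defect s = 0" by (simp add: defect_eq_0)
          thus "s \<in> M" using s ES N0 by (auto simp: M_def)
        qed
      qed
      thus ?thesis
      proof
        assume M: "M = equiv_part"
        have "f = 0" if f: "f \<in> N" for f
        proof -
          obtain s where s: "s \<in> S" "f = defect s" using N(1) f by blast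
          hence "s \<in> M" using f by (simp add: M_def)
          thus "f = 0" unfolding M s(2) by (simp only: defect_eq_0)
        qed
        thus ?thesis using N0 by blast
      next
        assume "M = S"
        thus ?thesis using N(1) by (auto simp: M_def)
      qed
    qed
    show "defect ` S \<noteq> {0}"
    proof
      assume *: "defect ` S = {0}"
      obtain s where s: "s \<in> S" "s \<notin> equiv_part" using ES by blast
      hence "defect s = 0" using * by blast
      thus False using s(2) by (simp only: defect_eq_0 simp_thms)
    qed
    show "act (scalar_m2 z) f = smf (\<chi> z) f" if z: "z \<noteq> 0" and f: "f \<in> defect ` S" for z f
    proof -
      obtain s where s: "s \<in> S" "f = defect s" using f by blast
      have "defect (ac (scalar_m2 z) s) = defect (sm (\<chi> z) s)" using \<chi>[OF z s(1)] by (simp only: defect_eq_iff)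
      thus ?thesis unfolding s(2) by (simp only: defect_ac[OF scalar_GL2[OF z]] defect_sm)
    qed
  qed
  thus ?thesis by blast
qed

end

text \<open>\<open>smf uE\<close> is an endomorphism of an irreducible module, so its image is everything or zero.\<close>

lemma (in sigma) uniformizer_kills: "sigma_kill val uf p uE red sm ac Sg \<chi>"
proof -
  let ?N = "smf uE ` Sg"
  have "?N = {0} \<or> ?N = Sg"
  proof (rule irr)
    show "?N \<subseteq> Sg" using S.subspace_scale[OF Sg_sub] by blast
    show "S.subspace ?N"
    proof (rule S.subspaceI)
      show "0 \<in> ?N" using Sg0 by (intro image_eqI[of _ _ 0]) simp_all
      show "f + f' \<in> ?N" if "f \<in> ?N" "f' \<in> ?N" for f f'
      proof -
        obtain s t where st: "s \<in> Sg" "t \<in> Sg" "f = smf uE s" "f' = smf uE t" using \<open>f \<in> _\<close> \<open>f' \<in> _\<close> by blast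
        show ?thesis unfolding st(3,4) S.scale_right_distrib[symmetric]
          by (rule imageI) (rule S.subspace_add[OF Sg_sub st(1,2)])
      qed
      show "smf a f \<in> ?N" if "f \<in> ?N" for a f
      proof -
        obtain s where s: "s \<in> Sg" "f = smf uE s" using \<open>f \<in> _\<close> by blast
        show ?thesis unfolding s(2) S.scale_left_commute[of a]
          by (rule imageI) (rule S.subspace_scale[OF Sg_sub s(1)])
      qed
    qed
    show "act g f \<in> ?N" if g: "g \<in> GL2" and f: "f \<in> ?N" for g f
    proof -
      obtain s where s: "s \<in> Sg" "f = smf uE s" using f by blast
      show ?thesis unfolding s(2) act_smf by (rule imageI) (rule Sg_act[OF g s(1)])
    qed
  qed
  thus ?thesis
  proof
    assume N: "?N = Sg"
    interpret sigma_div val uf p uE red sm ac Sg \<chi>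
    proof unfold_locales
      show "\<exists>f'\<in>Sg. f = smf uE f'" if f: "f \<in> Sg" for f
      proof -
        have "f \<in> ?N" unfolding N by (rule f)
        thus ?thesis by blast
      qed
    qed
    show ?thesis using sigma_div_False ..
  next
    assume N: "?N = {0}"
    show ?thesis
    proof unfold_locales
      show "smf uE f = 0" if f: "f \<in> Sg" for f using imageI[OF f, of "smf uE"] unfolding N by (rule singletonD)
    qed
  qed
qed

lemma (in sigma_kill) ex_eigen_line: "\<exists>w \<alpha> \<psi>. eigen_line val uf p uE red sm ac Sg \<chi> w \<alpha> \<psi>"
proof -
  obtain w a \<psi> where "w \<in> A" "w \<noteq> 0" "U w = smf a w" "red a \<noteq> 0" "Teig \<psi> w"
    using ex_unit_eigenvector by blast
  hence "eigen_line val uf p uE red sm ac Sg \<chi> w a \<psi>" by unfold_locales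
  thus ?thesis by blast
qed

context borel_map
begin

text \<open>The last clause comes from the spanning property of v: the eigenfunction w is fixed by
  \<open>Iwahori1 val\<close>, so it is a multiple of \<open>defect v\<close>, and
  \<open>value_at_Pi\<close> applies to \<open>defect v\<close>.\<close>

lemma iso_Sp_twist:
  assumes S: "OG_submodule sm ac S" and e: "eigen_line val uf p uE red sm' ac' (defect ` S) \<chi> w \<alpha> \<psi>"
  shows "\<exists>\<delta> h. smooth_char val \<delta> \<and> iso_quot_Sp_twist val red sm ac equiv_part S \<delta> h \<and>
    (\<forall>v. v \<in> S \<and> (\<forall>s\<in>S. (\<forall>k\<in>Iwahori1 val. ac k s - s \<in> equiv_part) \<longrightarrow> (\<exists>a. s - sm a v \<in> equiv_part)) \<longrightarrow>
      (let D = defect v (PiElt uf) in D \<noteq> 0 \<and> sm' uE D = 0 \<and>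
        (\<forall>g\<in>GL2. \<forall>a. red a = \<delta> (m2det g) \<longrightarrow> ac' g D = sm' a D)))"
proof -
  interpret e: eigen_line val uf p uE red sm' ac' "defect ` S" \<chi> w \<alpha> \<psi> by (rule e)
  have dS: "defect s \<in> defect ` S" if "s \<in> S" for s using that by (rule imageI)
  have iso: "iso_quot_Sp_twist val red sm ac equiv_part S e.\<delta> (\<lambda>s. e.hh (defect s))"
    unfolding iso_quot_Sp_twist_def
  proof (intro conjI ballI allI)
    show "e.hh (defect s) \<in> IndP1 val" if "s \<in> S" for s by (rule e.hh_IndP1[OF dS[OF that]])
    show "eq_mod_const (e.hh (defect (s + t))) (\<lambda>x. e.hh (defect s) x + e.hh (defect t) x)" if "s \<in> S" "t \<in> S" for s t
      unfolding eq_mod_const_def defect_add e.hh_add[OF dS[OF that(1)] dS[OF that(2)]] by simp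
    show "eq_mod_const (e.hh (defect (sm a s))) (\<lambda>x. red a * e.hh (defect s) x)" if "s \<in> S" for a s
      unfolding eq_mod_const_def defect_sm e.hh_smf[OF dS[OF that]] by simp
    show "eq_mod_const (e.hh (defect (ac g s))) (\<lambda>x. e.\<delta> (m2det g) * e.hh (defect s) (m2mult x g))"
      if g: "g \<in> GL2" and s: "s \<in> S" for g s
      unfolding eq_mod_const_def defect_ac[OF g]
      using e.hh_act[OF dS[OF s] g] by (intro exI[of _ "- e.cf (defect s) g"]) simp
    show "eq_mod_const (e.hh (defect s)) (\<lambda>x. 0) \<longleftrightarrow> s \<in> equiv_part" if s: "s \<in> S" for s
    proof
      assume "eq_mod_const (e.hh (defect s)) (\<lambda>x. 0)"
      then obtain c where c: "\<And>g. g \<in> GL2 \<Longrightarrow> e.hh (defect s) g = c" unfolding eq_mod_const_def by auto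
      \<comment> \<open>Every \<open>hh\<close> vanishes at the identity, so a constant one is
        0.\<close>
      have "c = 0" using c[OF m2one_GL2] e.hh_one[OF dS[OF s]] by simp
      hence "defect s g = 0" if "g \<in> GL2" for g using c[OF that] e.hh_zero_iff[OF dS[OF s] that] by simp
      hence "defect s = 0" by (auto simp: fun_eq_iff defect_def)
      thus "s \<in> equiv_part" by (simp only: defect_eq_0)
    next
      assume "s \<in> equiv_part"
      hence "defect s g = 0" for g by (simp add: defect_def equiv_part_def)
      hence "e.hh (defect s) g = 0" if "g \<in> GL2" for g using e.hh_zero_iff[OF dS[OF s] that] by simp
      thus "eq_mod_const (e.hh (defect s)) (\<lambda>x. 0)" unfolding eq_mod_const_def by simp
    qed
    show "\<exists>s\<in>S. eq_mod_const (e.hh (defect s)) \<Psi>" if \<Psi>: "\<Psi> \<in> IndP1 val" for \<Psi>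
    proof -
      obtain f where f: "f \<in> defect ` S" "\<And>g. g \<in> GL2 \<Longrightarrow> e.hh f g = \<Psi> g - \<Psi> m2one"
        using e.hh_surj[OF \<Psi>] by blast
      obtain s where s: "s \<in> S" "f = defect s" using f(1) by blast
      have "eq_mod_const (e.hh (defect s)) \<Psi>"
        unfolding eq_mod_const_def using f(2) s(2) by (intro exI[of _ "- \<Psi> m2one"]) simp
      thus ?thesis using s(1) by blast
    qed
  qed
  have "let D = defect v (PiElt uf) in D \<noteq> 0 \<and> sm' uE D = 0 \<and>
        (\<forall>g\<in>GL2. \<forall>a. red a = e.\<delta> (m2det g) \<longrightarrow> ac' g D = sm' a D)"
    if v: "v \<in> S" "\<And>s. s \<in> S \<Longrightarrow> (\<forall>k\<in>Iwahori1 val. ac k s - s \<in> equiv_part) \<Longrightarrow> \<exists>a. s - sm a v \<in> equiv_part" for v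
  proof -
    obtain s where s: "s \<in> S" "w = defect s" using e.wS by blast
    have "ac k s - s \<in> equiv_part" if k: "k \<in> Iwahori1 val" for k
    proof -
      have "defect (ac k s) = defect s"
        using e.w_Iwahori[OF k] unfolding s(2) defect_ac[OF KK_GL2[OF Iwahori1_KK[OF k]]] .
      thus ?thesis by (simp only: defect_eq_iff)
    qed
    then obtain a where "s - sm a v \<in> equiv_part" using v(2)[OF s(1)] by blast
    hence "w = smf a (defect v)" unfolding s(2) by (simp only: defect_eq_iff flip: defect_sm)
    from e.value_at_Pi[OF dS[OF v(1)] this] show ?thesis unfolding Let_def by blast
  qed
  thus ?thesis using e.smooth_char_delta iso by (intro exI[of _ e.\<delta>] exI[of _ "\<lambda>s. e.hh (defect s)"]) blast
qed

end

theorem theorem6p1: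
  fixes val :: "'f::field \<Rightarrow> int" and uf :: 'f and p :: nat
    and uE :: "'o::idom" and red :: "'o \<Rightarrow> 'k::field"
    and sm :: "'o \<Rightarrow> 'v::ab_group_add \<Rightarrow> 'v" and ac :: "'f m2 \<Rightarrow> 'v \<Rightarrow> 'v"
    and sm' :: "'o \<Rightarrow> 'w::ab_group_add \<Rightarrow> 'w" and ac' :: "'f m2 \<Rightarrow> 'w \<Rightarrow> 'w"
    and \<phi> :: "'v \<Rightarrow> 'w"
    and \<tau> S :: "'v set"
  assumes F: "nonarch_local_field val uf p"
    and k: "alg_closure_Fp p TYPE('k)"
    and O: "complete_dvr_with_residue uE red"
    and pi: "smooth_OG_module val sm ac"
    and pi': "smooth_OG_module val sm' ac'"
    and fl: "finite_length sm ac"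
    and cc: "\<forall>A B. irred_subquot sm ac A B \<longrightarrow> has_central_char sm ac A B"
    and phi_add: "\<forall>x y. \<phi> (x + y) = \<phi> x + \<phi> y"
    and phi_O: "\<forall>a x. \<phi> (sm a x) = sm' a (\<phi> x)"
    and phi_P: "\<forall>b\<in>Borel. \<forall>x. \<phi> (ac b x) = ac' b (\<phi> x)"
    and not_G: "\<exists>g\<in>GL2. \<exists>x. \<phi> (ac g x) \<noteq> ac' g (\<phi> x)"
    and tau: "\<tau> = {w. \<forall>g\<in>GL2. \<phi> (ac g w) = ac' g (\<phi> w)}"
    and sigma: "irred_subquot sm ac \<tau> S"
  shows "\<exists>(\<delta>::'f \<Rightarrow> 'k) h. smooth_char val \<delta> \<and> iso_quot_Sp_twist val red sm ac \<tau> S \<delta> h \<and>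
     (\<forall>v. v \<in> S \<and> (\<forall>k\<in>Iwahori1 val. ac k v - v \<in> \<tau>) \<and>
          (\<forall>s\<in>S. (\<forall>k\<in>Iwahori1 val. ac k s - s \<in> \<tau>) \<longrightarrow> (\<exists>a. s - sm a v \<in> \<tau>))
        \<longrightarrow> (let D = ac' (PiElt uf) (\<phi> v) - \<phi> (ac (PiElt uf) v) in
              D \<noteq> 0 \<and> sm' uE D = 0 \<and>
              (\<forall>g\<in>GL2. \<forall>a. red a = \<delta> (m2det g) \<longrightarrow> ac' g D = sm' a D)))"
proof -
  interpret borel_map val uf p uE red sm ac sm' ac' \<phi>
  proof
    show "prime p" using F by (simp add: nonarch_local_field_def)
  qed (use F k O pi pi' phi_add phi_O phi_P in blast)+
  have T: "equiv_part = \<tau>" by (simp add: equiv_part_def tau)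
  obtain \<chi> where s: "sigma val uf p uE red sm' ac' (defect ` S) \<chi>"
    using sigma_defect[unfolded T, OF sigma] cc sigma by blast
  obtain w \<alpha> \<psi> where "eigen_line val uf p uE red sm' ac' (defect ` S) \<chi> w \<alpha> \<psi>"
    using sigma_kill.ex_eigen_line[OF sigma.uniformizer_kills[OF s]] by blast
  moreover have "OG_submodule sm ac S" using sigma by (simp add: irred_subquot_def)
  ultimately obtain \<delta> :: "'f \<Rightarrow> 'k" and h where *: "smooth_char val \<delta>" "iso_quot_Sp_twist val red sm ac \<tau> S \<delta> h"
    "\<And>v. v \<in> S \<Longrightarrow> (\<forall>s\<in>S. (\<forall>k\<in>Iwahori1 val. ac k s - s \<in> \<tau>) \<longrightarrow> (\<exists>a. s - sm a v \<in> \<tau>)) \<Longrightarrow>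
      (let D = defect v (PiElt uf) in D \<noteq> 0 \<and> sm' uE D = 0 \<and>
        (\<forall>g\<in>GL2. \<forall>a. red a = \<delta> (m2det g) \<longrightarrow> ac' g D = sm' a D))"
    using iso_Sp_twist[unfolded T] by blast
  have "defect v (PiElt uf) = ac' (PiElt uf) (\<phi> v) - \<phi> (ac (PiElt uf) v)" for v
    by (simp add: defect_def PiElt_def)
  thus ?thesis using * by (intro exI[of _ \<delta>] exI[of _ h]) simp
qed

end
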